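(* Communicating finite-state machines (CFMs) and the logic $\mathrm{EMSO}^2[\to,\lhd,\le]$ are expressively equivalent over MSCs: for every CFM $\mathcal A$ over $P$ and $\Sigma$ there is a sentence $\varphi\in\mathrm{EMSO}^2[\to,\lhd,\le]$ with $L(\mathcal A)=L(\varphi)$, and for every sentence $\varphi\in\mathrm{EMSO}^2[\to,\lhd,\le]$ there is a CFM $\mathcal A$ over $P$ and $\Sigma$ with $L(\mathcal A)=L(\varphi)$.
   Context: Fix a finite set $P$ of processes and a finite alphabet $\Sigma$. A message sequence chart (MSC) over $P$ and $\Sigma$ is $M=((w_p)_{p\in P},\lhd)$ with $w_p\in\Sigma^*$, at least one of them nonempty. Its events are $E=\bigcup_{p}E_p$ with $E_p=\{p\}\times\{1,\dots,|w_p|\}$; the process relation $\to$ is given by $(p,i)\to(p,i+1)$ for $1\le i<|w_p|$; the labelling is $\lambda(p,i)=(p,a)$ where $a$ is the $i$-th letter of $w_p$. The message relation $\lhd\subseteq\bigcup_{p\neq q}E_p\times E_q$ must satisfy: $\to\cup\lhd$ is acyclic; each event belongs to at most one pair of $\lhd$; (FIFO) for $p\neq q$ and $(e,f),(e',f')\in\lhd\cap(E_p\times E_q)$, $e\to^*e'$ iff $f\to^*f'$. Let $\le=(\to\cup\lhd)^*$ and $<=(\to\cup\lhd)^+$. An event in no $\lhd$-pair is internal. A CFM over $P$ and $\Sigma$ is $\mathcal A=((\mathcal A_p)_{p\in P},\mathit{Msg},\mathit{Acc})$ where $\mathit{Msg}$ is a finite set of messages, $\mathcal A_p=(S_p,\iota_p,\Delta_p)$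 with $S_p$ finite, $\iota_p\in S_p$, $\Delta_p\subseteq S_p\times\mathit{Act}_p\times S_p$ where $\mathit{Act}_p=\Sigma\cup(\Sigma\times\{!,?\}\times\mathit{Msg}\times(P\setminus\{p\}))$, and $\mathit{Acc}\subseteq\prod_pS_p$. A transition with action $a\in\Sigma$ is internal; with action $(a,!,m,q)$ it sends $m$ to $q$; with $(a,?,m,q)$ it receives $m$ from $q$; in each case its label is $a$. A run on an MSC $M$ maps each $e\in E_p$ to a transition $\rho(e)\in\Delta_p$ such that: the label of $\rho(e)$ is the $\Sigma$-component of $\lambda(e)$; for each $p$ with $E_p\neq\emptyset$, $\rho((p,1))$ has source $\iota_p$; if $e\to f$ then the target of $\rho(e)$ is the source of $\rho(f)$; internal events are mapped to internal transitions; for $(e,f)\in\lhd$ with $e\in E_p$, $f\in E_q$, $\rho(e)$ has an action $(a,!,m,q)$ and $\rho(f)$ has an action $(b,?,m,p)$ with the same $m$. The run is accepting if $(s_p)_{p}\in\mathit{Acc}$, where $s_p$ is the target of $\rho$ at the last event of $p$, or $\iota_p$ if $E_p=\emptyset$. $L(\mathcal A)$ is the set of MSCs admitting an accepting run. MSO formulas are given by $\varphi::=p(x)\mid a(x)\mid x\in X\mid x=y\mid x\to y\mid x\lhd y\mid x\le y\mid\varphi\vee\varphi\mid\neg\varphi\mid\exists x.\varphi\mid\exists X.\varphi$ ($p\in P$, $a\in\Sigma$), interpreted over MSCs with first-order variables ranging over events and second-order variables over sets of events; $p(x)$ means $x\in E_p$ and $a(x)$ means the $\Sigma$-label of $x$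 is $a$. $\mathrm{FO}^2$ is the fragment without second-order quantification using only the two first-order variables $x,y$ (which may be requantified). $\mathrm{EMSO}^2$ consists of formulas $\exists X_1\cdots\exists X_n.\psi$ with $\psi\in\mathrm{FO}^2$. The bracket $[\to,\lhd,\le]$ lists the allowed binary predicates (equality is always allowed). For a sentence $\varphi$, $L(\varphi)$ is the set of MSCs over $P$ and $\Sigma$ satisfying $\varphi$. *)

theory Defs
  imports Main "HOL-Library.FuncSet"
begin

type_synonym 'p event = "'p \<times> nat"

record ('p, 'a) msc =
  word :: "'p \<Rightarrow> 'a list"
  msg_rel :: "('p event \<times> 'p event) set"

definition events_on :: "('p, 'a) msc \<Rightarrow> 'p \<Rightarrow> 'p event set" where
  "events_on M p = {p} \<times> {1..length (word M p)}"

definition events :: "('p, 'a) msc \<Rightarrow> 'p event set" where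
  "events M = (\<Union>p. events_on M p)"

definition proc_rel :: "('p, 'a) msc \<Rightarrow> ('p event \<times> 'p event) set" where
  "proc_rel M = {((p, i), (p, i + 1)) | p i. 1 \<le> i \<and> i < length (word M p)}"

text \<open>Positions of events are counted from 1, list positions from 0.\<close>

definition letter :: "('p, 'a) msc \<Rightarrow> 'p event \<Rightarrow> 'a" where
  "letter M e = word M (fst e) ! (snd e - 1)"

definition causal_le :: "('p, 'a) msc \<Rightarrow> ('p event \<times> 'p event) set" where
  "causal_le M = (proc_rel M \<union> msg_rel M)\<^sup>*"

text \<open>
  The family of words is indexed by the set \<open>P\<close> of processes; it is represented by a total
  function that is empty outside \<open>P\<close>. In particular all events are located on processes in \<open>P\<close>.
\<close>

definition is_msc :: "'p set \<Rightarrow> 'a set \<Rightarrow> ('p, 'a) msc \<Rightarrow> bool" where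
  "is_msc P Sig M \<longleftrightarrow>
     (\<forall>p\<in>P. word M p \<in> lists Sig) \<and>
     (\<forall>p. p \<notin> P \<longrightarrow> word M p = []) \<and>
     (\<exists>p\<in>P. word M p \<noteq> []) \<and>
     msg_rel M \<subseteq> (\<Union>p\<in>P. \<Union>q\<in>P - {p}. events_on M p \<times> events_on M q) \<and>
     acyclic (proc_rel M \<union> msg_rel M) \<and>
     (\<forall>e\<in>events M. \<forall>(e1, f1)\<in>msg_rel M. \<forall>(e2, f2)\<in>msg_rel M.
        e \<in> {e1, f1} \<and> e \<in> {e2, f2} \<longrightarrow> (e1, f1) = (e2, f2)) \<and>
     (\<forall>p\<in>P. \<forall>q\<in>P. p \<noteq> q \<longrightarrow>
        (\<forall>(e, f) \<in> msg_rel M \<inter> (events_on M p \<times> events_on M q).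
         \<forall>(e', f') \<in> msg_rel M \<inter> (events_on M p \<times> events_on M q).
           (e, e') \<in> (proc_rel M)\<^sup>* \<longleftrightarrow> (f, f') \<in> (proc_rel M)\<^sup>*))"

datatype ('p, 'a, 'm) action =
    Internal (act_label: 'a)
  | Send (act_label: 'a) 'm 'p
  | Receive (act_label: 'a) 'm 'p

type_synonym ('p, 'a, 's, 'm) transition = "'s \<times> ('p, 'a, 'm) action \<times> 's"

definition source :: "('p, 'a, 's, 'm) transition \<Rightarrow> 's" where
  "source t = fst t"

definition act :: "('p, 'a, 's, 'm) transition \<Rightarrow> ('p, 'a, 'm) action" where
  "act t = fst (snd t)"

definition target :: "('p, 'a, 's, 'm) transition \<Rightarrow> 's" where
  "target t = snd (snd t)"

record ('p, 'a, 's, 'm) cfm =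
  msgs :: "'m set"
  states :: "'p \<Rightarrow> 's set"
  init :: "'p \<Rightarrow> 's"
  trans_on :: "'p \<Rightarrow> ('p, 'a, 's, 'm) transition set"
  acc :: "('p \<Rightarrow> 's) set"

definition actions_on :: "'p set \<Rightarrow> 'a set \<Rightarrow> 'm set \<Rightarrow> 'p \<Rightarrow> ('p, 'a, 'm) action set" where
  "actions_on P Sig Ms p =
     {Internal a | a. a \<in> Sig} \<union>
     {Send a m q | a m q. a \<in> Sig \<and> m \<in> Ms \<and> q \<in> P - {p}} \<union>
     {Receive a m q | a m q. a \<in> Sig \<and> m \<in> Ms \<and> q \<in> P - {p}}"

definition is_cfm :: "'p set \<Rightarrow> 'a set \<Rightarrow> ('p, 'a, 's, 'm) cfm \<Rightarrow> bool" where
  "is_cfm P Sig A \<longleftrightarrow>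
     finite (msgs A) \<and>
     (\<forall>p\<in>P. finite (states A p) \<and> init A p \<in> states A p \<and>
        trans_on A p \<subseteq> states A p \<times> actions_on P Sig (msgs A) p \<times> states A p) \<and>
     acc A \<subseteq> (\<Pi>\<^sub>E p\<in>P. states A p)"

definition is_run ::
    "('p, 'a, 's, 'm) cfm \<Rightarrow> ('p, 'a) msc \<Rightarrow> ('p event \<Rightarrow> ('p, 'a, 's, 'm) transition) \<Rightarrow> bool" where
  "is_run A M \<rho> \<longleftrightarrow>
     (\<forall>p. \<forall>e\<in>events_on M p. \<rho> e \<in> trans_on A p) \<and>
     (\<forall>e\<in>events M. act_label (act (\<rho> e)) = letter M e) \<and>
     (\<forall>p. events_on M p \<noteq> {} \<longrightarrow> source (\<rho> (p, 1)) = init A p) \<and>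
     (\<forall>(e, f)\<in>proc_rel M. target (\<rho> e) = source (\<rho> f)) \<and>
     (\<forall>e\<in>events M - Field (msg_rel M). \<exists>a. act (\<rho> e) = Internal a) \<and>
     (\<forall>(e, f)\<in>msg_rel M. \<exists>a b m.
        act (\<rho> e) = Send a m (fst f) \<and> act (\<rho> f) = Receive b m (fst e))"

definition final_state ::
    "('p, 'a, 's, 'm) cfm \<Rightarrow> ('p, 'a) msc \<Rightarrow> ('p event \<Rightarrow> ('p, 'a, 's, 'm) transition) \<Rightarrow> 'p \<Rightarrow> 's" where
  "final_state A M \<rho> p =
     (if events_on M p = {} then init A p else target (\<rho> (p, length (word M p))))"

definition accepting ::
    "'p set \<Rightarrow> ('p, 'a, 's, 'm) cfm \<Rightarrow> ('p, 'a) msc \<Rightarrow>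
     ('p event \<Rightarrow> ('p, 'a, 's, 'm) transition) \<Rightarrow> bool" where
  "accepting P A M \<rho> \<longleftrightarrow> (\<lambda>p\<in>P. final_state A M \<rho> p) \<in> acc A"

definition cfm_lang :: "'p set \<Rightarrow> 'a set \<Rightarrow> ('p, 'a, 's, 'm) cfm \<Rightarrow> ('p, 'a) msc set" where
  "cfm_lang P Sig A = {M. is_msc P Sig M \<and> (\<exists>\<rho>. is_run A M \<rho> \<and> accepting P A M \<rho>)}"

datatype binpred = Proc_Edge | Msg_Edge | Causal_Le

text \<open>First-order and second-order variables are named by natural numbers, independently.\<close>

datatype (procs: 'p, letters: 'a) mso =
    OnProc 'p nat
  | HasLetter 'a nat
  | InSet nat nat \<comment> \<open>\<open>InSet x X\<close> stands for \<open>x \<in> X\<close>\<close>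
  | Equal nat nat
  | Rel binpred nat nat
  | Or "('p, 'a) mso" "('p, 'a) mso"
  | Neg "('p, 'a) mso"
  | ExFO nat "('p, 'a) mso"
  | ExSO nat "('p, 'a) mso"

fun rel_of :: "('p, 'a) msc \<Rightarrow> binpred \<Rightarrow> ('p event \<times> 'p event) set" where
  "rel_of M Proc_Edge = proc_rel M"
| "rel_of M Msg_Edge = msg_rel M"
| "rel_of M Causal_Le = causal_le M"

fun sat :: "('p, 'a) msc \<Rightarrow> (nat \<Rightarrow> 'p event) \<Rightarrow> (nat \<Rightarrow> 'p event set) \<Rightarrow> ('p, 'a) mso \<Rightarrow> bool" where
  "sat M v V (OnProc p x) \<longleftrightarrow> v x \<in> events_on M p"
| "sat M v V (HasLetter a x) \<longleftrightarrow> letter M (v x) = a"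
| "sat M v V (InSet x X) \<longleftrightarrow> v x \<in> V X"
| "sat M v V (Equal x y) \<longleftrightarrow> v x = v y"
| "sat M v V (Rel r x y) \<longleftrightarrow> (v x, v y) \<in> rel_of M r"
| "sat M v V (Or \<phi> \<psi>) \<longleftrightarrow> sat M v V \<phi> \<or> sat M v V \<psi>"
| "sat M v V (Neg \<phi>) \<longleftrightarrow> \<not> sat M v V \<phi>"
| "sat M v V (ExFO x \<phi>) \<longleftrightarrow> (\<exists>e\<in>events M. sat M (v(x := e)) V \<phi>)"
| "sat M v V (ExSO X \<phi>) \<longleftrightarrow> (\<exists>F. F \<subseteq> events M \<and> sat M v (V(X := F)) \<phi>)"

fun free_fo :: "('p, 'a) mso \<Rightarrow> nat set" where
  "free_fo (OnProc p x) = {x}"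
| "free_fo (HasLetter a x) = {x}"
| "free_fo (InSet x X) = {x}"
| "free_fo (Equal x y) = {x, y}"
| "free_fo (Rel r x y) = {x, y}"
| "free_fo (Or \<phi> \<psi>) = free_fo \<phi> \<union> free_fo \<psi>"
| "free_fo (Neg \<phi>) = free_fo \<phi>"
| "free_fo (ExFO x \<phi>) = free_fo \<phi> - {x}"
| "free_fo (ExSO X \<phi>) = free_fo \<phi>"

fun free_so :: "('p, 'a) mso \<Rightarrow> nat set" where
  "free_so (OnProc p x) = {}"
| "free_so (HasLetter a x) = {}"
| "free_so (InSet x X) = {X}"
| "free_so (Equal x y) = {}"
| "free_so (Rel r x y) = {}"
| "free_so (Or \<phi> \<psi>) = free_so \<phi> \<union> free_so \<psi>"
| "free_so (Neg \<phi>) = free_so \<phi>"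
| "free_so (ExFO x \<phi>) = free_so \<phi>"
| "free_so (ExSO X \<phi>) = free_so \<phi> - {X}"

definition sentence :: "'p set \<Rightarrow> 'a set \<Rightarrow> ('p, 'a) mso \<Rightarrow> bool" where
  "sentence P Sig \<phi> \<longleftrightarrow>
     procs \<phi> \<subseteq> P \<and> letters \<phi> \<subseteq> Sig \<and> free_fo \<phi> = {} \<and> free_so \<phi> = {}"

text \<open>Only used for sentences, whose truth value does not depend on the assignments.\<close>

definition mso_lang :: "'p set \<Rightarrow> 'a set \<Rightarrow> ('p, 'a) mso \<Rightarrow> ('p, 'a) msc set" where
  "mso_lang P Sig \<phi> = {M. is_msc P Sig M \<and> (\<forall>v V. sat M v V \<phi>)}"

text \<open>The two admissible first-order variables are 0 and 1; set variables may occur free.\<close>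

fun fo2 :: "binpred set \<Rightarrow> ('p, 'a) mso \<Rightarrow> bool" where
  "fo2 B (OnProc p x) \<longleftrightarrow> x \<in> {0, 1}"
| "fo2 B (HasLetter a x) \<longleftrightarrow> x \<in> {0, 1}"
| "fo2 B (InSet x X) \<longleftrightarrow> x \<in> {0, 1}"
| "fo2 B (Equal x y) \<longleftrightarrow> x \<in> {0, 1} \<and> y \<in> {0, 1}"
| "fo2 B (Rel r x y) \<longleftrightarrow> r \<in> B \<and> x \<in> {0, 1} \<and> y \<in> {0, 1}"
| "fo2 B (Or \<phi> \<psi>) \<longleftrightarrow> fo2 B \<phi> \<and> fo2 B \<psi>"
| "fo2 B (Neg \<phi>) \<longleftrightarrow> fo2 B \<phi>"
| "fo2 B (ExFO x \<phi>) \<longleftrightarrow> x \<in> {0, 1} \<and> fo2 B \<phi>"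
| "fo2 B (ExSO X \<phi>) \<longleftrightarrow> False"

definition emso2 :: "binpred set \<Rightarrow> ('p, 'a) mso \<Rightarrow> bool" where
  "emso2 B \<phi> \<longleftrightarrow> (\<exists>Xs \<psi>. \<phi> = foldr ExSO Xs \<psi> \<and> fo2 B \<psi>)"

end

theory Submission
  imports Defs
begin

text \<open>
  From automata to logic, a run is encoded by one set variable per transition, and its correctness is
  a two-variable property of the two event relations.

  Conversely, a CFM is a tiling: it guesses finitely many colours and checks them against the colours
  of the process predecessor and of the sender. A two-variable formula is eliminated from
  the inside: the truth of \<open>\<psi>(x, y)\<close>, \<open>\<psi>\<close> a Boolean combination, depends only on the unary
  properties of \<open>x\<close> and \<open>y\<close> and on their relative position, so it is enough that a tiling can
  compute at every event \<open>x\<close> which unary properties occur in which position relative to \<open>x\<close>. For causally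
  ordered positions this is a recursion along the order. For parallel positions it suffices to certify, for
  two sets of events \<open>Y\<close> and \<open>W\<close> on two processes, that every \<open>Y\<close>-event is comparable
  with all \<open>W\<close>-events, or that every \<open>Y\<close>-event is parallel to some \<open>W\<close>-event.
  Causal inequalities with disjoint intervals are certified by tokens on vertex-disjoint paths; a greedy choice
  of witnesses yields inequalities that split into boundedly many such families.
\<close>

section \<open>Events and causal order\<close>

text \<open>Tilings are nondeterministic, and complement is not among the closure properties
  established for them. Hence parallelism requires two unrelated positive certificates, one for each
  answer. The obstacle is that being parallel is the absence of causal paths, while tokens can only
  exhibit paths. Tokens are also anonymous: a link shows that its targets have distinct origins
  below them, not which origin belongs to which target. So inequalities are extracted by counting.
  Paths that must not exist are refuted by colours: since channels are FIFO, the latest event of a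
  kind on a given process below \<open>x\<close> is found by always following the latest message
  along some sequence of distinct processes, and such sequences are finitely many. Index
  \<open>i\<close> has to avoid the colour of \<open>i - 1\<close> and of three further indices per
  sequence, whence the bound \<open>1 + 3 * card Ws\<close>.\<close>

definition step :: "('p, 'a) msc \<Rightarrow> ('p event \<times> 'p event) set" where
  "step M = proc_rel M \<union> msg_rel M"

locale alphabets =
  fixes P :: "'p set" and Sig :: "'a set"
  assumes finite_P: "finite P" and finite_Sig: "finite Sig"

locale msc_loc = alphabets P Sig for P :: "'p set" and Sig :: "'a set" +
  fixes M :: "('p, 'a) msc"
  assumes msc: "is_msc P Sig M"
begin

abbreviation cle :: "'p event \<Rightarrow> 'p event \<Rightarrow> bool" (infix "\<preceq>" 50) where
  "x \<preceq> y \<equiv> (x, y) \<in> causal_le M"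

lemmas msc_conds = msc[unfolded is_msc_def]
lemmas msc_outside = msc_conds[THEN conjunct2, THEN conjunct1]
lemmas msc_nonempty = msc_conds[THEN conjunct2, THEN conjunct2, THEN conjunct1]
lemmas msc_msg = msc_conds[THEN conjunct2, THEN conjunct2, THEN conjunct2, THEN conjunct1]
lemmas msc_acyclic = msc_conds[THEN conjunct2, THEN conjunct2, THEN conjunct2, THEN conjunct2, THEN conjunct1]
lemmas msc_unique = msc_conds[THEN conjunct2, THEN conjunct2, THEN conjunct2, THEN conjunct2, THEN conjunct2,
  THEN conjunct1]

lemma event_iff: "e \<in> events M \<longleftrightarrow> 1 \<le> snd e \<and> snd e \<le> length (word M (fst e))"
  by (cases e) (auto simp: events_def events_on_def)

lemma events_on_iff: "e \<in> events_on M p \<longleftrightarrow> e \<in> events M \<and> fst e = p"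
  by (cases e) (auto simp: events_def events_on_def)

lemma fst_event: "e \<in> events M \<Longrightarrow> fst e \<in> P"
proof (rule ccontr)
  assume "e \<in> events M" "fst e \<notin> P"
  then show False using msc_outside by (auto simp: event_iff)
qed

lemma finite_events: "finite (events M)"
proof -
  have "events M \<subseteq> (\<Union>p\<in>P. events_on M p)"
    using fst_event by (auto simp: events_on_iff)
  moreover have "finite (\<Union>p\<in>P. events_on M p)"
    using finite_P by (auto simp: events_on_def)
  ultimately show ?thesis by (rule finite_subset)
qed

lemma proc_rel_iff:
  "(x, y) \<in> proc_rel M \<longleftrightarrow> x \<in> events M \<and> y \<in> events M \<and> fst x = fst y \<and> snd y = Suc (snd x)"
  by (cases x; cases y) (auto simp: proc_rel_def event_iff)

lemma msg_relD:
  assumes "(x, y) \<in> msg_rel M"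
  shows "x \<in> events M" "y \<in> events M" "fst x \<noteq> fst y"
proof -
  have "(x, y) \<in> (\<Union>p\<in>P. \<Union>q\<in>P - {p}. events_on M p \<times> events_on M q)"
    using assms msc_msg by (rule rev_subsetD)
  then show "x \<in> events M" "y \<in> events M" "fst x \<noteq> fst y"
    by (auto simp: events_on_iff)
qed

lemma msg_unique:
  assumes "(x, y) \<in> msg_rel M" "(x', y') \<in> msg_rel M" "{x, y} \<inter> {x', y'} \<noteq> {}"
  shows "x = x' \<and> y = y'"
proof -
  have u: "\<And>e e1 f1 e2 f2. \<lbrakk>e \<in> events M; (e1, f1) \<in> msg_rel M; (e2, f2) \<in> msg_rel M;
      e \<in> {e1, f1} \<and> e \<in> {e2, f2}\<rbrakk> \<Longrightarrow> (e1, f1) = (e2, f2)"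
  proof -
    fix e e1 f1 e2 f2
    assume a: "e \<in> events M" "(e1, f1) \<in> msg_rel M" "(e2, f2) \<in> msg_rel M" "e \<in> {e1, f1} \<and> e \<in> {e2, f2}"
    from bspec[OF bspec[OF bspec[OF msc_unique a(1)] a(2), unfolded case_prod_conv] a(3), unfolded case_prod_conv] a(4)
    show "(e1, f1) = (e2, f2)" by blast
  qed
  obtain e where "e \<in> {x, y} \<inter> {x', y'}" using assms(3) by blast
  then show ?thesis using u[of e x y x' y'] assms(1,2) msg_relD(1,2)[OF assms(1)] by auto
qed

lemma msg_sender_unique: "(x, y) \<in> msg_rel M \<Longrightarrow> (x', y) \<in> msg_rel M \<Longrightarrow> x = x'"
  using msg_unique[of x y x' y] by blast

lemma msg_receiver_unique: "(x, y) \<in> msg_rel M \<Longrightarrow> (x, y') \<in> msg_rel M \<Longrightarrow> y = y'"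
  using msg_unique[of x y x y'] by blast

lemma step_events: "(x, y) \<in> step M \<Longrightarrow> x \<in> events M \<and> y \<in> events M"
  by (auto simp: step_def proc_rel_iff dest: msg_relD)

lemma acyclic_step: "acyclic (step M)"
  unfolding step_def by (rule msc_acyclic)

lemma finite_step: "finite (step M)"
  by (rule finite_subset[of _ "events M \<times> events M"]) (auto simp: finite_events dest: step_events)

lemma wf_step: "wf (step M)"
  by (rule finite_acyclic_wf[OF finite_step acyclic_step])

lemma wf_step_converse: "wf ((step M)\<inverse>)"
  by (rule finite_acyclic_wf_converse[OF finite_step acyclic_step])

lemma causal_le_step: "causal_le M = (step M)\<^sup>*"
  by (simp add: causal_le_def step_def)

lemma cle_refl [simp]: "x \<preceq> x"
  by (simp add: causal_le_def)

lemma cle_trans: "x \<preceq> y \<Longrightarrow> y \<preceq> z \<Longrightarrow> x \<preceq> z"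
  by (simp add: causal_le_def)

lemma step_cle: "(x, y) \<in> step M \<Longrightarrow> x \<preceq> y"
  by (simp add: causal_le_step)

lemma cle_antisym: "x \<preceq> y \<Longrightarrow> y \<preceq> x \<Longrightarrow> x = y"
  unfolding causal_le_step using acyclic_impl_antisym_rtrancl[OF acyclic_step] by (auto dest: antisymD)

lemma step_irrefl: "(x, y) \<in> step M \<Longrightarrow> \<not> y \<preceq> x"
  unfolding causal_le_step using acyclic_step
  by (meson acyclic_def rtrancl_into_trancl2)

lemma cle_last: "x \<preceq> y \<longleftrightarrow> x = y \<or> (\<exists>d. (d, y) \<in> step M \<and> x \<preceq> d)"
  unfolding causal_le_step by (metis rtrancl.simps)

lemma cle_first: "x \<preceq> y \<longleftrightarrow> x = y \<or> (\<exists>d. (x, d) \<in> step M \<and> d \<preceq> y)"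
  unfolding causal_le_step by (metis converse_rtranclE converse_rtrancl_into_rtrancl rtrancl.rtrancl_refl)

lemma same_proc_le:
  assumes "x \<in> events M" "y \<in> events M" "fst x = fst y" "snd x \<le> snd y"
  shows "x \<preceq> y"
proof -
  have "(fst x, snd x + k) \<in> events M \<Longrightarrow> x \<preceq> (fst x, snd x + k)" for k
  proof (induction k)
    case (Suc k)
    then have a: "(fst x, snd x + k) \<in> events M" using assms(1) by (auto simp: event_iff)
    have "((fst x, snd x + k), (fst x, snd x + Suc k)) \<in> step M"
      using a Suc.prems by (simp add: step_def proc_rel_iff)
    then show ?case using Suc.IH[OF a] cle_trans step_cle by blast
  qed simp
  from this[of "snd y - snd x"] show ?thesis using assms by (metis le_add_diff_inverse prod.collapse)
qed

lemma cle_same_proc: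
  assumes "x \<in> events M" "y \<in> events M" "fst x = fst y"
  shows "x \<preceq> y \<longleftrightarrow> snd x \<le> snd y"
  using same_proc_le[OF assms] same_proc_le[of y x] assms cle_antisym
  by (metis linorder_le_cases)

lemma cle_total:
  assumes "x \<in> events M" "y \<in> events M" "fst x = fst y"
  shows "x \<preceq> y \<or> y \<preceq> x"
  using assms by (metis cle_same_proc linorder_le_cases)

end

section \<open>Tilings and recognisable properties\<close>

definition onprd :: "('p, 'a) msc \<Rightarrow> ('p event \<Rightarrow> bool) \<Rightarrow> 'p event \<Rightarrow> bool" where
  "onprd M U e \<longleftrightarrow> (\<exists>d. (d, e) \<in> proc_rel M \<and> U d)"

definition onsuc :: "('p, 'a) msc \<Rightarrow> ('p event \<Rightarrow> bool) \<Rightarrow> 'p event \<Rightarrow> bool" where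
  "onsuc M U e \<longleftrightarrow> (\<exists>f. (e, f) \<in> proc_rel M \<and> U f)"

definition onsnd :: "('p, 'a) msc \<Rightarrow> ('p event \<Rightarrow> bool) \<Rightarrow> 'p event \<Rightarrow> bool" where
  "onsnd M U e \<longleftrightarrow> (\<exists>d. (d, e) \<in> msg_rel M \<and> U d)"

definition onrcv :: "('p, 'a) msc \<Rightarrow> ('p event \<Rightarrow> bool) \<Rightarrow> 'p event \<Rightarrow> bool" where
  "onrcv M U e \<longleftrightarrow> (\<exists>f. (e, f) \<in> msg_rel M \<and> U f)"

definition prd_val :: "('p, 'a) msc \<Rightarrow> ('p event \<Rightarrow> 'c) \<Rightarrow> 'p event \<Rightarrow> 'c option" where
  "prd_val M c e = (if snd e \<le> 1 then None else Some (c (fst e, snd e - 1)))"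

definition snd_val :: "('p, 'a) msc \<Rightarrow> ('p event \<Rightarrow> 'c) \<Rightarrow> 'p event \<Rightarrow> 'c option" where
  "snd_val M c e = (if \<exists>d. (d, e) \<in> msg_rel M then Some (c (THE d. (d, e) \<in> msg_rel M)) else None)"

definition last_val :: "('p, 'a) msc \<Rightarrow> ('p event \<Rightarrow> 'c) \<Rightarrow> 'p \<Rightarrow> 'c option" where
  "last_val M c p = (if word M p = [] then None else Some (c (p, length (word M p))))"

text \<open>
  A tile sees the process, the letter and the label of an event, the colours of its process
  predecessor and of the sender of its message (if any), whether it sends, and its own colour.
\<close>

type_synonym ('p, 'a, 'l, 'c) tile =
  "'p \<Rightarrow> 'a \<Rightarrow> 'l \<Rightarrow> 'c option \<Rightarrow> 'c option \<Rightarrow> bool \<Rightarrow> 'c \<Rightarrow> bool"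

text \<open>The labelling \<open>l\<close> is an input: it carries the values of free set variables
  and of terms that are verified elsewhere. \<open>A\<close> sees the last colours of all processes
  at once and is the only global test.\<close>

definition tiling :: "('p, 'a, 'l, 'c) tile \<Rightarrow> (('p \<Rightarrow> 'c option) \<Rightarrow> bool) \<Rightarrow> 'c set \<Rightarrow>
    ('p, 'a) msc \<Rightarrow> ('p event \<Rightarrow> 'l) \<Rightarrow> ('p event \<Rightarrow> 'c) \<Rightarrow> bool" where
  "tiling T A C M l c \<longleftrightarrow>
     (\<forall>e\<in>events M. c e \<in> C \<and>
        T (fst e) (letter M e) (l e) (prd_val M c e) (snd_val M c e) (e \<in> Domain (msg_rel M)) (c e)) \<and>
     A (last_val M c)"

text \<open>Process, letter and label are exactly what a tile sees of the event itself, so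
  substituting such a term into a labelling changes only the tile. Comparing two MSCs makes the
  value a function of these three data.\<close>

definition local_term :: "(('p, 'a) msc \<Rightarrow> ('p event \<Rightarrow> 'l) \<Rightarrow> 'p event \<Rightarrow> 't) \<Rightarrow> bool" where
  "local_term t \<longleftrightarrow> (\<forall>M M' l l' e e'. fst e = fst e' \<longrightarrow> letter M e = letter M' e' \<longrightarrow> l e = l' e' \<longrightarrow>
     t M l e = t M' l' e')"

context msc_loc
begin

lemma snd_val_eq: "(d, e) \<in> msg_rel M \<Longrightarrow> snd_val M c e = Some (c d)"
proof -
  assume a: "(d, e) \<in> msg_rel M"
  then have the: "(THE d. (d, e) \<in> msg_rel M) = d" by (blast intro: the_equality msg_sender_unique)
  have ex: "\<exists>d. (d, e) \<in> msg_rel M" using a by blast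
  show ?thesis by (simp only: snd_val_def the ex if_True)
qed

lemma snd_val_None: "(\<And>d. (d, e) \<notin> msg_rel M) \<Longrightarrow> snd_val M c e = None"
  unfolding snd_val_def by auto

lemma prd_val_eq: "(d, e) \<in> proc_rel M \<Longrightarrow> prd_val M c e = Some (c d)"
  by (cases d; cases e) (auto simp: prd_val_def proc_rel_iff event_iff)

lemma prd_val_None: "e \<in> events M \<Longrightarrow> (\<And>d. (d, e) \<notin> proc_rel M) \<Longrightarrow> prd_val M c e = None"
proof (rule ccontr)
  assume a: "e \<in> events M" "\<And>d. (d, e) \<notin> proc_rel M" "prd_val M c e \<noteq> None"
  then have "((fst e, snd e - 1), e) \<in> proc_rel M"
    by (auto simp: prd_val_def proc_rel_iff event_iff split: if_splits)
  then show False using a by blast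
qed

lemma prd_val_Some_iff: "e \<in> events M \<Longrightarrow> prd_val M c e = Some x \<longleftrightarrow> onprd M (\<lambda>d. c d = x) e"
proof (cases "\<exists>d. (d, e) \<in> proc_rel M")
  case True
  then obtain d where d: "(d, e) \<in> proc_rel M" by blast
  have "d' = d" if "(d', e) \<in> proc_rel M" for d'
    using that d by (auto simp: proc_rel_iff intro: prod_eqI)
  then show ?thesis unfolding onprd_def prd_val_eq[OF d] option.inject using d by blast
next
  case False
  assume "e \<in> events M"
  then have "prd_val M c e = None" using prd_val_None False by blast
  then show ?thesis unfolding onprd_def using False by auto
qed

lemma snd_val_Some_iff: "snd_val M c e = Some x \<longleftrightarrow> onsnd M (\<lambda>d. c d = x) e"
proof (cases "\<exists>d. (d, e) \<in> msg_rel M")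
  case True
  then obtain d where d: "(d, e) \<in> msg_rel M" by blast
  then show ?thesis unfolding onsnd_def snd_val_eq[OF d] option.inject using msg_sender_unique by blast
next
  case False
  then have "snd_val M c e = None" using snd_val_None by blast
  then show ?thesis unfolding onsnd_def using False by auto
qed

lemma proc_rel_unique: "(d, f) \<in> proc_rel M \<Longrightarrow> (d, f') \<in> proc_rel M \<Longrightarrow> f = f'"
  by (auto simp: proc_rel_iff prod_eq_iff)

lemma onsuc_eq: "(d, f) \<in> proc_rel M \<Longrightarrow> onsuc M U d = U f"
  unfolding onsuc_def using proc_rel_unique by blast

lemma onrcv_eq: "(d, f) \<in> msg_rel M \<Longrightarrow> onrcv M U d = U f"
  unfolding onrcv_def using msg_receiver_unique by blast

lemma last_event: "word M p \<noteq> [] \<Longrightarrow> (p, length (word M p)) \<in> events M"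
  by (auto simp: event_iff Suc_leI)

lemma prd_val_cong: "e \<in> events M \<Longrightarrow> (\<And>d. d \<in> events M \<Longrightarrow> c d = c' d) \<Longrightarrow> prd_val M c e = prd_val M c' e"
proof -
  assume e: "e \<in> events M" and c: "\<And>d. d \<in> events M \<Longrightarrow> c d = c' d"
  have "(fst e, snd e - 1) \<in> events M" if "\<not> snd e \<le> 1" using e that by (auto simp: event_iff)
  then show ?thesis using c by (simp add: prd_val_def)
qed

lemma snd_val_cong: "e \<in> events M \<Longrightarrow> (\<And>d. d \<in> events M \<Longrightarrow> c d = c' d) \<Longrightarrow> snd_val M c e = snd_val M c' e"
  by (cases "\<exists>d. (d, e) \<in> msg_rel M") (metis snd_val_eq msg_relD(1), metis snd_val_None)

lemma last_val_cong: "(\<And>d. d \<in> events M \<Longrightarrow> c d = c' d) \<Longrightarrow> last_val M c = last_val M c'"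
  by (auto simp: last_val_def last_event)

lemma prd_val_map: "prd_val M (\<lambda>e. h (c e)) e = map_option h (prd_val M c e)"
  by (auto simp: prd_val_def)

lemma snd_val_map: "snd_val M (\<lambda>e. h (c e)) e = map_option h (snd_val M c e)"
  by (auto simp: snd_val_def)

lemma last_val_map: "last_val M (\<lambda>e. h (c e)) = (\<lambda>p. map_option h (last_val M c p))"
  by (auto simp: last_val_def)

lemma tiling_cong:
  assumes "\<And>e. e \<in> events M \<Longrightarrow> l e = l' e" "\<And>e. e \<in> events M \<Longrightarrow> c e = c' e"
  shows "tiling T A C M l c = tiling T A C M l' c'"
  unfolding tiling_def using assms
  by (auto simp: prd_val_cong[of _ c c'] snd_val_cong[of _ c c'] last_val_cong[of c c'])

end

lemma local_termI:
  assumes "\<And>M M' l l' e e'. fst e = fst e' \<Longrightarrow> letter M e = letter M' e' \<Longrightarrow> l e = l' e' \<Longrightarrow> t M l e = t M' l' e'"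
  shows "local_term t"
  unfolding local_term_def using assms by blast

lemma local_termD:
  "local_term t \<Longrightarrow> fst e = fst e' \<Longrightarrow> letter M e = letter M' e' \<Longrightarrow> l e = l' e' \<Longrightarrow> t M l e = t M' l' e'"
  unfolding local_term_def by blast

section \<open>Closure properties of recognisable properties\<close>

context alphabets
begin

lemma msc_locI: "is_msc P Sig M \<Longrightarrow> msc_loc P Sig M"
  by unfold_locales

text \<open>Colours are numbers because HOL has no existential quantification over types;
  \<open>recogI\<close> admits any finite colour set.\<close>

definition recog :: "(('p, 'a) msc \<Rightarrow> ('p event \<Rightarrow> 'l) \<Rightarrow> bool) \<Rightarrow> bool" where
  "recog Q \<longleftrightarrow> (\<exists>(C :: nat set) T A. finite C \<and>
     (\<forall>M l. is_msc P Sig M \<longrightarrow> Q M l \<longleftrightarrow> (\<exists>c. tiling T A C M l c)))"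

text \<open>Colours are transported along an injection into the numbers, with tile and acceptance
  read through its left inverse on \<open>C\<close>.\<close>

lemma recogI:
  fixes C :: "'c set"
  assumes "finite C" "\<And>M l. is_msc P Sig M \<Longrightarrow> Q M l \<longleftrightarrow> (\<exists>c. tiling T A C M l c)"
  shows "recog Q"
proof -
  obtain h :: "'c \<Rightarrow> nat" where h: "inj_on h C"
    using finite_imp_inj_to_nat_seg[OF assms(1)] by blast
  define g where "g = inv_into C h"
  have gh: "g (h x) = x" if "x \<in> C" for x using h that by (simp add: g_def)
  define T' where "T' = (\<lambda>p a l pv sv rv x. T p a l (map_option g pv) (map_option g sv) rv (g x))"
  define A' where "A' = (\<lambda>f. A (\<lambda>p. map_option g (f p)))"
  have "Q M l \<longleftrightarrow> (\<exists>c. tiling T' A' (h ` C) M l c)" if M: "is_msc P Sig M" for M l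
  proof -
    interpret msc_loc P Sig M by (rule msc_locI[OF M])
    have 1: "tiling T A C M l (\<lambda>e. g (c e))" if "tiling T' A' (h ` C) M l c" for c
      using that gh by (auto simp: tiling_def T'_def A'_def prd_val_map snd_val_map last_val_map)
    have 2: "tiling T' A' (h ` C) M l (\<lambda>e. h (c e))" if c: "tiling T A C M l c" for c
    proof -
      \<comment> \<open>Off the events \<open>c\<close> may leave \<open>C\<close>, where
        \<open>g\<close> need not invert \<open>h\<close>; tilings do not look there.\<close>
      have "tiling T A C M l (\<lambda>e. g (h (c e))) = tiling T A C M l c"
        using c gh by (intro tiling_cong) (auto simp: tiling_def)
      then have t: "tiling T A C M l (\<lambda>e. g (h (c e)))" using c by simp
      have "prd_val M (\<lambda>e. g (h (c e))) e = map_option g (prd_val M (\<lambda>e. h (c e)) e)" for e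
        by (rule prd_val_map)
      moreover have "snd_val M (\<lambda>e. g (h (c e))) e = map_option g (snd_val M (\<lambda>e. h (c e)) e)" for e
        by (rule snd_val_map)
      moreover have "last_val M (\<lambda>e. g (h (c e))) = (\<lambda>p. map_option g (last_val M (\<lambda>e. h (c e)) p))"
        by (rule last_val_map)
      ultimately show ?thesis using t c unfolding tiling_def T'_def A'_def by simp
    qed
    show ?thesis using 1 2 assms(2)[OF M] by blast
  qed
  moreover have "finite (h ` C)" using assms(1) by simp
  ultimately show ?thesis unfolding recog_def by blast
qed

lemma recogE:
  assumes "recog Q"
  obtains C :: "nat set" and T A where "finite C"
    "\<And>M l. is_msc P Sig M \<Longrightarrow> Q M l \<longleftrightarrow> (\<exists>c. tiling T A C M l c)"
  using assms unfolding recog_def by (elim exE conjE) (rule that; blast)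

lemma recog_cong:
  "recog Q \<Longrightarrow> (\<And>M l. is_msc P Sig M \<Longrightarrow> Q M l = Q' M l) \<Longrightarrow> recog Q'"
  unfolding recog_def by (metis (no_types, lifting))

text \<open>A tiling reads labels at events only. This matters because guessed labellings are
  constrained only there.\<close>

lemma recog_events_cong:
  assumes "recog Q" "is_msc P Sig M" "\<And>e. e \<in> events M \<Longrightarrow> l e = l' e"
  shows "Q M l = Q M l'"
proof -
  interpret msc_loc P Sig M by (rule msc_locI[OF assms(2)])
  from assms(1) obtain C :: "nat set" and T A where
    *: "\<And>M l. is_msc P Sig M \<Longrightarrow> Q M l \<longleftrightarrow> (\<exists>c. tiling T A C M l c)" by (rule recogE) blast
  have "tiling T A C M l c = tiling T A C M l' c" for c
    by (rule tiling_cong) (use assms(3) in auto)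
  then show ?thesis using *[OF assms(2)] by blast
qed

lemma recog_conj:
  assumes "recog Q" "recog Q'"
  shows "recog (\<lambda>M l. Q M l \<and> Q' M l)"
proof -
  obtain C1 :: "nat set" and T1 A1 where 1: "finite C1"
    "\<And>M l. is_msc P Sig M \<Longrightarrow> Q M l \<longleftrightarrow> (\<exists>c. tiling T1 A1 C1 M l c)" using assms(1) by (rule recogE) blast
  obtain C2 :: "nat set" and T2 A2 where 2: "finite C2"
    "\<And>M l. is_msc P Sig M \<Longrightarrow> Q' M l \<longleftrightarrow> (\<exists>c. tiling T2 A2 C2 M l c)" using assms(2) by (rule recogE) blast
  let ?T = "\<lambda>p a l pv sv rv x. T1 p a l (map_option fst pv) (map_option fst sv) rv (fst x) \<and>
      T2 p a l (map_option snd pv) (map_option snd sv) rv (snd x)"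
  let ?A = "\<lambda>f. A1 (\<lambda>p. map_option fst (f p)) \<and> A2 (\<lambda>p. map_option snd (f p))"
  show ?thesis
  proof (rule recogI[of "C1 \<times> C2" _ ?T ?A])
    fix M and l :: "'p event \<Rightarrow> 'b" assume M: "is_msc P Sig M"
    interpret msc_loc P Sig M by (rule msc_locI[OF M])
    have eq: "tiling ?T ?A (C1 \<times> C2) M l c \<longleftrightarrow>
       tiling T1 A1 C1 M l (\<lambda>e. fst (c e)) \<and> tiling T2 A2 C2 M l (\<lambda>e. snd (c e))" for c
      unfolding tiling_def by (auto simp: prd_val_map snd_val_map last_val_map mem_Times_iff)
    show "(Q M l \<and> Q' M l) = (\<exists>c. tiling ?T ?A (C1 \<times> C2) M l c)"
      unfolding eq 1(2)[OF M] 2(2)[OF M]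
    proof safe
      fix c1 c2 assume "tiling T1 A1 C1 M l c1" "tiling T2 A2 C2 M l c2"
      then show "\<exists>c. tiling T1 A1 C1 M l (\<lambda>e. fst (c e)) \<and> tiling T2 A2 C2 M l (\<lambda>e. snd (c e))"
        by (intro exI[of _ "\<lambda>e. (c1 e, c2 e)"]) auto
    qed auto
  qed (use 1 2 in auto)
qed

text \<open>The colour records which disjunct is meant. Tiles keep this bit constant along each
  process, and acceptance, which sees the final colours of all processes, makes the processes
  agree.\<close>

lemma recog_disj:
  assumes "recog Q" "recog Q'"
  shows "recog (\<lambda>M l. Q M l \<or> Q' M l)"
proof -
  obtain C1 :: "nat set" and T1 A1 where 1: "finite C1"
    "\<And>M l. is_msc P Sig M \<Longrightarrow> Q M l \<longleftrightarrow> (\<exists>c. tiling T1 A1 C1 M l c)" using assms(1) by (rule recogE) blast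
  obtain C2 :: "nat set" and T2 A2 where 2: "finite C2"
    "\<And>M l. is_msc P Sig M \<Longrightarrow> Q' M l \<longleftrightarrow> (\<exists>c. tiling T2 A2 C2 M l c)" using assms(2) by (rule recogE) blast
  let ?C = "{True} \<times> C1 \<union> {False} \<times> C2"
  let ?T = "\<lambda>p a l pv sv rv x. (\<forall>y. pv = Some y \<longrightarrow> fst y = fst x) \<and>
      (if fst x then T1 p a l (map_option snd pv) (map_option snd sv) rv (snd x)
       else T2 p a l (map_option snd pv) (map_option snd sv) rv (snd x))"
  let ?A = "\<lambda>f. (\<forall>p x. f p = Some x \<longrightarrow> fst x) \<and> A1 (\<lambda>p. map_option snd (f p)) \<or>
      (\<forall>p x. f p = Some x \<longrightarrow> \<not> fst x) \<and> A2 (\<lambda>p. map_option snd (f p))"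
  show ?thesis
  proof (rule recogI[of ?C _ ?T ?A])
    fix M and l :: "'p event \<Rightarrow> 'b" assume M: "is_msc P Sig M"
    interpret msc_loc P Sig M by (rule msc_locI[OF M])
    have side: "fst (c e) = fst (c (fst e, length (word M (fst e))))"
      if t: "tiling ?T ?A ?C M l c" and e: "e \<in> events M" for c e
    proof -
      have "(fst e, snd e + k) \<in> events M \<Longrightarrow> fst (c e) = fst (c (fst e, snd e + k))" for k
      proof (induction k)
        case (Suc k)
        then have a: "(fst e, snd e + k) \<in> events M" using e by (auto simp: event_iff)
        have "((fst e, snd e + k), (fst e, snd e + Suc k)) \<in> proc_rel M"
          using a Suc.prems by (simp add: proc_rel_iff)
        from prd_val_eq[OF this, of c] t Suc.prems
        have "fst (c (fst e, snd e + k)) = fst (c (fst e, snd e + Suc k))"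
          unfolding tiling_def by blast
        then show ?case using Suc.IH[OF a] by simp
      qed simp
      from this[of "length (word M (fst e)) - snd e"] show ?thesis using e by (auto simp: event_iff)
    qed
    have ne: "word M (fst e) \<noteq> []" if "e \<in> events M" for e using that by (auto simp: event_iff)
    have 3: "tiling T1 A1 C1 M l (\<lambda>e. snd (c e)) \<or> tiling T2 A2 C2 M l (\<lambda>e. snd (c e))"
      if t: "tiling ?T ?A ?C M l c" for c
    proof -
      consider "\<forall>p x. last_val M c p = Some x \<longrightarrow> fst x" "A1 (\<lambda>p. map_option snd (last_val M c p))"
        | "\<forall>p x. last_val M c p = Some x \<longrightarrow> \<not> fst x" "A2 (\<lambda>p. map_option snd (last_val M c p))"
        using t unfolding tiling_def by blast
      then show ?thesis
      proof cases
        case 1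
        have "\<forall>e\<in>events M. fst (c e)"
        proof
          fix e assume e: "e \<in> events M"
          have "last_val M c (fst e) = Some (c (fst e, length (word M (fst e))))"
            using ne[OF e] by (simp add: last_val_def)
          then show "fst (c e)" using 1(1) side[OF t e] by blast
        qed
        then have "tiling T1 A1 C1 M l (\<lambda>e. snd (c e))"
          using t 1(2) unfolding tiling_def by (fastforce simp: prd_val_map snd_val_map last_val_map)
        then show ?thesis ..
      next
        case 2
        have "\<forall>e\<in>events M. \<not> fst (c e)"
        proof
          fix e assume e: "e \<in> events M"
          have "last_val M c (fst e) = Some (c (fst e, length (word M (fst e))))"
            using ne[OF e] by (simp add: last_val_def)
          then show "\<not> fst (c e)" using 2(1) side[OF t e] by blast
        qed
        then have "tiling T2 A2 C2 M l (\<lambda>e. snd (c e))"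
          using t 2(2) unfolding tiling_def by (fastforce simp: prd_val_map snd_val_map last_val_map)
        then show ?thesis ..
      qed
    qed
    have 4: "tiling ?T ?A ?C M l (\<lambda>e. (True, c e))" if "tiling T1 A1 C1 M l c" for c
      using that unfolding tiling_def
      by (auto simp: prd_val_map[of "Pair True"] snd_val_map[of "Pair True"] last_val_map[of "Pair True"]
          option.map_comp comp_def option.map_ident)
    have 5: "tiling ?T ?A ?C M l (\<lambda>e. (False, c e))" if "tiling T2 A2 C2 M l c" for c
      using that unfolding tiling_def
      by (auto simp: prd_val_map[of "Pair False"] snd_val_map[of "Pair False"] last_val_map[of "Pair False"]
          option.map_comp comp_def option.map_ident)
    show "(Q M l \<or> Q' M l) = (\<exists>c. tiling ?T ?A ?C M l c)"
      unfolding 1(2)[OF M] 2(2)[OF M] using 3 4 5 by blast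
  qed (use 1 2 in auto)
qed

text \<open>Projection: the guessed labelling becomes a second component of the colour, which is
  where finiteness of \<open>K\<close> enters. The label type itself may be infinite.\<close>

lemma recog_ex:
  fixes K :: "'k set"
  assumes "recog (\<lambda>M (l :: 'p event \<Rightarrow> 'l \<times> 'k). Q M (\<lambda>e. fst (l e)) (\<lambda>e. snd (l e)))" "finite K"
  shows "recog (\<lambda>M l. \<exists>b. (\<forall>e\<in>events M. b e \<in> K) \<and> Q M l b)"
proof -
  obtain C :: "nat set" and T A where 1: "finite C"
    "\<And>M l. is_msc P Sig M \<Longrightarrow> Q M (\<lambda>e. fst (l e)) (\<lambda>e. snd (l e)) \<longleftrightarrow> (\<exists>c. tiling T A C M l c)"
    using assms(1) by (rule recogE) blast
  let ?T = "\<lambda>p a l pv sv rv x. T p a (l, snd x) (map_option fst pv) (map_option fst sv) rv (fst x)"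
  let ?A = "\<lambda>f. A (\<lambda>p. map_option fst (f p))"
  have *: "(\<exists>b. (\<forall>e\<in>events M. b e \<in> K) \<and> Q M l b) = (\<exists>c. tiling ?T ?A (C \<times> K) M l c)"
    if M: "is_msc P Sig M" for M l
  proof -
    interpret msc_loc P Sig M by (rule msc_locI[OF M])
    have eq: "tiling ?T ?A (C \<times> K) M l c \<longleftrightarrow> (\<forall>e\<in>events M. snd (c e) \<in> K) \<and>
       tiling T A C M (\<lambda>e. (l e, snd (c e))) (\<lambda>e. fst (c e))" for c
      unfolding tiling_def by (auto simp: prd_val_map snd_val_map last_val_map mem_Times_iff)
    have Q: "Q M l b \<longleftrightarrow> (\<exists>c. tiling T A C M (\<lambda>e. (l e, b e)) c)" for b
      using 1(2)[OF M, of "\<lambda>e. (l e, b e)"] by simp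
    show ?thesis
      unfolding eq Q
    proof safe
      fix b c assume "\<forall>e\<in>events M. b e \<in> K" "tiling T A C M (\<lambda>e. (l e, b e)) c"
      then show "\<exists>c. (\<forall>e\<in>events M. snd (c e) \<in> K) \<and> tiling T A C M (\<lambda>e. (l e, snd (c e))) (\<lambda>e. fst (c e))"
        by (intro exI[of _ "\<lambda>e. (c e, b e)"]) auto
    next
      fix c assume "\<forall>e\<in>events M. snd (c e) \<in> K" "tiling T A C M (\<lambda>e. (l e, snd (c e))) (\<lambda>e. fst (c e))"
      then show "\<exists>b. (\<forall>e\<in>events M. b e \<in> K) \<and> (\<exists>c. tiling T A C M (\<lambda>e. (l e, b e)) c)"
        by (intro exI[of _ "\<lambda>e. snd (c e)"]) auto
    qed
  qed
  show ?thesis by (rule recogI[OF _ *]) (use 1(1) assms(2) in auto)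
qed

lemma recog_subst:
  assumes "recog Q" "local_term t"
  shows "recog (\<lambda>M l. Q M (t M l))"
proof -
  obtain C :: "nat set" and T A where 1: "finite C"
    "\<And>M l. is_msc P Sig M \<Longrightarrow> Q M l \<longleftrightarrow> (\<exists>c. tiling T A C M l c)"
    using assms(1) by (rule recogE) blast
  \<comment> \<open>Choice turns the term into a function of process, letter and label; triples that
    do not occur get an arbitrary value.\<close>
  have "\<exists>v. \<forall>M l e. k = (fst e, letter M e, l e) \<longrightarrow> t M l e = v" for k
  proof (cases "\<exists>M l e. k = (fst e, letter M e, l e)")
    case True
    then obtain M0 l0 e0 where k: "k = (fst e0, letter M0 e0, l0 e0)" by (elim exE)
    show ?thesis
    proof (intro exI allI impI)
      fix M l e assume "k = (fst e, letter M e, l e)"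
      then show "t M l e = t M0 l0 e0" using k by (intro local_termD[OF assms(2)]) simp_all
    qed
  qed blast
  then obtain v where v: "\<And>k M l e. k = (fst e, letter M e, l e) \<Longrightarrow> t M l e = v k" by metis
  define g where "g p a x = v (p, a, x)" for p a x
  have g: "t M l e = g (fst e) (letter M e) (l e)" for M l e using v unfolding g_def by blast
  show ?thesis
    by (rule recogI[of C _ "\<lambda>p a x. T p a (g p a x)" A])
      (use 1 in \<open>auto simp: tiling_def g\<close>)
qed

lemma recog_const: "recog (\<lambda>M l. b)"
  by (rule recogI[of "{()}" _ "\<lambda>_ _ _ _ _ _ _. b" "\<lambda>_. b"]) (auto simp: tiling_def)

lemma recog_ball:
  assumes "finite I" "\<And>i. i \<in> I \<Longrightarrow> recog (Q i)"
  shows "recog (\<lambda>M l. \<forall>i\<in>I. Q i M l)"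
  using assms
proof (induction I rule: finite_induct)
  case empty then show ?case using recog_const[of True] by simp
next
  case (insert i I)
  then show ?case using recog_conj[of "Q i" "\<lambda>M l. \<forall>i\<in>I. Q i M l"] by simp
qed

lemma recog_all_events: "recog (\<lambda>M l. \<forall>e\<in>events M. l e)"
  by (rule recogI[of "{()}" _ "\<lambda>_ _ l _ _ _ _. l" "\<lambda>_. True"]) (auto simp: tiling_def)

text \<open>The bit of an event tells whether a labelled event has occurred so far on its process;
  acceptance asks for one final bit to be set.\<close>

lemma recog_ex_event: "recog (\<lambda>M l. \<exists>e\<in>events M. l e)"
proof (rule recogI[of UNIV _ "\<lambda>_ _ l pv _ _ x. x = (l \<or> pv = Some True)" "\<lambda>f. \<exists>p. f p = Some True"])
  fix M and l :: "'p event \<Rightarrow> bool" assume M: "is_msc P Sig M"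
  interpret msc_loc P Sig M by (rule msc_locI[OF M])
  let ?t = "tiling (\<lambda>_ _ l pv _ _ x. x = (l \<or> pv = Some True)) (\<lambda>f. \<exists>p. f p = Some True) UNIV M l"
  have 1: "\<exists>e\<in>events M. l e" if "?t c" for c
  proof -
    have "\<exists>p. last_val M c p = Some True" using that unfolding tiling_def by (elim conjE)
    then obtain p where p: "last_val M c p = Some True" ..
    have *: "c e \<Longrightarrow> e \<in> events M \<Longrightarrow> \<exists>e\<in>events M. l e" for e
    proof (induction "snd e" arbitrary: e rule: less_induct)
      case less
      show ?case
      proof (cases "l e")
        case False
        then have "onprd M (\<lambda>d. c d = True) e"
          using that less.prems prd_val_Some_iff[of e c True] unfolding tiling_def by auto
        then obtain d where "(d, e) \<in> proc_rel M" "c d" by (auto simp: onprd_def)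
        then show ?thesis using less.hyps[of d] by (auto simp: proc_rel_iff)
      qed (use less in auto)
    qed
    show ?thesis using p *[of "(p, length (word M p))"] last_event[of p]
      by (auto simp: last_val_def split: if_splits)
  qed
  have 2: "?t (\<lambda>e. \<exists>d\<in>events M. fst d = fst e \<and> snd d \<le> snd e \<and> l d)" 
    if e: "e \<in> events M" "l e" for e
  proof -
    let ?c = "\<lambda>e. \<exists>d\<in>events M. fst d = fst e \<and> snd d \<le> snd e \<and> l d"
    have "?c x = (l x \<or> prd_val M ?c x = Some True)" if x: "x \<in> events M" for x
    proof
      assume "?c x"
      then obtain d where d: "d \<in> events M" "fst d = fst x" "snd d \<le> snd x" "l d" by blast
      show "l x \<or> prd_val M ?c x = Some True"
      proof (cases "d = x")
        case False
        then have lt: "snd d < snd x" using d by (metis le_neq_implies_less prod.collapse)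
        have "((fst x, snd x - 1), x) \<in> proc_rel M"
          using lt d x by (auto simp: proc_rel_iff event_iff)
        moreover have "?c (fst x, snd x - 1)" using d lt by (auto intro!: bexI[of _ d])
        ultimately show ?thesis using x prd_val_Some_iff[of x ?c True] unfolding onprd_def by blast
      qed (use d in auto)
    next
      assume "l x \<or> prd_val M ?c x = Some True"
      then show "?c x"
      proof
        assume "prd_val M ?c x = Some True"
        then obtain d where "(d, x) \<in> proc_rel M" "?c d"
          using x prd_val_Some_iff[of x ?c True] unfolding onprd_def by blast
        then show ?thesis unfolding proc_rel_iff by (metis le_Suc_eq)
      qed (use x in auto)
    qed
    moreover have "last_val M ?c (fst e) = Some True"
      using e by (auto simp: last_val_def event_iff)
    ultimately show ?thesis unfolding tiling_def by blast
  qed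
  show "(\<exists>e\<in>events M. l e) = (\<exists>c. ?t c)" using 1 2 by blast
qed auto

text \<open>Terms whose values can be guessed and verified by a tiling.\<close>

definition cpt :: "(('p, 'a) msc \<Rightarrow> ('p event \<Rightarrow> 'l) \<Rightarrow> 'p event \<Rightarrow> 't) \<Rightarrow> bool" where
  "cpt t \<longleftrightarrow> (\<exists>K. finite K \<and> (\<forall>M l. is_msc P Sig M \<longrightarrow> (\<forall>e\<in>events M. t M l e \<in> K))) \<and>
     recog (\<lambda>M l. \<forall>e\<in>events M. snd (l e) = t M (\<lambda>e. fst (l e)) e)"

lemma cpt_boolI:
  "recog (\<lambda>M l. \<forall>e\<in>events M. snd (l e) = t M (\<lambda>e. fst (l e)) e) \<Longrightarrow> cpt (t :: _ \<Rightarrow> _ \<Rightarrow> _ \<Rightarrow> bool)"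
  unfolding cpt_def using finite_UNIV by blast

text \<open>The values of \<open>t\<close> are guessed as an additional labelling, verified through
  the second half of \<open>cpt\<close>, and handed to \<open>Q\<close>.\<close>

lemma recog_plug:
  assumes "recog (\<lambda>M l. Q M (\<lambda>e. fst (l e)) (\<lambda>e. snd (l e)))" "cpt t"
  shows "recog (\<lambda>M l. Q M l (t M l))"
proof -
  obtain K where K: "finite K" "\<And>M l e. is_msc P Sig M \<Longrightarrow> e \<in> events M \<Longrightarrow> t M l e \<in> K"
    and r: "recog (\<lambda>M l. \<forall>e\<in>events M. snd (l e) = t M (\<lambda>e. fst (l e)) e)"
    using assms(2) unfolding cpt_def by blast
  have "recog (\<lambda>M l. \<exists>b. (\<forall>e\<in>events M. b e \<in> K) \<and> ((\<forall>e\<in>events M. b e = t M l e) \<and> Q M l b))"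
    by (rule recog_ex[OF _ K(1)]) (rule recog_conj[OF r assms(1)])
  then show ?thesis
  proof (rule recog_cong)
    fix M l assume M: "is_msc P Sig M"
    have "Q M l b = Q M l (t M l)" if "\<forall>e\<in>events M. b e = t M l e" for b
      using recog_events_cong[OF assms(1) M, of "\<lambda>e. (l e, b e)" "\<lambda>e. (l e, t M l e)"] that by simp
    then show "(\<exists>b. (\<forall>e\<in>events M. b e \<in> K) \<and> ((\<forall>e\<in>events M. b e = t M l e) \<and> Q M l b)) = Q M l (t M l)"
      using K(2)[OF M] by blast
  qed
qed

lemma recog_plug1:
  assumes "recog Q" "cpt t"
  shows "recog (\<lambda>M l. Q M (t M l))"
  by (rule recog_plug[OF _ assms(2), of "\<lambda>M l b. Q M b"])
    (rule recog_subst[OF assms(1)], rule local_termI, simp)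

lemma cptE:
  assumes "cpt t"
  obtains K where "finite K" "\<And>M l e. is_msc P Sig M \<Longrightarrow> e \<in> events M \<Longrightarrow> t M l e \<in> K"
    "recog (\<lambda>M l. \<forall>e\<in>events M. snd (l e) = t M (\<lambda>e. fst (l e)) e)"
  using assms unfolding cpt_def by blast

lemma cptI:
  assumes "finite K" "\<And>M l e. is_msc P Sig M \<Longrightarrow> e \<in> events M \<Longrightarrow> t M l e \<in> K"
    "recog (\<lambda>M l. \<forall>e\<in>events M. snd (l e) = t M (\<lambda>e. fst (l e)) e)"
  shows "cpt t"
  using assms unfolding cpt_def by blast

lemma cpt_subst:
  assumes "cpt t" "local_term h"
  shows "cpt (\<lambda>M l. t M (h M l))"
proof -
  obtain K where K: "finite K" "\<And>M l e. is_msc P Sig M \<Longrightarrow> e \<in> events M \<Longrightarrow> t M l e \<in> K"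
    and r: "recog (\<lambda>M l. \<forall>e\<in>events M. snd (l e) = t M (\<lambda>e. fst (l e)) e)"
    using assms(1) by (rule cptE) blast
  have "local_term (\<lambda>M l e. (h M (\<lambda>e. fst (l e)) e, snd (l e)))"
    by (rule local_termI) (auto intro: local_termD[OF assms(2)])
  from recog_subst[OF r this]
  have "recog (\<lambda>M l. \<forall>e\<in>events M. snd (l e) = t M (h M (\<lambda>e. fst (l e))) e)" by simp
  then show ?thesis by (rule cptI[OF K(1), rotated]) (rule K(2))
qed

lemma cpt_comp:
  assumes "cpt s" "cpt t"
  shows "cpt (\<lambda>M l. s M (t M l))"
proof -
  have s: "recog (\<lambda>M l. \<forall>e\<in>events M. snd (l e) = s M (\<lambda>e. fst (l e)) e)"
    using assms(1) unfolding cpt_def by blast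
  have "recog (\<lambda>M l. \<forall>e\<in>events M. snd (l e) = s M (t M (\<lambda>e. fst (l e))) e)"
  proof (rule recog_cong)
    have r: "recog (\<lambda>M l. \<forall>e\<in>events M. snd (fst (l e)) = s M (\<lambda>e. snd (l e)) e)"
    proof -
      have "local_term (\<lambda>M l e. (snd (l e), snd (fst (l e))))" by (rule local_termI) auto
      from recog_subst[OF s this] show ?thesis by simp
    qed
    have "cpt (\<lambda>M l. t M (\<lambda>e. fst (l e)))"
      by (rule cpt_subst[OF assms(2)]) (rule local_termI, simp)
    from recog_plug[OF r[unfolded] this]
    show "recog (\<lambda>M l. \<forall>e\<in>events M. snd (l e) = s M (t M (\<lambda>e. fst (l e))) e)" by simp
  qed simp
  then show ?thesis using assms(1) by (elim cptE) (rule cptI)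
qed

lemma cpt_local:
  fixes t :: "('p, 'a) msc \<Rightarrow> ('p event \<Rightarrow> 'l) \<Rightarrow> 'p event \<Rightarrow> 't"
  assumes t: "local_term t" and f: "finite (\<Union>M l. t M l ` events M)"
  shows "cpt t"
proof -
  have "local_term (\<lambda>M l e. snd (l e) = t M (\<lambda>e. fst (l e)) e)"
    unfolding local_term_def
  proof (intro allI impI)
    fix M M' :: "('p, 'a) msc" and l l' :: "'p event \<Rightarrow> 'l \<times> 't" and e e' :: "'p event"
    assume a: "fst e = fst e'" "letter M e = letter M' e'" "l e = l' e'"
    then have "t M (\<lambda>e. fst (l e)) e = t M' (\<lambda>e. fst (l' e)) e'"
      by (intro local_termD[OF t]) auto
    then show "(snd (l e) = t M (\<lambda>e. fst (l e)) e) = (snd (l' e') = t M' (\<lambda>e. fst (l' e)) e')"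
      using a by simp
  qed
  from recog_subst[OF recog_all_events this] show ?thesis
    unfolding cpt_def using f by blast
qed

lemma cpt_localb: "local_term t \<Longrightarrow> cpt (t :: _ \<Rightarrow> _ \<Rightarrow> _ \<Rightarrow> bool)"
  by (rule cpt_local) auto

lemma cpt_Pair:
  assumes "cpt s" "cpt t"
  shows "cpt (\<lambda>M l e. (s M l e, t M l e))"
proof -
  obtain K where K: "finite K" "\<And>M l e. is_msc P Sig M \<Longrightarrow> e \<in> events M \<Longrightarrow> s M l e \<in> K"
    and r: "recog (\<lambda>M l. \<forall>e\<in>events M. snd (l e) = s M (\<lambda>e. fst (l e)) e)"
    using assms(1) unfolding cpt_def by blast
  obtain K' where K': "finite K'" "\<And>M l e. is_msc P Sig M \<Longrightarrow> e \<in> events M \<Longrightarrow> t M l e \<in> K'"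
    and r': "recog (\<lambda>M l. \<forall>e\<in>events M. snd (l e) = t M (\<lambda>e. fst (l e)) e)"
    using assms(2) unfolding cpt_def by blast
  have "local_term (\<lambda>M l e. (fst (l e), fst (snd (l e))))" by (rule local_termI) simp
  from recog_subst[OF r this]
  have 1: "recog (\<lambda>M l. \<forall>e\<in>events M. fst (snd (l e)) = s M (\<lambda>e. fst (l e)) e)" by simp
  have "local_term (\<lambda>M l e. (fst (l e), snd (snd (l e))))" by (rule local_termI) simp
  from recog_subst[OF r' this]
  have 2: "recog (\<lambda>M l. \<forall>e\<in>events M. snd (snd (l e)) = t M (\<lambda>e. fst (l e)) e)" by simp
  have "recog (\<lambda>M l. (\<forall>e\<in>events M. fst (snd (l e)) = s M (\<lambda>e. fst (l e)) e) \<and>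
      (\<forall>e\<in>events M. snd (snd (l e)) = t M (\<lambda>e. fst (l e)) e))"
    by (rule recog_conj[OF 1 2])
  then have "recog (\<lambda>M l. \<forall>e\<in>events M. snd (l e) = (s M (\<lambda>e. fst (l e)) e, t M (\<lambda>e. fst (l e)) e))"
    by (rule recog_cong) (auto simp: prod_eq_iff)
  moreover have "finite (K \<times> K')" using K K' by simp
  ultimately show ?thesis by (intro cptI[of "K \<times> K'"]) (use K(2) K'(2) in auto)
qed

lemma cpt_map: "cpt t \<Longrightarrow> cpt (\<lambda>M l e. h (t M l e))"
proof -
  assume t: "cpt t"
  then obtain K where K: "finite K" "\<And>M l e. is_msc P Sig M \<Longrightarrow> e \<in> events M \<Longrightarrow> t M l e \<in> K"
    by (rule cptE) blast
  have "cpt (\<lambda>M l. t M (\<lambda>e. fst (l e)))"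
    by (rule cpt_subst[OF t]) (rule local_termI, simp)
  note t' = this
  have "local_term (\<lambda>M l e. snd (fst (l e)) = h (snd (l e)))" by (rule local_termI) simp
  note r = recog_subst[OF recog_all_events this]
  have "recog (\<lambda>M l. \<forall>e\<in>events M. snd (l e) = h (t M (\<lambda>e. fst (l e)) e))"
    by (rule recog_plug[OF _ t', of "\<lambda>M l b. \<forall>e\<in>events M. snd (l e) = h (b e)"]) (rule r)
  moreover have "finite (h ` K)" using K by simp
  ultimately show ?thesis by (intro cptI[of "h ` K"]) (use K(2) in auto)
qed

lemma cpt_map2: "cpt s \<Longrightarrow> cpt t \<Longrightarrow> cpt (\<lambda>M l e. h (s M l e) (t M l e))"
  using cpt_map[OF cpt_Pair, of s t "\<lambda>x. h (fst x) (snd x)"] by simp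

lemma cpt_comp2:
  assumes "cpt (\<lambda>M l. S M (\<lambda>e. fst (l e)) (\<lambda>e. snd (l e)))" "cpt s" "cpt t"
  shows "cpt (\<lambda>M l. S M (s M l) (t M l))"
  using cpt_comp[OF assms(1) cpt_Pair[OF assms(2,3)]] by simp

lemma recog_plug2:
  assumes "recog (\<lambda>M l. S M (\<lambda>e. fst (l e)) (\<lambda>e. snd (l e)))" "cpt s" "cpt t"
  shows "recog (\<lambda>M l. S M (s M l) (t M l))"
  using recog_plug1[OF assms(1) cpt_Pair[OF assms(2,3)]] by simp

lemma cpt_not: "cpt t \<Longrightarrow> cpt (\<lambda>M l e. \<not> t M l e)"
  by (rule cpt_map)

lemma cpt_conj: "cpt s \<Longrightarrow> cpt t \<Longrightarrow> cpt (\<lambda>M l e. s M l e \<and> t M l e)"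
  by (rule cpt_map2)

lemma cpt_disj: "cpt s \<Longrightarrow> cpt t \<Longrightarrow> cpt (\<lambda>M l e. s M l e \<or> t M l e)"
  by (rule cpt_map2)

lemma cpt_imp: "cpt s \<Longrightarrow> cpt t \<Longrightarrow> cpt (\<lambda>M l e. s M l e \<longrightarrow> t M l e)"
  by (rule cpt_map2)

lemma cpt_if: "cpt r \<Longrightarrow> cpt s \<Longrightarrow> cpt t \<Longrightarrow> cpt (\<lambda>M l e. if r M l e then s M l e else t M l e)"
  using cpt_map2[OF _ cpt_Pair, of r s t "\<lambda>x y. if x then fst y else snd y"]
  by (simp only: fst_conv snd_conv)

lemma recog_all: "cpt t \<Longrightarrow> recog (\<lambda>M l. \<forall>e\<in>events M. t M l e)"
  by (rule recog_plug1[OF recog_all_events])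

lemma recog_exe: "cpt t \<Longrightarrow> recog (\<lambda>M l. \<exists>e\<in>events M. t M l e)"
  by (rule recog_plug1[OF recog_ex_event])

text \<open>A tile sees the predecessor's colour but not its label, so the colour republishes the
  label.\<close>

lemma cpt_onprd0: "cpt (\<lambda>M l. onprd M l)"
proof (rule cpt_boolI, rule recogI[of UNIV _ "\<lambda>_ _ l pv _ _ x. x = fst l \<and> snd l = (pv = Some True)" "\<lambda>_. True"])
  fix M and l :: "'p event \<Rightarrow> bool \<times> bool" assume M: "is_msc P Sig M"
  interpret msc_loc P Sig M by (rule msc_locI[OF M])
  let ?t = "tiling (\<lambda>_ _ l pv _ _ x. x = fst l \<and> snd l = (pv = Some True)) (\<lambda>_. True) UNIV M l"
  have "?t c \<longleftrightarrow> (\<forall>e\<in>events M. c e = fst (l e)) \<and> (\<forall>e\<in>events M. snd (l e) = onprd M (\<lambda>e. fst (l e)) e)" for c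
    unfolding tiling_def by (auto simp: prd_val_Some_iff onprd_def proc_rel_iff)
  then show "(\<forall>e\<in>events M. snd (l e) = onprd M (\<lambda>e. fst (l e)) e) = (\<exists>c. ?t c)" by auto
qed auto

lemma cpt_onsnd0: "cpt (\<lambda>M l. onsnd M l)"
proof (rule cpt_boolI, rule recogI[of UNIV _ "\<lambda>_ _ l _ sv _ x. x = fst l \<and> snd l = (sv = Some True)" "\<lambda>_. True"])
  fix M and l :: "'p event \<Rightarrow> bool \<times> bool" assume M: "is_msc P Sig M"
  interpret msc_loc P Sig M by (rule msc_locI[OF M])
  let ?t = "tiling (\<lambda>_ _ l _ sv _ x. x = fst l \<and> snd l = (sv = Some True)) (\<lambda>_. True) UNIV M l"
  have eq: "?t c \<longleftrightarrow> (\<forall>e\<in>events M. c e = fst (l e)) \<and> (\<forall>e\<in>events M. snd (l e) = onsnd M c e)" for c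
    unfolding tiling_def snd_val_Some_iff eq_True by blast
  have cong: "onsnd M c e = onsnd M (\<lambda>e. fst (l e)) e" if "\<forall>e\<in>events M. c e = fst (l e)" for c e
    unfolding onsnd_def using that msg_relD(1) by blast
  have "?t c \<longleftrightarrow> (\<forall>e\<in>events M. c e = fst (l e)) \<and> (\<forall>e\<in>events M. snd (l e) = onsnd M (\<lambda>e. fst (l e)) e)" for c
    unfolding eq using cong by blast
  then show "(\<forall>e\<in>events M. snd (l e) = onsnd M (\<lambda>e. fst (l e)) e) = (\<exists>c. ?t c)" by auto
qed auto

text \<open>Information flows forward only, so an event guesses what its successor will show. The
  successor rejects a wrong guess, and acceptance rejects a positive guess at the last event of a
  process.\<close>

lemma cpt_onsuc0: "cpt (\<lambda>M l. onsuc M l)"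
proof (rule cpt_boolI, rule recogI[of UNIV _ "\<lambda>_ _ l pv _ _ x. x = snd l \<and> pv \<noteq> Some (\<not> fst l)" "\<lambda>f. \<forall>p. f p \<noteq> Some True"])
  fix M and l :: "'p event \<Rightarrow> bool \<times> bool" assume M: "is_msc P Sig M"
  interpret msc_loc P Sig M by (rule msc_locI[OF M])
  let ?t = "tiling (\<lambda>_ _ l pv _ _ x. x = snd l \<and> pv \<noteq> Some (\<not> fst l)) (\<lambda>f. \<forall>p. f p \<noteq> Some True) UNIV M l"
  have last: "(e, f) \<notin> proc_rel M" if "snd e = length (word M (fst e))" for e f
    using that by (auto simp: proc_rel_iff event_iff)
  have 1: "\<forall>e\<in>events M. snd (l e) = onsuc M (\<lambda>e. fst (l e)) e" if t: "?t c" for c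
  proof
    fix e assume e: "e \<in> events M"
    have ce: "c e = snd (l e)" using t e unfolding tiling_def by blast
    show "snd (l e) = onsuc M (\<lambda>e. fst (l e)) e"
    proof (cases "snd e = length (word M (fst e))")
      case True
      then have "last_val M c (fst e) = Some (c e)"
        using e by (cases e) (auto simp: last_val_def event_iff)
      moreover have "last_val M c (fst e) \<noteq> Some True" using t unfolding tiling_def by blast
      ultimately show ?thesis using ce last[OF True] unfolding onsuc_def by auto
    next
      case False
      then have *: "(e, (fst e, Suc (snd e))) \<in> proc_rel M" (is "(e, ?f) \<in> _")
        using e by (auto simp: proc_rel_iff event_iff)
      have "prd_val M c ?f \<noteq> Some (\<not> fst (l ?f))"
        using t * proc_rel_iff unfolding tiling_def by blast
      then have "c e = fst (l ?f)" using prd_val_eq[OF *, of c] by auto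
      moreover have "onsuc M (\<lambda>e. fst (l e)) e = fst (l ?f)"
        using * by (rule onsuc_eq)
      ultimately show ?thesis using ce by simp
    qed
  qed
  have 2: "?t (\<lambda>e. snd (l e))" if h: "\<forall>e\<in>events M. snd (l e) = onsuc M (\<lambda>e. fst (l e)) e"
  proof -
    have "prd_val M (\<lambda>e. snd (l e)) f \<noteq> Some (\<not> fst (l f))" if f: "f \<in> events M" for f
    proof
      assume "prd_val M (\<lambda>e. snd (l e)) f = Some (\<not> fst (l f))"
      then obtain d where d: "(d, f) \<in> proc_rel M" "snd (l d) = (\<not> fst (l f))"
        using prd_val_Some_iff[OF f] unfolding onprd_def by metis
      then have "onsuc M (\<lambda>e. fst (l e)) d = fst (l f)"
        by (intro onsuc_eq)
      then show False using h d by (auto simp: proc_rel_iff)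
    qed
    moreover have "last_val M (\<lambda>e. snd (l e)) p \<noteq> Some True" for p
      using h last_event[of p] last[of "(p, length (word M p))"] by (auto simp: last_val_def onsuc_def)
    ultimately show ?thesis unfolding tiling_def by auto
  qed
  show "(\<forall>e\<in>events M. snd (l e) = onsuc M (\<lambda>e. fst (l e)) e) = (\<exists>c. ?t c)"
    using 1 2 by blast
qed auto

text \<open>As for the process successor, with the receiver checking the guess. An event that sends
  nothing has no such check and must guess \<open>False\<close>; the sending flag of tiles serves
  this purpose.\<close>

lemma cpt_onrcv0: "cpt (\<lambda>M l. onrcv M l)"
proof (rule cpt_boolI, rule recogI[of UNIV _ "\<lambda>_ _ l _ sv rv x. x = snd l \<and> sv \<noteq> Some (\<not> fst l) \<and> (snd l \<longrightarrow> rv)" "\<lambda>f. True"])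
  fix M and l :: "'p event \<Rightarrow> bool \<times> bool" assume M: "is_msc P Sig M"
  interpret msc_loc P Sig M by (rule msc_locI[OF M])
  let ?t = "tiling (\<lambda>_ _ l _ sv rv x. x = snd l \<and> sv \<noteq> Some (\<not> fst l) \<and> (snd l \<longrightarrow> rv)) (\<lambda>f. True) UNIV M l"
  have 1: "\<forall>e\<in>events M. snd (l e) = onrcv M (\<lambda>e. fst (l e)) e" if t: "?t c" for c
  proof
    fix e assume e: "e \<in> events M"
    have ce: "c e = snd (l e)" "snd (l e) \<Longrightarrow> e \<in> Domain (msg_rel M)" using t e unfolding tiling_def by blast+
    show "snd (l e) = onrcv M (\<lambda>e. fst (l e)) e"
    proof (cases "e \<in> Domain (msg_rel M)")
      case True
      then obtain f where *: "(e, f) \<in> msg_rel M" by blast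
      have "snd_val M c f \<noteq> Some (\<not> fst (l f))"
        using t * msg_relD(2) unfolding tiling_def by blast
      then have "c e = fst (l f)" using snd_val_eq[OF *, of c] by auto
      moreover have "onrcv M (\<lambda>e. fst (l e)) e = fst (l f)"
        using * by (rule onrcv_eq)
      ultimately show ?thesis using ce by simp
    qed (use ce in \<open>auto simp: onrcv_def\<close>)
  qed
  have 2: "?t (\<lambda>e. snd (l e))" if h: "\<forall>e\<in>events M. snd (l e) = onrcv M (\<lambda>e. fst (l e)) e"
  proof -
    have "snd_val M (\<lambda>e. snd (l e)) f \<noteq> Some (\<not> fst (l f))" for f
    proof
      assume "snd_val M (\<lambda>e. snd (l e)) f = Some (\<not> fst (l f))"
      then obtain d where d: "(d, f) \<in> msg_rel M" "snd (l d) = (\<not> fst (l f))"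
        using snd_val_Some_iff unfolding onsnd_def by metis
      then have "onrcv M (\<lambda>e. fst (l e)) d = fst (l f)"
        by (intro onrcv_eq)
      then show False using h d msg_relD(1) by blast
    qed
    then show ?thesis using h unfolding tiling_def onrcv_def by auto
  qed
  show "(\<forall>e\<in>events M. snd (l e) = onrcv M (\<lambda>e. fst (l e)) e) = (\<exists>c. ?t c)"
    using 1 2 by blast
qed auto

lemma cpt_onprd: "cpt t \<Longrightarrow> cpt (\<lambda>M l. onprd M (t M l))"
  by (rule cpt_comp[OF cpt_onprd0])

lemma cpt_onsnd: "cpt t \<Longrightarrow> cpt (\<lambda>M l. onsnd M (t M l))"
  by (rule cpt_comp[OF cpt_onsnd0])

lemma cpt_onsuc: "cpt t \<Longrightarrow> cpt (\<lambda>M l. onsuc M (t M l))"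
  by (rule cpt_comp[OF cpt_onsuc0])

lemma cpt_onrcv: "cpt t \<Longrightarrow> cpt (\<lambda>M l. onrcv M (t M l))"
  by (rule cpt_comp[OF cpt_onrcv0])

text \<open>A term that is, on events, the only solution of a computable equation can be guessed and
  verified through the equation.\<close>

lemma cpt_fix:
  fixes t :: "('p, 'a) msc \<Rightarrow> ('p event \<Rightarrow> 'l) \<Rightarrow> 'p event \<Rightarrow> bool"
  assumes "cpt (\<lambda>M l. G M (\<lambda>e. fst (l e)) (\<lambda>e. snd (l e)))"
    and "\<And>M l b. is_msc P Sig M \<Longrightarrow>
      (\<forall>e\<in>events M. b e = t M l e) \<longleftrightarrow> (\<forall>e\<in>events M. b e = G M l b e)"
  shows "cpt t"
proof (rule cpt_boolI, rule recog_cong)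
  show "recog (\<lambda>M l. \<forall>e\<in>events M. snd (l e) = G M (\<lambda>e. fst (l e)) (\<lambda>e. snd (l e)) e)"
    by (rule recog_all, rule cpt_map2[OF _ assms(1), of _ "(=)"], rule cpt_localb, rule local_termI) simp
qed (use assms(2) in auto)

end

declare split_paired_All [simp del] split_paired_Ex [simp del]

section \<open>Token links\<close>

definition up :: "('p, 'a) msc \<Rightarrow> ('p event \<Rightarrow> bool) \<Rightarrow> 'p event \<Rightarrow> bool" where
  "up M W y \<longleftrightarrow> (\<exists>x\<in>events M. W x \<and> (x, y) \<in> causal_le M)"

definition down :: "('p, 'a) msc \<Rightarrow> ('p event \<Rightarrow> bool) \<Rightarrow> 'p event \<Rightarrow> bool" where
  "down M W y \<longleftrightarrow> (\<exists>x\<in>events M. W x \<and> (y, x) \<in> causal_le M)"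

definition lastp :: "('p, 'a) msc \<Rightarrow> ('p event \<Rightarrow> bool) \<Rightarrow> 'p event \<Rightarrow> 'p event \<Rightarrow> bool" where
  "lastp M U x u \<longleftrightarrow> u \<in> events M \<and> fst u = fst x \<and> snd u \<le> snd x \<and> U u \<and>
     (\<forall>v\<in>events M. fst v = fst x \<longrightarrow> snd v \<le> snd x \<longrightarrow> U v \<longrightarrow> snd v \<le> snd u)"

definition nextp :: "('p, 'a) msc \<Rightarrow> ('p event \<Rightarrow> bool) \<Rightarrow> 'p event \<Rightarrow> 'p event \<Rightarrow> bool" where
  "nextp M U x u \<longleftrightarrow> u \<in> events M \<and> fst u = fst x \<and> snd x \<le> snd u \<and> U u \<and>
     (\<forall>v\<in>events M. fst v = fst x \<longrightarrow> snd x \<le> snd v \<longrightarrow> U v \<longrightarrow> snd u \<le> snd v)"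

text \<open>
  \<open>lv M F w x f\<close>: tracing back from \<open>x\<close> through the processes listed in \<open>w\<close>, always taking the
  latest message from the next process in \<open>w\<close>, the last \<open>F\<close>-event found on the final process is \<open>f\<close>.
\<close>

fun lv :: "('p, 'a) msc \<Rightarrow> ('p event \<Rightarrow> bool) \<Rightarrow> 'p list \<Rightarrow> 'p event \<Rightarrow> 'p event \<Rightarrow> bool" where
  "lv M F [] x f \<longleftrightarrow> False"
| "lv M F [p] x f \<longleftrightarrow> fst x = p \<and> lastp M F x f"
| "lv M F (p # r # w) x f \<longleftrightarrow> fst x = p \<and>
     (\<exists>u. lastp M (onsnd M (\<lambda>d. fst d = r)) x u \<and> onsnd M (\<lambda>d. fst d = r \<and> lv M F (r # w) d f) u)"

text \<open>Relaxed form of \<open>lv\<close>: at every process some message from the next process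
  is followed, not necessarily the latest, and \<open>f\<close> is any event at or before the place
  reached.\<close>

fun via :: "('p, 'a) msc \<Rightarrow> 'p list \<Rightarrow> 'p event \<Rightarrow> 'p event \<Rightarrow> bool" where
  "via M [] f x \<longleftrightarrow> False"
| "via M [p] f x \<longleftrightarrow> fst x = p \<and> fst f = p \<and> snd f \<le> snd x"
| "via M (p # r # w) f x \<longleftrightarrow> fst x = p \<and>
     (\<exists>u d. fst u = p \<and> snd u \<le> snd x \<and> (d, u) \<in> msg_rel M \<and> fst d = r \<and> via M (r # w) f d)"

text \<open>
  A link is a system of tokens that start at \<open>X\<close>-events and travel along process and message edges
  to all \<open>Y\<close>-events, with at most one token per event.
\<close>

definition link :: "('p, 'a) msc \<Rightarrow> ('p event \<Rightarrow> bool) \<Rightarrow> ('p event \<Rightarrow> bool) \<Rightarrow> bool" where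
  "link M X Y \<longleftrightarrow> (\<exists>b. (\<forall>e\<in>events M. b e \<in> UNIV) \<and> (\<forall>e\<in>events M. (Y e \<longrightarrow> fst (b e)) \<and>
     (fst (b e) \<longrightarrow> X e \<or> onprd M (\<lambda>d. fst (b d) \<and> snd (b d) \<and> \<not> Y d) e \<or>
        onsnd M (\<lambda>d. fst (b d) \<and> \<not> snd (b d) \<and> \<not> Y d) e)))"

context msc_loc
begin

lemma onprd_step: "onprd M U e \<or> onsnd M U e \<longleftrightarrow> (\<exists>d. (d, e) \<in> step M \<and> U d)"
  by (auto simp: onprd_def onsnd_def step_def)

lemma onsuc_step: "onsuc M U e \<or> onrcv M U e \<longleftrightarrow> (\<exists>d. (e, d) \<in> step M \<and> U d)"
  by (auto simp: onsuc_def onrcv_def step_def)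

text \<open>\<open>G\<close> at \<open>e\<close> reads its argument only at
  \<open>r\<close>-predecessors, so induction along \<open>r\<close> leaves a single solution. Used
  with \<open>step\<close> for information from the past and with its converse for information from
  the future.\<close>

lemma local_recursion_unique:
  assumes "wf r" "\<And>d e. (d, e) \<in> r \<Longrightarrow> d \<in> events M"
    and dep: "\<And>b b' e. e \<in> events M \<Longrightarrow> (\<And>d. (d, e) \<in> r \<Longrightarrow> b d = b' d) \<Longrightarrow> G b e = G b' e"
    and sol: "\<And>e. e \<in> events M \<Longrightarrow> t e = G t e"
  shows "(\<forall>e\<in>events M. b e = t e) \<longleftrightarrow> (\<forall>e\<in>events M. b e = G b e)"
proof
  assume a: "\<forall>e\<in>events M. b e = t e"
  show "\<forall>e\<in>events M. b e = G b e"
  proof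
    fix e assume e: "e \<in> events M"
    have "G b e = G t e" by (rule dep[OF e]) (use a assms(2) in blast)
    then show "b e = G b e" using a e sol by simp
  qed
next
  assume a: "\<forall>e\<in>events M. b e = G b e"
  have "e \<in> events M \<longrightarrow> b e = t e" for e
    using assms(1)
  proof (induction e rule: wf_induct_rule)
    case (less e)
    show ?case
    proof
      assume e: "e \<in> events M"
      have "G b e = G t e" by (rule dep[OF e]) (use less assms(2) in blast)
      then show "b e = t e" using a e sol by simp
    qed
  qed
  then show "\<forall>e\<in>events M. b e = t e" by blast
qed

lemma up_rec: "e \<in> events M \<Longrightarrow> up M W e \<longleftrightarrow> W e \<or> onprd M (up M W) e \<or> onsnd M (up M W) e"
  unfolding onprd_step unfolding up_def by (metis cle_last)

lemma down_rec: "e \<in> events M \<Longrightarrow> down M W e \<longleftrightarrow> W e \<or> onsuc M (down M W) e \<or> onrcv M (down M W) e"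
  unfolding onsuc_step unfolding down_def by (metis cle_first)

lemma lastp_unique: "lastp M U x u \<Longrightarrow> lastp M U x v \<Longrightarrow> u = v"
  unfolding lastp_def by (metis dual_order.antisym prod.collapse)

lemma nextp_unique: "nextp M U x u \<Longrightarrow> nextp M U x v \<Longrightarrow> u = v"
  unfolding nextp_def by (metis dual_order.antisym prod.collapse)

lemma lastp_exists:
  assumes "v \<in> events M" "fst v = fst x" "snd v \<le> snd x" "U v"
  shows "\<exists>u. lastp M U x u"
proof -
  let ?S = "{v \<in> events M. fst v = fst x \<and> snd v \<le> snd x \<and> U v}"
  have f: "finite ?S" "?S \<noteq> {}" using finite_events assms by (simp, blast)
  then have "Max (snd ` ?S) \<in> snd ` ?S" by simp
  then obtain u where u: "u \<in> ?S" "snd u = Max (snd ` ?S)" by (metis (no_types, lifting) imageE)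
  have "snd v \<le> snd u" if "v \<in> ?S" for v using u f that by simp
  then show ?thesis unfolding lastp_def using u by blast
qed

lemma lastp_rec:
  assumes "e \<in> events M"
  shows "lastp M U e u \<longleftrightarrow> (if U e then u = e else onprd M (\<lambda>d. lastp M U d u) e)"
proof (cases "U e")
  case True
  then have "lastp M U e e" using assms by (auto simp: lastp_def)
  then show ?thesis using True lastp_unique[of U e] by metis
next
  case False
  have *: "\<forall>v. fst v = fst e \<longrightarrow> U v \<longrightarrow> snd v \<le> snd e \<longleftrightarrow> snd v \<le> snd d" if "(d, e) \<in> proc_rel M" for d
    using that False unfolding proc_rel_iff by (metis le_Suc_eq prod.collapse)
  have eq: "lastp M U e u \<longleftrightarrow> lastp M U d u" if d: "(d, e) \<in> proc_rel M" for d
    using *[OF d] d unfolding lastp_def proc_rel_iff by auto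
  have ex: "\<exists>d. (d, e) \<in> proc_rel M" if l: "lastp M U e u"
  proof -
    have "snd u \<noteq> snd e" using l False by (auto simp: lastp_def) (metis prod.collapse)
    then have "((fst e, snd e - 1), e) \<in> proc_rel M"
      using l assms by (auto simp: lastp_def proc_rel_iff event_iff)
    then show ?thesis by blast
  qed
  show ?thesis unfolding onprd_def if_not_P[OF False] using eq ex by blast
qed

lemma nextp_rec:
  assumes "e \<in> events M"
  shows "nextp M U e u \<longleftrightarrow> (if U e then u = e else onsuc M (\<lambda>d. nextp M U d u) e)"
proof (cases "U e")
  case True
  then have "nextp M U e e" using assms by (auto simp: nextp_def)
  then show ?thesis using True nextp_unique[of U e] by metis
next
  case False
  have *: "\<forall>v. fst v = fst e \<longrightarrow> U v \<longrightarrow> snd e \<le> snd v \<longleftrightarrow> snd d \<le> snd v" if "(e, d) \<in> proc_rel M" for d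
    using that False unfolding proc_rel_iff by (metis Suc_le_eq le_neq_implies_less less_imp_le_nat prod.collapse)
  have eq: "nextp M U e u \<longleftrightarrow> nextp M U d u" if d: "(e, d) \<in> proc_rel M" for d
    using *[OF d] d unfolding nextp_def proc_rel_iff by auto
  have ex: "\<exists>d. (e, d) \<in> proc_rel M" if l: "nextp M U e u"
  proof -
    have "snd u \<noteq> snd e" using l False by (auto simp: nextp_def) (metis prod.collapse)
    then have "(e, (fst e, Suc (snd e))) \<in> proc_rel M"
      using l assms by (auto simp: nextp_def proc_rel_iff event_iff)
    then show ?thesis by blast
  qed
  show ?thesis unfolding onsuc_def if_not_P[OF False] using eq ex by blast
qed

lemma lv_ConsE:
  assumes "lv M F (p # r # w) x f"
  obtains u d where "fst x = p" "lastp M (onsnd M (\<lambda>d. fst d = r)) x u" "(d, u) \<in> msg_rel M" "fst d = r" "lv M F (r # w) d f"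
  using assms by (auto simp: onsnd_def)

lemma lv_unique: "lv M F w x f \<Longrightarrow> lv M F w x f' \<Longrightarrow> f = f'"
proof (induction w arbitrary: x)
  case (Cons p w)
  show ?case
  proof (cases w)
    case Nil
    then show ?thesis using Cons.prems lastp_unique[of F x] by simp
  next
    case (Cons r w')
    obtain u d where u: "lastp M (onsnd M (\<lambda>d. fst d = r)) x u" "(d, u) \<in> msg_rel M" "lv M F w d f"
      using Cons.prems(1) unfolding Cons by (rule lv_ConsE)
    obtain u' d' where u': "lastp M (onsnd M (\<lambda>d. fst d = r)) x u'" "(d', u') \<in> msg_rel M" "lv M F w d' f'"
      using Cons.prems(2) unfolding Cons by (rule lv_ConsE)
    have "u' = u" using u(1) u'(1) lastp_unique by blast
    then have "d' = d" using u(2) u'(2) msg_sender_unique by blast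
    then show ?thesis using Cons.IH u(3) u'(3) by blast
  qed
qed simp

lemma lastp_cle: "lastp M U x u \<Longrightarrow> x \<in> events M \<Longrightarrow> u \<preceq> x"
  by (simp add: lastp_def same_proc_le)

lemma msg_cle: "(d, u) \<in> msg_rel M \<Longrightarrow> d \<preceq> u"
  by (simp add: step_cle step_def)

lemma lv_le: "lv M F w x f \<Longrightarrow> x \<in> events M \<Longrightarrow> f \<preceq> x \<and> F f \<and> f \<in> events M"
proof (induction w arbitrary: x)
  case (Cons p w)
  show ?case
  proof (cases w)
    case Nil
    then show ?thesis using Cons.prems lastp_cle[of F x f] by (simp add: lastp_def)
  next
    case (Cons r w')
    obtain u d where u: "lastp M (onsnd M (\<lambda>d. fst d = r)) x u" "(d, u) \<in> msg_rel M" "lv M F w d f"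
      using Cons.prems(1) unfolding Cons by (rule lv_ConsE)
    have "d \<preceq> x" using lastp_cle[OF u(1) Cons.prems(2)] msg_cle[OF u(2)] cle_trans by blast
    then show ?thesis using Cons.IH[OF u(3)] msg_relD(1)[OF u(2)] cle_trans by blast
  qed
qed simp

lemma via_mono: "via M w f x \<Longrightarrow> fst x = fst y \<Longrightarrow> snd x \<le> snd y \<Longrightarrow> via M w f y"
  by (cases "(M, w, f, x)" rule: via.cases) (auto intro: order_trans)

lemma via_suffix: "via M (w1 @ p # w) f x \<Longrightarrow> x \<in> events M \<Longrightarrow>
   \<exists>y\<in>events M. fst y = p \<and> via M (p # w) f y \<and> y \<preceq> x"
proof (induction w1 arbitrary: x)
  case Nil
  then have "fst x = p" by (cases w) auto
  then show ?case using Nil by (auto intro: bexI[of _ x])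
next
  case (Cons q w1)
  obtain r w' where w: "w1 @ p # w = r # w'" by (cases w1) auto
  obtain u d where u: "fst u = fst x" "snd u \<le> snd x" "(d, u) \<in> msg_rel M" "via M (w1 @ p # w) f d"
    using Cons.prems(1) unfolding append_Cons w by auto
  have "u \<preceq> x" using u same_proc_le msg_relD(2) Cons.prems(2) by blast
  then have "d \<preceq> x" using msg_cle[OF u(3)] cle_trans by blast
  then show ?case using Cons.IH[OF u(4)] msg_relD(1)[OF u(3)] cle_trans by blast
qed

text \<open>When the chain returns to a process that it has already visited, the part in between is
  cut out with \<open>via_suffix\<close> and the order on that process. Lists without repetition
  over \<open>P\<close> are finitely many, which keeps the number of visibility tests
  finite.\<close>

lemma via_exists:
  assumes "f \<preceq> x" "f \<in> events M"
  shows "\<exists>w. distinct w \<and> set w \<subseteq> P \<and> w \<noteq> [] \<and> hd w = fst x \<and> via M w f x"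
  using assms(1) unfolding causal_le_step
proof (induction rule: rtrancl_induct)
  case base
  show ?case using fst_event[OF assms(2)] by (intro exI[of _ "[fst f]"]) auto
next
  case (step y z)
  then obtain w where w: "distinct w" "set w \<subseteq> P" "w \<noteq> []" "hd w = fst y" "via M w f y" by blast
  have ev: "y \<in> events M" "z \<in> events M" using step_events[OF step.hyps(2)] by auto
  consider "(y, z) \<in> proc_rel M" | "(y, z) \<in> msg_rel M" using step.hyps(2) by (auto simp: step_def)
  then show ?case
  proof cases
    case 1
    then show ?thesis using w via_mono[of w f y z] by (auto simp: proc_rel_iff)
  next
    case 2
    obtain r w' where rw: "w = r # w'" using w(3) by (cases w) auto
    show ?thesis
    proof (cases "fst z \<in> set w")
      case False
      have "via M (fst z # w) f z" unfolding rw via.simps using 2 w(4,5) rw by (metis list.sel(1) order_refl)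
      then show ?thesis using False w fst_event[OF ev(2)] by (intro exI[of _ "fst z # w"]) auto
    next
      case True
      then obtain w1 w2 where s: "w = w1 @ fst z # w2" by (meson split_list)
      obtain y' where y': "y' \<in> events M" "fst y' = fst z" "via M (fst z # w2) f y'" "y' \<preceq> y"
        using via_suffix[of w1 "fst z" w2 f y] w(5) s ev(1) by blast
      have "y' \<preceq> z" using y'(4) msg_cle[OF 2] cle_trans by blast
      then have "snd y' \<le> snd z" using cle_same_proc y' ev(2) by blast
      then have "via M (fst z # w2) f z" using via_mono y' by blast
      then show ?thesis using w s by (intro exI[of _ "fst z # w2"]) auto
    qed
  qed
qed

lemma fifo:
  assumes "(d, u) \<in> msg_rel M" "(d', u') \<in> msg_rel M" "fst d = fst d'" "fst u = fst u'" "snd u \<le> snd u'"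
  shows "snd d \<le> snd d'"
proof (rule ccontr)
  assume n: "\<not> snd d \<le> snd d'"
  have ev: "d \<in> events M" "u \<in> events M" "d' \<in> events M" "u' \<in> events M" "fst d \<noteq> fst u"
    using assms(1,2) msg_relD by blast+
  have pr: "(x, y) \<in> (proc_rel M)\<^sup>* \<Longrightarrow> x \<preceq> y" for x y
    unfolding causal_le_def by (metis Un_upper1 rtrancl_mono subsetD)
  have conv: "(x, y) \<in> (proc_rel M)\<^sup>*" if "x \<in> events M" "y \<in> events M" "fst x = fst y" "snd x \<le> snd y" for x y
  proof -
    have "(fst x, snd x + k) \<in> events M \<Longrightarrow> (x, (fst x, snd x + k)) \<in> (proc_rel M)\<^sup>*" for k
    proof (induction k)
      case (Suc k)
      then have a: "(fst x, snd x + k) \<in> events M" using that by (auto simp: event_iff)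
      have "((fst x, snd x + k), (fst x, snd x + Suc k)) \<in> proc_rel M"
        using a Suc.prems by (simp add: proc_rel_iff)
      then show ?case using Suc.IH[OF a] by (rule rtrancl_into_rtrancl[rotated])
    qed simp
    from this[of "snd y - snd x"] show ?thesis using that by (metis le_add_diff_inverse prod.collapse)
  qed
  have "\<forall>p\<in>P. \<forall>q\<in>P. p \<noteq> q \<longrightarrow>
        (\<forall>(e, f) \<in> msg_rel M \<inter> (events_on M p \<times> events_on M q).
         \<forall>(e', f') \<in> msg_rel M \<inter> (events_on M p \<times> events_on M q).
           (e, e') \<in> (proc_rel M)\<^sup>* \<longleftrightarrow> (f, f') \<in> (proc_rel M)\<^sup>*)"
    using msc_conds by (elim conjE)
  from this[rule_format, OF fst_event[OF ev(1)] fst_event[OF ev(2)] ev(5)]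
  have ff: "\<And>e f e' f'. (e, f) \<in> msg_rel M \<inter> (events_on M (fst d) \<times> events_on M (fst u)) \<Longrightarrow>
     (e', f') \<in> msg_rel M \<inter> (events_on M (fst d) \<times> events_on M (fst u)) \<Longrightarrow>
     (e, e') \<in> (proc_rel M)\<^sup>* \<longleftrightarrow> (f, f') \<in> (proc_rel M)\<^sup>*"
    by blast
  have in1: "(d, u) \<in> msg_rel M \<inter> (events_on M (fst d) \<times> events_on M (fst u))"
    "(d', u') \<in> msg_rel M \<inter> (events_on M (fst d) \<times> events_on M (fst u))"
    using assms ev by (auto simp: events_on_iff)
  have "(u, u') \<in> (proc_rel M)\<^sup>*" using conv ev assms by blast
  then have "(d, d') \<in> (proc_rel M)\<^sup>*" using ff[OF in1] by blast
  then have "d \<preceq> d'" by (rule pr)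
  then show False using n cle_same_proc[OF ev(1,3) assms(3)] by blast
qed

text \<open>FIFO makes the greedy trace optimal. The later of two receptions on a channel has the
  later sender, so going back along the latest message from \<open>r\<close> never falls behind the
  given chain; as \<open>f\<close> is the last \<open>F\<close>-event below \<open>x\<close>, the
  trace ends in \<open>f\<close> itself.\<close>

lemma lv_last:
  assumes "via M w f x" "x \<in> events M" "f \<in> events M" "F f"
    and "\<And>f'. f' \<in> events M \<Longrightarrow> F f' \<Longrightarrow> fst f' = fst f"
    and "\<And>f'. f' \<in> events M \<Longrightarrow> F f' \<Longrightarrow> f' \<preceq> x \<Longrightarrow> snd f' \<le> snd f"
  shows "lv M F w x f"
  using assms(1,2,6)
proof (induction w arbitrary: x)
  case (Cons p w)
  show ?case
  proof (cases w)
    case Nil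
    have "lastp M F x f" unfolding lastp_def using Cons.prems assms(3,4) Nil by (auto simp: same_proc_le)
    then show ?thesis using Cons.prems Nil by simp
  next
    case (Cons r w')
    obtain u d where u: "fst x = p" "fst u = fst x" "snd u \<le> snd x" "(d, u) \<in> msg_rel M" "fst d = r" "via M w f d"
      using Cons.prems(1) unfolding Cons by auto
    have "onsnd M (\<lambda>d. fst d = r) u" using u unfolding onsnd_def by blast
    then obtain u0 where u0: "lastp M (onsnd M (\<lambda>d. fst d = r)) x u0"
      using lastp_exists u msg_relD(2) by blast
    then obtain d0 where d0: "(d0, u0) \<in> msg_rel M" "fst d0 = r" by (auto simp: lastp_def onsnd_def)
    have "snd u \<le> snd u0" using u0 u \<open>onsnd M _ u\<close> msg_relD(2)[OF u(4)] by (auto simp: lastp_def)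
    moreover have "fst u = fst u0" using u0 u by (simp add: lastp_def)
    ultimately have "snd d \<le> snd d0" using fifo[OF u(4) d0(1)] u(5) d0(2) by simp
    then have v: "via M w f d0" using via_mono[OF u(6)] u(5) d0(2) by simp
    have d0x: "d0 \<preceq> x" using lastp_cle[OF u0 Cons.prems(2)] msg_cle[OF d0(1)] cle_trans by blast
    have "lv M F w d0 f"
      by (rule Cons.IH[OF v msg_relD(1)[OF d0(1)]]) (use Cons.prems(3) d0x cle_trans in blast)
    then show ?thesis unfolding Cons using u(1) u0 d0 by (auto simp: onsnd_def)
  qed
qed simp

text \<open>\<open>fst (b e)\<close> says that \<open>e\<close> holds a token,
  \<open>snd (b e)\<close> whether it leaves along the process edge or along the message. So moves
  are deterministic, and tokens stop at \<open>Y\<close>-events. Two targets with the same origin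
  would lie on one trajectory, where the first of them would already have stopped the token.\<close>

lemma link_sound:
  assumes "link M X Y"
  shows "\<exists>t. inj_on t {y \<in> events M. Y y} \<and> (\<forall>y\<in>events M. Y y \<longrightarrow> t y \<in> events M \<and> X (t y) \<and> t y \<preceq> y)"
proof -
  obtain b where b1: "\<And>e. e \<in> events M \<Longrightarrow> Y e \<Longrightarrow> fst (b e)"
    and b2: "\<And>e. e \<in> events M \<Longrightarrow> fst (b e) \<Longrightarrow> X e \<or> onprd M (\<lambda>d. fst (b d) \<and> snd (b d) \<and> \<not> Y d) e \<or>
        onsnd M (\<lambda>d. fst (b d) \<and> \<not> snd (b d) \<and> \<not> Y d) e"
    using assms unfolding link_def by (elim exE) blast
  define R where "R = {(d, e). fst (b d) \<and> \<not> Y d \<and> (if snd (b d) then (d, e) \<in> proc_rel M else (d, e) \<in> msg_rel M)}"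
  have Rstep: "R \<subseteq> step M" by (auto simp: R_def step_def split: if_splits)
  have sv: "single_valued R"
    unfolding single_valued_def R_def
    using proc_rel_unique msg_receiver_unique by (auto split: if_splits; blast)
  have origin: "e \<in> events M \<longrightarrow> fst (b e) \<longrightarrow> (\<exists>x\<in>events M. X x \<and> (x, e) \<in> R\<^sup>*)" for e
    using wf_step
  proof (induction e rule: wf_induct_rule)
    case (less e)
    show ?case
    proof (intro impI)
      assume e: "e \<in> events M" "fst (b e)"
      from b2[OF this] have "X e \<or> (\<exists>d. (d, e) \<in> R \<and> fst (b d))"
        unfolding onprd_def onsnd_def R_def by auto
      then consider "X e" | d where "(d, e) \<in> R" "fst (b d)" by blast
      then show "\<exists>x\<in>events M. X x \<and> (x, e) \<in> R\<^sup>*"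
      proof cases
        case 2
        then have "(d, e) \<in> step M" using Rstep by blast
        then have "\<exists>x\<in>events M. X x \<and> (x, d) \<in> R\<^sup>*" using less 2(2) step_events by blast
        then show ?thesis using 2(1) by (meson rtrancl_into_rtrancl)
      qed (use e in blast)
    qed
  qed
  have "\<forall>y. \<exists>x. y \<in> events M \<longrightarrow> Y y \<longrightarrow> x \<in> events M \<and> X x \<and> (x, y) \<in> R\<^sup>*"
    using origin b1 by blast
  then obtain t where t: "\<And>y. y \<in> events M \<Longrightarrow> Y y \<Longrightarrow> t y \<in> events M \<and> X (t y) \<and> (t y, y) \<in> R\<^sup>*"
    by metis
  have stuck: "y = z" if "(y, z) \<in> R\<^sup>*" "Y y" for y z
    using that by (auto elim: converse_rtranclE simp: R_def)
  have "inj_on t {y \<in> events M. Y y}"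
  proof (rule inj_onI)
    fix y z assume a: "y \<in> {y \<in> events M. Y y}" "z \<in> {y \<in> events M. Y y}" "t y = t z"
    then have "(y, z) \<in> R\<^sup>* \<or> (z, y) \<in> R\<^sup>*"
      using single_valued_confluent[OF sv] t by (metis (mono_tags, lifting) mem_Collect_eq)
    then show "y = z" using stuck a by blast
  qed
  moreover have "t y \<preceq> y" if "y \<in> events M" "Y y" for y
    using t[OF that] rtrancl_mono[OF Rstep] unfolding causal_le_step by blast
  ultimately show ?thesis using t by blast
qed

text \<open>The trajectory of a single token: \<open>T\<close> consists of the vertices of a path
  and \<open>out\<close> tells how each of them is left; \<open>d \<noteq> y\<close> because the
  token stops at \<open>y\<close>.\<close>

lemma path_tokens:
  assumes "x \<preceq> y" "x \<in> events M"
  shows "\<exists>T out. x \<in> T \<and> y \<in> T \<and> (\<forall>e\<in>T. x \<preceq> e \<and> e \<preceq> y) \<and>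
    (\<forall>e\<in>T. e = x \<or> onprd M (\<lambda>d. d \<in> T \<and> out d \<and> d \<noteq> y) e \<or> onsnd M (\<lambda>d. d \<in> T \<and> \<not> out d \<and> d \<noteq> y) e)"
  using assms(1) unfolding causal_le_step
proof (induction rule: rtrancl_induct)
  case base
  show ?case by (intro exI[of _ "{x}"]) auto
next
  case (step y z)
  then obtain T out where T: "x \<in> T" "y \<in> T" "\<And>e. e \<in> T \<Longrightarrow> x \<preceq> e \<and> e \<preceq> y"
    "\<And>e. e \<in> T \<Longrightarrow> e = x \<or> onprd M (\<lambda>d. d \<in> T \<and> out d \<and> d \<noteq> y) e \<or> onsnd M (\<lambda>d. d \<in> T \<and> \<not> out d \<and> d \<noteq> y) e"
    unfolding causal_le_step by blast
  have z: "z \<notin> T" using T(3) step_irrefl step.hyps(2) by blast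
  have yz: "y \<noteq> z" using z T by blast
  have le: "e \<preceq> z" if "e \<in> T" for e using T(3)[OF that] step_cle[OF step.hyps(2)] cle_trans by blast
  let ?o = "out(y := ((y, z) \<in> proc_rel M))"
  have "e = x \<or> onprd M (\<lambda>d. d \<in> insert z T \<and> ?o d \<and> d \<noteq> z) e \<or> onsnd M (\<lambda>d. d \<in> insert z T \<and> \<not> ?o d \<and> d \<noteq> z) e"
    if e: "e \<in> insert z T" for e
  proof (cases "e = z")
    case True
    consider "(y, z) \<in> proc_rel M" | "(y, z) \<notin> proc_rel M" "(y, z) \<in> msg_rel M"
      using step.hyps(2) unfolding step_def by blast
    then show ?thesis
    proof cases
      case 1
      then have "onprd M (\<lambda>d. d \<in> insert z T \<and> ?o d \<and> d \<noteq> z) z"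
        unfolding onprd_def using T(2) yz by (intro exI[of _ y]) simp
      then show ?thesis using True by blast
    next
      case 2
      then have "onsnd M (\<lambda>d. d \<in> insert z T \<and> \<not> ?o d \<and> d \<noteq> z) z"
        unfolding onsnd_def using T(2) yz by (intro exI[of _ y]) simp
      then show ?thesis using True by blast
    qed
  next
    case False
    then have "e \<in> T" using e by blast
    from T(4)[OF this] z show ?thesis unfolding onprd_def onsnd_def by auto
  qed
  then show ?case
    using T le step.hyps(1)[folded causal_le_step] step_cle[OF step.hyps(2)] cle_trans
    unfolding causal_le_step[symmetric]
    by (intro exI[of _ "insert z T"] exI[of _ ?o]) (auto intro: cle_trans)
qed

text \<open>Disjointness of the causal intervals makes the paths of the tokens vertex-disjoint.\<close>

lemma link_complete:
  assumes t: "\<And>y. y \<in> events M \<Longrightarrow> Y y \<Longrightarrow> t y \<in> events M \<and> X (t y) \<and> t y \<preceq> y"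
    and disj: "\<And>y y' z. \<lbrakk>y \<in> events M; Y y; y' \<in> events M; Y y'; t y \<preceq> z; z \<preceq> y; t y' \<preceq> z; z \<preceq> y'\<rbrakk> \<Longrightarrow> y = y'"
  shows "link M X Y"
proof -
  define good where "good y T out \<longleftrightarrow> t y \<in> T \<and> y \<in> T \<and> (\<forall>e\<in>T. t y \<preceq> e \<and> e \<preceq> y) \<and>
    (\<forall>e\<in>T. e = t y \<or> onprd M (\<lambda>d. d \<in> T \<and> out d \<and> d \<noteq> y) e \<or> onsnd M (\<lambda>d. d \<in> T \<and> \<not> out d \<and> d \<noteq> y) e)"
    for y T out
  have "\<exists>T out. y \<in> events M \<longrightarrow> Y y \<longrightarrow> good y T out" for y
  proof (cases "y \<in> events M \<and> Y y")
    case True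
    then show ?thesis using path_tokens[of "t y" y] t[of y] unfolding good_def by blast
  qed blast
  then obtain T out where TO: "\<And>y. y \<in> events M \<Longrightarrow> Y y \<Longrightarrow> good y (T y) (out y)"
    by metis
  define own where "own e y \<longleftrightarrow> y \<in> events M \<and> Y y \<and> e \<in> T y" for e y
  have own: "t y \<preceq> e" "e \<preceq> y" "y \<in> events M" "Y y" if "own e y" for e y
    using that TO[of y] unfolding own_def good_def by auto
  have uniq: "y = y'" if "own e y" "own e y'" for e y y'
    using own[OF that(1)] own[OF that(2)] disj[of y y' e] by simp
  have own_y: "own y y" if "y \<in> events M" "Y y" for y
    using that TO[OF that] unfolding own_def good_def by simp
  define b where "b e = ((\<exists>y. own e y), (\<exists>y. own e y \<and> out y e))" for e
  have bd: "fst (b d)" "snd (b d) = out y d" "Y d \<longrightarrow> d = y" if "own d y" "d \<in> events M" for d y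
  proof -
    show "fst (b d)" using that(1) unfolding b_def fst_conv by (rule exI)
    show "snd (b d) = out y d" unfolding b_def snd_conv using that(1) uniq[OF that(1)] by metis
    show "Y d \<longrightarrow> d = y" using own_y[OF that(2)] uniq[OF that(1)] by metis
  qed
  have "(Y e \<longrightarrow> fst (b e)) \<and> (fst (b e) \<longrightarrow> X e \<or> onprd M (\<lambda>d. fst (b d) \<and> snd (b d) \<and> \<not> Y d) e \<or>
        onsnd M (\<lambda>d. fst (b d) \<and> \<not> snd (b d) \<and> \<not> Y d) e)" if e: "e \<in> events M" for e
  proof (intro conjI impI)
    assume "Y e" then show "fst (b e)" using own_y[OF e] unfolding b_def fst_conv by blast
  next
    assume "fst (b e)"
    then obtain y where y: "own e y" unfolding b_def by auto
    then have yy: "y \<in> events M" "Y y" "e \<in> T y" by (auto simp: own_def)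
    have "e = t y \<or> onprd M (\<lambda>d. d \<in> T y \<and> out y d \<and> d \<noteq> y) e \<or> onsnd M (\<lambda>d. d \<in> T y \<and> \<not> out y d \<and> d \<noteq> y) e"
      using TO[OF yy(1,2)] yy(3) unfolding good_def by blast
    then show "X e \<or> onprd M (\<lambda>d. fst (b d) \<and> snd (b d) \<and> \<not> Y d) e \<or>
        onsnd M (\<lambda>d. fst (b d) \<and> \<not> snd (b d) \<and> \<not> Y d) e"
    proof (elim disjE)
      assume "onprd M (\<lambda>d. d \<in> T y \<and> out y d \<and> d \<noteq> y) e"
      then obtain d where d: "(d, e) \<in> proc_rel M" "d \<in> T y" "out y d" "d \<noteq> y" by (auto simp: onprd_def)
      have "own d y" "d \<in> events M" using d yy by (auto simp: own_def proc_rel_iff)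
      then have "fst (b d) \<and> snd (b d) \<and> \<not> Y d" using bd[of d y] d by simp
      then show ?thesis using d(1) unfolding onprd_def by blast
    next
      assume "onsnd M (\<lambda>d. d \<in> T y \<and> \<not> out y d \<and> d \<noteq> y) e"
      then obtain d where d: "(d, e) \<in> msg_rel M" "d \<in> T y" "\<not> out y d" "d \<noteq> y" by (auto simp: onsnd_def)
      have "own d y" "d \<in> events M" using d yy msg_relD(1) by (auto simp: own_def)
      then have "fst (b d) \<and> \<not> snd (b d) \<and> \<not> Y d" using bd[of d y] d by simp
      then show ?thesis using d(1) unfolding onsnd_def by blast
    qed (use t yy in auto)
  qed
  then show ?thesis unfolding link_def by blast
qed

end

section \<open>Computable operators: causal closure, latest events, links\<close>

context alphabets
begin

lemma cpt_recursion:
  fixes t :: "('p, 'a) msc \<Rightarrow> ('p event \<Rightarrow> 'l) \<Rightarrow> 'p event \<Rightarrow> bool"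
  assumes "cpt (\<lambda>M l. G M (\<lambda>e. fst (l e)) (\<lambda>e. snd (l e)))"
    and "\<And>M. is_msc P Sig M \<Longrightarrow> wf (r M) \<and> (\<forall>(d, e)\<in>r M. d \<in> events M)"
    and "\<And>M l b b' e. is_msc P Sig M \<Longrightarrow> e \<in> events M \<Longrightarrow> (\<And>d. (d, e) \<in> r M \<Longrightarrow> b d = b' d) \<Longrightarrow> G M l b e = G M l b' e"
    and "\<And>M l e. is_msc P Sig M \<Longrightarrow> e \<in> events M \<Longrightarrow> t M l e = G M l (t M l) e"
  shows "cpt t"
proof (rule cpt_fix[OF assms(1)])
  fix M l b assume M: "is_msc P Sig M"
  interpret msc_loc P Sig M by (rule msc_locI[OF M])
  show "(\<forall>e\<in>events M. b e = t M l e) = (\<forall>e\<in>events M. b e = G M l b e)"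
    by (rule local_recursion_unique[of "r M"]) (use assms(2)[OF M] assms(3)[OF M] assms(4)[OF M] in blast)+
qed

lemma wf_forward: "is_msc P Sig M \<Longrightarrow> wf (step M) \<and> (\<forall>(d, e)\<in>step M. d \<in> events M)"
  using msc_loc.wf_step[OF msc_locI] msc_loc.step_events[OF msc_locI] by fast

lemma wf_backward: "is_msc P Sig M \<Longrightarrow> wf ((step M)\<inverse>) \<and> (\<forall>(d, e)\<in>(step M)\<inverse>. d \<in> events M)"
  using msc_loc.wf_step_converse[OF msc_locI] msc_loc.step_events[OF msc_locI] by fast

lemma cpt_loc: "(\<And>M M' l l' e e'. fst e = fst e' \<Longrightarrow> letter M e = letter M' e' \<Longrightarrow> l e = l' e' \<Longrightarrow> t M l e = t M' l' e')
   \<Longrightarrow> cpt (t :: _ \<Rightarrow> _ \<Rightarrow> _ \<Rightarrow> bool)"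
  by (rule cpt_localb, rule local_termI)

lemma cpt_up: "cpt t \<Longrightarrow> cpt (\<lambda>M l. up M (t M l))"
proof (rule cpt_comp[of "\<lambda>M l. up M l"])
  show "cpt (\<lambda>M l. up M l)"
  proof (rule cpt_recursion[where r = step and G = "\<lambda>M l b e. l e \<or> onprd M b e \<or> onsnd M b e"])
    show "cpt (\<lambda>M l e. fst (l e) \<or> onprd M (\<lambda>e. snd (l e)) e \<or> onsnd M (\<lambda>e. snd (l e)) e)"
      by (intro cpt_disj cpt_onprd cpt_onsnd cpt_loc) simp_all
  qed (use wf_forward in blast, auto simp: onprd_def onsnd_def step_def msc_loc.up_rec[OF msc_locI, unfolded onprd_def onsnd_def])
qed

lemma cpt_down: "cpt t \<Longrightarrow> cpt (\<lambda>M l. down M (t M l))"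
proof (rule cpt_comp[of "\<lambda>M l. down M l"])
  show "cpt (\<lambda>M l. down M l)"
  proof (rule cpt_recursion[where r = "\<lambda>M. (step M)\<inverse>" and G = "\<lambda>M l b e. l e \<or> onsuc M b e \<or> onrcv M b e"])
    show "cpt (\<lambda>M l e. fst (l e) \<or> onsuc M (\<lambda>e. snd (l e)) e \<or> onrcv M (\<lambda>e. snd (l e)) e)"
      by (intro cpt_disj cpt_onsuc cpt_onrcv cpt_loc) simp_all
  qed (use wf_backward in blast, auto simp: onsuc_def onrcv_def step_def msc_loc.down_rec[OF msc_locI, unfolded onsuc_def onrcv_def])
qed

lemma cpt_lastp: "cpt s \<Longrightarrow> cpt t \<Longrightarrow> cpt (\<lambda>M l x. \<exists>u. lastp M (s M l) x u \<and> t M l u)"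
proof (rule cpt_comp2[of "\<lambda>M s t x. \<exists>u. lastp M s x u \<and> t u"])
  show "cpt (\<lambda>M l x. \<exists>u. lastp M (\<lambda>e. fst (l e)) x u \<and> snd (l u))"
  proof (rule cpt_recursion[where r = step and G = "\<lambda>M l b e. if fst (l e) then snd (l e) else onprd M b e"])
    show "cpt (\<lambda>M l e. if fst (fst (l e)) then snd (fst (l e)) else onprd M (\<lambda>e. snd (l e)) e)"
      by (intro cpt_if cpt_onprd cpt_loc) simp_all
    fix M l and e :: "'p event" assume a: "is_msc P Sig M" "e \<in> events M"
    show "(\<exists>u. lastp M (\<lambda>e. fst (l e)) e u \<and> snd (l u)) = (if fst (l e) then snd (l e)
        else onprd M (\<lambda>x. \<exists>u. lastp M (\<lambda>e. fst (l e)) x u \<and> snd (l u)) e)"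
      unfolding msc_loc.lastp_rec[OF msc_locI[OF a(1)] a(2)] by (auto simp: onprd_def)
  qed (use wf_forward in blast, auto simp: onprd_def step_def)
qed

lemma cpt_nextp: "cpt s \<Longrightarrow> cpt t \<Longrightarrow> cpt (\<lambda>M l x. \<exists>u. nextp M (s M l) x u \<and> t M l u)"
proof (rule cpt_comp2[of "\<lambda>M s t x. \<exists>u. nextp M s x u \<and> t u"])
  show "cpt (\<lambda>M l x. \<exists>u. nextp M (\<lambda>e. fst (l e)) x u \<and> snd (l u))"
  proof (rule cpt_recursion[where r = "\<lambda>M. (step M)\<inverse>" and G = "\<lambda>M l b e. if fst (l e) then snd (l e) else onsuc M b e"])
    show "cpt (\<lambda>M l e. if fst (fst (l e)) then snd (fst (l e)) else onsuc M (\<lambda>e. snd (l e)) e)"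
      by (intro cpt_if cpt_onsuc cpt_loc) simp_all
    fix M l and e :: "'p event" assume a: "is_msc P Sig M" "e \<in> events M"
    show "(\<exists>u. nextp M (\<lambda>e. fst (l e)) e u \<and> snd (l u)) = (if fst (l e) then snd (l e)
        else onsuc M (\<lambda>x. \<exists>u. nextp M (\<lambda>e. fst (l e)) x u \<and> snd (l u)) e)"
      unfolding msc_loc.nextp_rec[OF msc_locI[OF a(1)] a(2)] by (auto simp: onsuc_def)
  qed (use wf_backward in blast, auto simp: onsuc_def step_def)
qed

text \<open>Only the truth value of the test \<open>t\<close> at the traced event travels along the
  message chain, so every list \<open>w\<close> costs finitely many bits.\<close>

lemma cpt_lv: "cpt s \<Longrightarrow> cpt t \<Longrightarrow> cpt (\<lambda>M l x. \<exists>f. lv M (s M l) w x f \<and> t M l f)"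
proof (induction w)
  case Nil
  then show ?case by (simp add: cpt_loc)
next
  case (Cons p w)
  show ?case
  proof (cases w)
    case Nil
    have "cpt (\<lambda>M l x. fst x = p \<and> (\<exists>u. lastp M (s M l) x u \<and> t M l u))"
      by (intro cpt_conj cpt_lastp Cons.prems cpt_loc) simp
    then show ?thesis unfolding Nil lv.simps by (simp add: conj_assoc)
  next
    case (Cons r w')
    have "cpt (\<lambda>M l x. fst x = p \<and> (\<exists>u. lastp M (onsnd M (\<lambda>d. fst d = r)) x u \<and>
       onsnd M (\<lambda>d. fst d = r \<and> (\<exists>f. lv M (s M l) w d f \<and> t M l f)) u))"
      by (intro cpt_conj cpt_lastp cpt_onsnd Cons.IH Cons.prems cpt_loc) simp_all
    moreover have "(\<lambda>M l x. fst x = p \<and> (\<exists>u. lastp M (onsnd M (\<lambda>d. fst d = r)) x u \<and>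
       onsnd M (\<lambda>d. fst d = r \<and> (\<exists>f. lv M (s M l) w d f \<and> t M l f)) u)) =
       (\<lambda>M l x. \<exists>f. lv M (s M l) (p # w) x f \<and> t M l f)"
      unfolding Cons lv.simps onsnd_def by (intro ext) blast
    ultimately show ?thesis by simp
  qed
qed

text \<open>The clause \<open>b e \<in> UNIV\<close> gives the existential in \<open>link\<close>
  the shape of \<open>recog_ex\<close>.\<close>

lemma recog_link: "cpt s \<Longrightarrow> cpt t \<Longrightarrow> recog (\<lambda>M l. link M (s M l) (t M l))"
proof (rule recog_plug2[of link])
  show "recog (\<lambda>M (l :: 'p event \<Rightarrow> bool \<times> bool). link M (\<lambda>e. fst (l e)) (\<lambda>e. snd (l e)))"
    unfolding link_def
    by (intro recog_ex recog_all cpt_conj cpt_imp cpt_disj cpt_onprd cpt_onsnd cpt_not cpt_loc) simp_all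
qed

end

section \<open>Comparable events\<close>

text \<open>Strict variant of \<open>lastp\<close>: the predecessor of \<open>x\<close> within the
  \<open>U\<close>-events of its process, where \<open>x\<close> itself may lie outside
  \<open>U\<close>.\<close>

definition prevp :: "('p, 'a) msc \<Rightarrow> ('p event \<Rightarrow> bool) \<Rightarrow> 'p event \<Rightarrow> 'p event \<Rightarrow> bool" where
  "prevp M U x u \<longleftrightarrow> u \<in> events M \<and> fst u = fst x \<and> snd u < snd x \<and> U u \<and>
     (\<forall>v\<in>events M. fst v = fst x \<longrightarrow> snd v < snd x \<longrightarrow> U v \<longrightarrow> snd v \<le> snd u)"

definition succp :: "('p, 'a) msc \<Rightarrow> ('p event \<Rightarrow> bool) \<Rightarrow> 'p event \<Rightarrow> 'p event \<Rightarrow> bool" where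
  "succp M U x u \<longleftrightarrow> u \<in> events M \<and> fst u = fst x \<and> snd x < snd u \<and> U u \<and>
     (\<forall>v\<in>events M. fst v = fst x \<longrightarrow> snd x < snd v \<longrightarrow> U v \<longrightarrow> snd u \<le> snd v)"

text \<open>
  Certificate that all \<open>N\<close>-events (on one process) are comparable with all \<open>W\<close>-events (on another).
  The \<open>N\<close>-events are grouped into blocks according to the last \<open>W\<close>-event below them; \<open>fst \<circ> b\<close> marks
  the last event of each block and \<open>snd \<circ> b\<close> the \<open>W\<close>-events that precede a block. Tokens travel from
  these to the first event of the block, and from the last event of the block to the next
  \<open>W\<close>-event. The flag \<open>m\<close> says that the first block has no \<open>W\<close>-event below it.
\<close>

definition comparable_cert :: "('p, 'a) msc \<Rightarrow> bool \<Rightarrow> ('p event \<Rightarrow> bool) \<Rightarrow> ('p event \<Rightarrow> bool) \<Rightarrow> bool" where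
  "comparable_cert M m N W \<longleftrightarrow> (\<exists>b. (\<forall>e\<in>events M. b e \<in> UNIV) \<and>
     (\<forall>e\<in>events M. (fst (b e) \<longrightarrow> N e) \<and> (snd (b e) \<longrightarrow> W e)) \<and>
     link M (\<lambda>e. snd (b e))
       (\<lambda>e. N e \<and> ((\<exists>u. prevp M N e u \<and> fst (b u)) \<or> \<not> m \<and> \<not> (\<exists>u. prevp M N e u \<and> True))) \<and>
     link M (\<lambda>e. fst (b e))
       (\<lambda>e. W e \<and> ((\<exists>u. prevp M W e u \<and> snd (b u)) \<or> m \<and> \<not> (\<exists>u. prevp M W e u \<and> True))))"

context msc_loc
begin

lemma event_eqI: "fst x = fst y \<Longrightarrow> snd x = snd y \<Longrightarrow> x = y"
  by (rule prod_eqI)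

lemma prevp_unique: "prevp M U x u \<Longrightarrow> prevp M U x v \<Longrightarrow> u = v"
  unfolding prevp_def by (metis dual_order.antisym prod.collapse)

lemma succp_unique: "succp M U x u \<Longrightarrow> succp M U x v \<Longrightarrow> u = v"
  unfolding succp_def by (metis dual_order.antisym prod.collapse)

lemma prevp_onprd: "x \<in> events M \<Longrightarrow> prevp M U x u \<longleftrightarrow> onprd M (\<lambda>d. lastp M U d u) x"
proof
  assume x: "x \<in> events M" and p: "prevp M U x u"
  let ?d = "(fst x, snd x - 1)"
  have "u \<in> events M" "snd u < snd x" using p by (auto simp: prevp_def)
  then have d: "(?d, x) \<in> proc_rel M" using x by (auto simp: proc_rel_iff event_iff)
  have "lastp M U ?d u" using p unfolding lastp_def prevp_def by auto
  then show "onprd M (\<lambda>d. lastp M U d u) x" using d unfolding onprd_def by blast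
next
  assume "onprd M (\<lambda>d. lastp M U d u) x"
  then obtain d where "(d, x) \<in> proc_rel M" "lastp M U d u" by (auto simp: onprd_def)
  then show "prevp M U x u" unfolding lastp_def prevp_def proc_rel_iff by (auto simp: less_Suc_eq_le)
qed

lemma succp_onsuc: "x \<in> events M \<Longrightarrow> succp M U x u \<longleftrightarrow> onsuc M (\<lambda>d. nextp M U d u) x"
proof
  assume x: "x \<in> events M" and p: "succp M U x u"
  let ?d = "(fst x, Suc (snd x))"
  have "u \<in> events M" "snd x < snd u" "fst u = fst x" using p by (auto simp: succp_def)
  then have d: "(x, ?d) \<in> proc_rel M" using x by (auto simp: proc_rel_iff event_iff)
  have "nextp M U ?d u" using p unfolding nextp_def succp_def by (auto simp: Suc_le_eq)
  then show "onsuc M (\<lambda>d. nextp M U d u) x" using d unfolding onsuc_def by blast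
next
  assume "onsuc M (\<lambda>d. nextp M U d u) x"
  then obtain d where "(x, d) \<in> proc_rel M" "nextp M U d u" by (auto simp: onsuc_def)
  then show "succp M U x u" unfolding nextp_def succp_def proc_rel_iff by (auto simp: Suc_le_eq)
qed

lemma max_event:
  assumes "\<exists>v\<in>events M. Q v"
  obtains u where "u \<in> events M" "Q u" "\<And>v. v \<in> events M \<Longrightarrow> Q v \<Longrightarrow> snd v \<le> snd u"
proof -
  let ?S = "{v \<in> events M. Q v}"
  have f: "finite ?S" "?S \<noteq> {}" using finite_events assms by auto
  then have "Max (snd ` ?S) \<in> snd ` ?S" by simp
  then obtain u where u: "u \<in> ?S" "snd u = Max (snd ` ?S)" by (metis (no_types, lifting) imageE)
  have "snd v \<le> snd u" if "v \<in> ?S" for v using u f that by simp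
  then show ?thesis using that u by blast
qed

lemma min_event:
  assumes "\<exists>v\<in>events M. Q v"
  obtains u where "u \<in> events M" "Q u" "\<And>v. v \<in> events M \<Longrightarrow> Q v \<Longrightarrow> snd u \<le> snd v"
proof -
  let ?S = "{v \<in> events M. Q v}"
  have f: "finite ?S" "?S \<noteq> {}" using finite_events assms by auto
  then have "Min (snd ` ?S) \<in> snd ` ?S" by simp
  then obtain u where u: "u \<in> ?S" "snd u = Min (snd ` ?S)" by (metis (no_types, lifting) imageE)
  have "snd u \<le> snd v" if "v \<in> ?S" for v using u f that by simp
  then show ?thesis using that u by blast
qed

lemma prevp_exists:
  assumes "v \<in> events M" "fst v = fst x" "snd v < snd x" "U v"
  shows "\<exists>u. prevp M U x u"
proof -
  obtain u where "u \<in> events M" "fst u = fst x \<and> snd u < snd x \<and> U u"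
    "\<And>v. v \<in> events M \<Longrightarrow> fst v = fst x \<and> snd v < snd x \<and> U v \<Longrightarrow> snd v \<le> snd u"
    by (rule max_event[of "\<lambda>u. fst u = fst x \<and> snd u < snd x \<and> U u"]) (use assms in blast)+
  then show ?thesis unfolding prevp_def by blast
qed

lemma succp_exists:
  assumes "v \<in> events M" "fst v = fst x" "snd x < snd v" "U v"
  shows "\<exists>u. succp M U x u"
proof -
  obtain u where "u \<in> events M" "fst u = fst x \<and> snd x < snd u \<and> U u"
    "\<And>v. v \<in> events M \<Longrightarrow> fst v = fst x \<and> snd x < snd v \<and> U v \<Longrightarrow> snd u \<le> snd v"
    by (rule min_event[of "\<lambda>u. fst u = fst x \<and> snd x < snd u \<and> U u"]) (use assms in blast)+
  then show ?thesis unfolding succp_def by blast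
qed

lemma succp_prevp:
  assumes "succp M U x y" "x \<in> events M" "U x"
  shows "prevp M U y x"
  unfolding prevp_def
proof (intro conjI ballI impI)
  fix v assume v: "v \<in> events M" "fst v = fst y" "snd v < snd y" "U v"
  show "snd v \<le> snd x"
  proof (rule ccontr)
    assume "\<not> snd v \<le> snd x"
    then have "snd y \<le> snd v" using assms v unfolding succp_def by auto
    then show False using v by simp
  qed
qed (use assms in \<open>auto simp: succp_def\<close>)

text \<open>If the intervals from \<open>t y\<close> to \<open>y\<close> and from
  \<open>t y'\<close> to \<open>y'\<close> meet, then \<open>t y' \<preceq> y\<close> and
  \<open>t y \<preceq> y'\<close>. For targets on one process it is enough to exclude that the
  origin of the later target is below the earlier one.\<close>

lemma link_complete_proc:
  assumes t: "\<And>y. y \<in> events M \<Longrightarrow> Y y \<Longrightarrow> t y \<in> events M \<and> X (t y) \<and> t y \<preceq> y"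
    and r: "\<And>y. y \<in> events M \<Longrightarrow> Y y \<Longrightarrow> fst y = r"
    and less: "\<And>y y'. \<lbrakk>y \<in> events M; Y y; y' \<in> events M; Y y'; snd y < snd y'\<rbrakk> \<Longrightarrow> \<not> t y' \<preceq> y"
  shows "link M X Y"
proof (rule link_complete[OF t])
  fix y y' z assume a: "y \<in> events M" "Y y" "y' \<in> events M" "Y y'" "t y \<preceq> z" "z \<preceq> y" "t y' \<preceq> z" "z \<preceq> y'"
  have "t y' \<preceq> y" "t y \<preceq> y'" using a cle_trans by blast+
  then have "snd y = snd y'" using less[of y y'] less[of y' y] a by (meson linorder_neqE_nat)
  then show "y = y'" using a r event_eqI by metis
qed auto

text \<open>Each \<open>V\<close>-event before \<open>e\<close> has a next \<open>U\<close>-event,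
  at or before \<open>e\<close>, and is recovered from it as its \<open>prevp\<close>.\<close>

lemma count_successors:
  assumes "e \<in> events M" "U e" "\<And>x. x \<in> events M \<Longrightarrow> V x \<Longrightarrow> U x"
  shows "card {x \<in> events M. V x \<and> fst x = fst e \<and> snd x < snd e} \<le>
     card {y \<in> events M. (U y \<and> (\<exists>u. prevp M U y u \<and> V u)) \<and> fst y = fst e \<and> snd y \<le> snd e}"
    (is "card ?X \<le> card ?Y")
proof -
  define g where "g y = (THE u. prevp M U y u)" for y
  have "?X \<subseteq> g ` ?Y"
  proof
    fix x assume x: "x \<in> ?X"
    then obtain y where y: "succp M U x y" using succp_exists[of e x U] assms by auto
    have p: "prevp M U y x" by (rule succp_prevp[OF y]) (use x assms in auto)
    have "g y = x" unfolding g_def using p prevp_unique by blast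
    moreover have "snd y \<le> snd e" using y x assms(1,2) unfolding succp_def by auto
    then have "y \<in> ?Y" using y p x unfolding succp_def by auto
    ultimately show "x \<in> g ` ?Y" by blast
  qed
  moreover have "finite ?Y" using finite_events by simp
  ultimately show ?thesis by (rule surj_card_le[rotated])
qed

text \<open>The first \<open>U\<close>-event has no \<open>prevp\<close> and is counted in addition,
  which makes the inequality strict. The comparability certificate grants this surplus to exactly
  one of the two processes.\<close>

lemma count_successors_first:
  assumes "e \<in> events M" "U e" "\<And>x. x \<in> events M \<Longrightarrow> V x \<Longrightarrow> U x"
  shows "card {x \<in> events M. V x \<and> fst x = fst e \<and> snd x < snd e} <
     card {y \<in> events M. (U y \<and> ((\<exists>u. prevp M U y u \<and> V u) \<or> \<not> (\<exists>u. prevp M U y u))) \<and> fst y = fst e \<and> snd y \<le> snd e}"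
    (is "card ?X < card ?Z")
proof -
  let ?Y = "{y \<in> events M. (U y \<and> (\<exists>u. prevp M U y u \<and> V u)) \<and> fst y = fst e \<and> snd y \<le> snd e}"
  obtain y where y: "y \<in> events M" "fst y = fst e \<and> snd y \<le> snd e \<and> U y"
    "\<And>v. v \<in> events M \<Longrightarrow> fst v = fst e \<and> snd v \<le> snd e \<and> U v \<Longrightarrow> snd y \<le> snd v"
    by (rule min_event[of "\<lambda>y. fst y = fst e \<and> snd y \<le> snd e \<and> U y"]) (use assms in blast)+
  have "\<not> (\<exists>u. prevp M U y u)"
  proof
    assume "\<exists>u. prevp M U y u"
    then obtain u where u: "prevp M U y u" ..
    then have "snd y \<le> snd u" using y unfolding prevp_def by auto
    then show False using u unfolding prevp_def by simp
  qed
  then have "y \<in> ?Z - ?Y" using y by blast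
  then have "?Y \<subset> ?Z" by blast
  then have "card ?Y < card ?Z" using finite_events by (intro psubset_card_mono) simp_all
  then show ?thesis using count_successors[of e U V] assms by simp
qed

text \<open>Suppose \<open>e\<close> and \<open>f\<close> are parallel. A token arriving at or
  before \<open>e\<close> started strictly before \<open>f\<close>, as otherwise
  \<open>f \<preceq> e\<close>; symmetrically for tokens arriving at or before \<open>f\<close>.
  Going once around along blocks and tokens, the number of marked \<open>N\<close>-events before
  \<open>e\<close> is bounded by itself, with a surplus of one on the \<open>N\<close>- or on the
  \<open>W\<close>-side according to \<open>m\<close>: a contradiction.\<close>

lemma comparable_sound:
  assumes c: "comparable_cert M m N W" and pq: "\<And>e. N e \<Longrightarrow> fst e = p" "\<And>f. W f \<Longrightarrow> fst f = q" "p \<noteq> q"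
    and e: "e \<in> events M" "N e" and f: "f \<in> events M" "W f"
  shows "e \<preceq> f \<or> f \<preceq> e"
proof (rule ccontr)
  assume neg: "\<not> (e \<preceq> f \<or> f \<preceq> e)"
  obtain b :: "'p event \<Rightarrow> bool \<times> bool" where b: "\<And>e. e \<in> events M \<Longrightarrow> fst (b e) \<Longrightarrow> N e" "\<And>e. e \<in> events M \<Longrightarrow> snd (b e) \<Longrightarrow> W e"
    and l1: "link M (\<lambda>e. snd (b e))
       (\<lambda>e. N e \<and> ((\<exists>u. prevp M N e u \<and> fst (b u)) \<or> \<not> m \<and> \<not> (\<exists>u. prevp M N e u)))" (is "link M ?A ?Fi")
    and l2: "link M (\<lambda>e. fst (b e))
       (\<lambda>e. W e \<and> ((\<exists>u. prevp M W e u \<and> snd (b u)) \<or> m \<and> \<not> (\<exists>u. prevp M W e u)))" (is "link M ?La ?B")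
    using c unfolding comparable_cert_def simp_thms by blast
  obtain t where t: "inj_on t {y \<in> events M. ?Fi y}"
    "\<And>y. y \<in> events M \<Longrightarrow> ?Fi y \<Longrightarrow> t y \<in> events M \<and> ?A (t y) \<and> t y \<preceq> y"
    using link_sound[OF l1] by blast
  obtain s where s: "inj_on s {y \<in> events M. ?B y}"
    "\<And>y. y \<in> events M \<Longrightarrow> ?B y \<Longrightarrow> s y \<in> events M \<and> ?La (s y) \<and> s y \<preceq> y"
    using link_sound[OF l2] by blast
  let ?LaS = "{x \<in> events M. ?La x \<and> fst x = fst e \<and> snd x < snd e}"
  let ?FiS = "{x \<in> events M. ?Fi x \<and> fst x = fst e \<and> snd x \<le> snd e}"
  let ?AS = "{x \<in> events M. ?A x \<and> fst x = fst f \<and> snd x < snd f}"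
  let ?BS = "{x \<in> events M. ?B x \<and> fst x = fst f \<and> snd x \<le> snd f}"
  have fin: "finite ?LaS" "finite ?FiS" "finite ?AS" "finite ?BS" using finite_events by simp_all
  have 1: "card ?LaS + (if m then 0 else 1) \<le> card ?FiS"
    using count_successors[of e N ?La] count_successors_first[of e N ?La] e b(1) by (cases m) auto
  have 2: "card ?FiS \<le> card ?AS"
  proof (rule card_inj_on_le[of t])
    show "inj_on t ?FiS" by (rule inj_on_subset[OF t(1)]) blast
    show "t ` ?FiS \<subseteq> ?AS"
    proof
      fix x assume "x \<in> t ` ?FiS"
      then obtain y where y: "y \<in> ?FiS" "x = t y" by blast
      then have x: "x \<in> events M" "?A x" "x \<preceq> y" using t(2)[of y] by auto
      have fx: "fst x = fst f" using b(2) x pq(2) f(2) by metis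
      have "y \<preceq> e" using y e same_proc_le by simp
      then have "\<not> f \<preceq> x" using neg x cle_trans by blast
      then have "snd x < snd f" using cle_same_proc[OF f(1) x(1)] fx by simp
      then show "x \<in> ?AS" using x fx by simp
    qed
  qed (rule fin)
  have 3: "card ?AS + (if m then 1 else 0) \<le> card ?BS"
    using count_successors[of f W ?A] count_successors_first[of f W ?A] f b(2) by (cases m) auto
  have 4: "card ?BS \<le> card ?LaS"
  proof (rule card_inj_on_le[of s])
    show "inj_on s ?BS" by (rule inj_on_subset[OF s(1)]) blast
    show "s ` ?BS \<subseteq> ?LaS"
    proof
      fix x assume "x \<in> s ` ?BS"
      then obtain y where y: "y \<in> ?BS" "x = s y" by blast
      then have x: "x \<in> events M" "?La x" "x \<preceq> y" using s(2)[of y] by auto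
      have fx: "fst x = fst e" using b(1) x pq(1) e(2) by metis
      have "y \<preceq> f" using y f same_proc_le by simp
      then have "\<not> e \<preceq> x" using neg x cle_trans by blast
      then have "snd x < snd e" using cle_same_proc[OF e(1) x(1)] fx by simp
      then show "x \<in> ?LaS" using x fx by simp
    qed
  qed (rule fin)
  show False using 1 2 3 4 by (cases m) auto
qed

text \<open>\<open>J e\<close> counts the \<open>W\<close>-events below \<open>e\<close> and numbers
  the blocks, \<open>pos f\<close> is the rank of \<open>f\<close>, and \<open>f \<preceq> e\<close>
  iff \<open>pos f \<le> J e\<close>. The first event of a block with number \<open>j > 0\<close>
  receives its token from the \<open>W\<close>-event of rank \<open>j\<close>. The
  \<open>W\<close>-event of rank \<open>j + 1\<close> receives one from the last event of block
  \<open>j\<close>, if that block is nonempty.\<close>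

lemma comparable_complete:
  assumes pq: "\<And>e. N e \<Longrightarrow> fst e = p" "\<And>f. W f \<Longrightarrow> fst f = q" "p \<noteq> q"
    and cmp: "\<And>e f. e \<in> events M \<Longrightarrow> N e \<Longrightarrow> f \<in> events M \<Longrightarrow> W f \<Longrightarrow> e \<preceq> f \<or> f \<preceq> e"
  shows "\<exists>m. comparable_cert M m N W"
proof -
  define J where "J e = card {f \<in> events M. W f \<and> f \<preceq> e}" for e :: "'p event"
  define pos where "pos f = card {g \<in> events M. W g \<and> snd g \<le> snd f}" for f :: "'p event"
  have fin: "finite {f \<in> events M. Q f}" for Q using finite_events by simp
  have J_iff: "f \<preceq> e \<longleftrightarrow> pos f \<le> J e" if f: "f \<in> events M" "W f" and e: "e \<in> events M" for e f
  proof
    assume fe: "f \<preceq> e"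
    have "g \<preceq> e" if "g \<in> events M" "W g" "snd g \<le> snd f" for g
      using same_proc_le[of g f] that f pq(2) fe cle_trans by metis
    then have "{g \<in> events M. W g \<and> snd g \<le> snd f} \<subseteq> {f \<in> events M. W f \<and> f \<preceq> e}" by blast
    then show "pos f \<le> J e" unfolding J_def pos_def by (rule card_mono[OF fin])
  next
    assume le: "pos f \<le> J e"
    show "f \<preceq> e"
    proof (rule ccontr)
      assume n: "\<not> f \<preceq> e"
      have "{f \<in> events M. W f \<and> f \<preceq> e} \<subset> {g \<in> events M. W g \<and> snd g \<le> snd f}"
      proof
        show "{f \<in> events M. W f \<and> f \<preceq> e} \<subseteq> {g \<in> events M. W g \<and> snd g \<le> snd f}"
        proof
          fix g assume g: "g \<in> {f \<in> events M. W f \<and> f \<preceq> e}"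
          then have "\<not> f \<preceq> g" using n cle_trans by blast
          then show "g \<in> {g \<in> events M. W g \<and> snd g \<le> snd f}"
            using g f pq(2) same_proc_le[of f g] by (metis (mono_tags, lifting) linorder_le_cases mem_Collect_eq)
        qed
        show "{f \<in> events M. W f \<and> f \<preceq> e} \<noteq> {g \<in> events M. W g \<and> snd g \<le> snd f}" using n f by blast
      qed
      then have "J e < pos f" unfolding J_def pos_def by (rule psubset_card_mono[OF fin])
      then show False using le by simp
    qed
  qed
  have J_mono: "J e \<le> J e'" if "e \<preceq> e'" for e e'
    unfolding J_def by (rule card_mono[OF fin]) (use that cle_trans in blast)
  have pos_less: "pos f < pos g" if "f \<in> events M" "W f" "g \<in> events M" "W g" "snd f < snd g" for f g
    unfolding pos_def
  proof (rule psubset_card_mono[OF fin])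
    have "g \<in> {g' \<in> events M. W g' \<and> snd g' \<le> snd g} - {g \<in> events M. W g \<and> snd g \<le> snd f}" using that by simp
    then show "{g \<in> events M. W g \<and> snd g \<le> snd f} \<subset> {g' \<in> events M. W g' \<and> snd g' \<le> snd g}" using that by fastforce
  qed
  have pos_prev: "pos f = Suc (pos a)" if "prevp M W f a" "f \<in> events M" "W f" for f a
  proof -
    have a: "a \<in> events M" "snd a < snd f" "W a" using that(1) by (auto simp: prevp_def)
    have le: "snd g \<le> snd a" if "g \<in> events M" "W g" "snd g < snd f" for g
      using \<open>prevp M W f a\<close> that pq(2) \<open>W f\<close> unfolding prevp_def by metis
    have "{g \<in> events M. W g \<and> snd g \<le> snd f} = insert f {g \<in> events M. W g \<and> snd g \<le> snd a}"
    proof (intro set_eqI iffI)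
      fix g assume g: "g \<in> {g \<in> events M. W g \<and> snd g \<le> snd f}"
      show "g \<in> insert f {g \<in> events M. W g \<and> snd g \<le> snd a}"
      proof (cases "snd g = snd f")
        case True
        then have "g = f" using g pq(2)[of g] pq(2)[of f] \<open>W f\<close> event_eqI[of g f] by simp
        then show ?thesis by simp
      qed (use g le[of g] in simp)
    qed (use a that(2,3) in auto)
    moreover have "f \<notin> {g \<in> events M. W g \<and> snd g \<le> snd a}" using that(1) unfolding prevp_def by auto
    ultimately show ?thesis unfolding pos_def using fin by simp
  qed
  have pos_first: "pos f = 1" if "\<not> (\<exists>a. prevp M W f a)" "f \<in> events M" "W f" for f
  proof -
    have "\<not> snd g < snd f" if "g \<in> events M" "W g" for g
      using prevp_exists[of g f W] that \<open>\<not> (\<exists>a. prevp M W f a)\<close> pq(2) \<open>W f\<close> by metis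
    then have "g = f" if "g \<in> events M" "W g" "snd g \<le> snd f" for g
      using that pq(2) \<open>W f\<close> event_eqI[of g f] by (metis le_neq_implies_less)
    then have "{g \<in> events M. W g \<and> snd g \<le> snd f} = {f}"
      using that(2,3) by auto
    then show ?thesis unfolding pos_def by simp
  qed
  have hit: "\<exists>f\<in>events M. W f \<and> pos f = J e" if "e \<in> events M" "J e \<noteq> 0" for e
  proof -
    have "{f \<in> events M. W f \<and> f \<preceq> e} \<noteq> {}" using that(2) unfolding J_def by (metis card.empty)
    then obtain f where f: "f \<in> events M" "W f \<and> f \<preceq> e" "\<And>v. v \<in> events M \<Longrightarrow> W v \<and> v \<preceq> e \<Longrightarrow> snd v \<le> snd f"
      using max_event[of "\<lambda>f. W f \<and> f \<preceq> e"] by blast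
    have "{g \<in> events M. W g \<and> g \<preceq> e} \<subseteq> {g \<in> events M. W g \<and> snd g \<le> snd f}" using f by blast
    then have "J e \<le> pos f" unfolding J_def pos_def by (rule card_mono[OF fin])
    moreover have "pos f \<le> J e" using J_iff[of f e] f that by blast
    ultimately show ?thesis using f by fastforce
  qed
  \<comment> \<open>If some \<open>N\<close>-event has no \<open>W\<close>-event below it, block
    \<open>0\<close> is nonempty and its last event can send a token to the first
    \<open>W\<close>-event; otherwise the first \<open>N\<close>-event receives one.\<close>
  define m where "m = (\<exists>e\<in>events M. N e \<and> J e = 0)"
  define La where "La e \<longleftrightarrow> N e \<and> (\<forall>e'\<in>events M. N e' \<longrightarrow> snd e < snd e' \<longrightarrow> J e' \<noteq> J e)" for e
  define A where "A f \<longleftrightarrow> W f \<and> (\<exists>e\<in>events M. N e \<and> J e = pos f)" for f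
  let ?Fi = "\<lambda>e. N e \<and> ((\<exists>u. prevp M N e u \<and> La u) \<or> \<not> m \<and> \<not> (\<exists>u. prevp M N e u))"
  let ?B = "\<lambda>e. W e \<and> ((\<exists>u. prevp M W e u \<and> A u) \<or> m \<and> \<not> (\<exists>u. prevp M W e u))"
  have JN: "J e \<le> J e'" if "e \<in> events M" "N e" "e' \<in> events M" "N e'" "snd e \<le> snd e'" for e e'
    by (rule J_mono) (use that pq(1) same_proc_le in metis)
  have Fi: "J e \<noteq> 0 \<and> (\<forall>e'\<in>events M. N e' \<longrightarrow> snd e' < snd e \<longrightarrow> J e' < J e)" if e: "e \<in> events M" "?Fi e" for e
  proof -
    consider u where "prevp M N e u" "La u" | "\<not> m" "\<not> (\<exists>u. prevp M N e u)" using e by blast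
    then show ?thesis
    proof cases
      case 1
      have u: "u \<in> events M" "N u" "snd u < snd e" using 1 by (auto simp: prevp_def)
      have "J u \<noteq> J e" using 1(2) e u unfolding La_def by metis
      then have lt: "J u < J e" using JN[of u e] u e by simp
      have "J e' < J e" if "e' \<in> events M" "N e'" "snd e' < snd e" for e'
      proof -
        have "snd e' \<le> snd u" using 1(1) that pq(1) e unfolding prevp_def by metis
        then show ?thesis using JN[of e' u] that u lt by simp
      qed
      then show ?thesis using lt by auto
    next
      case 2
      have "\<not> snd e' < snd e" if "e' \<in> events M" "N e'" for e'
      proof
        assume lt: "snd e' < snd e"
        have eq: "fst e' = fst e"
          using pq(1)[OF that(2)] pq(1)[OF e(2)[THEN conjunct1]] by (rule trans[OF _ sym])
        have ex: "\<exists>u. prevp M N e u" by (rule prevp_exists[where U = N, OF that(1) eq lt that(2)])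
        have "False" using 2(2) ex by (rule notE)
        then show False .
      qed
      note first = this
      have Ne: "N e" using e(2) by (rule conjunct1)
      have "J e \<noteq> 0" using 2(1) e(1) Ne unfolding m_def by simp
      then show ?thesis using first by simp
    qed
  qed
  have "link M A ?Fi"
  proof -
    have "\<exists>f. e \<in> events M \<longrightarrow> ?Fi e \<longrightarrow> f \<in> events M \<and> W f \<and> pos f = J e" for e
    proof (cases "e \<in> events M \<and> ?Fi e")
      case True
      then have "J e \<noteq> 0" using Fi[of e] by (elim conjE) blast
      then show ?thesis using hit[of e] True by blast
    qed blast
    then obtain t where t: "\<And>e. e \<in> events M \<Longrightarrow> ?Fi e \<Longrightarrow> t e \<in> events M \<and> W (t e) \<and> pos (t e) = J e" by metis
    show ?thesis
    proof (rule link_complete_proc[of _ t _ p])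
      fix y assume y: "y \<in> events M" "?Fi y"
      then show "t y \<in> events M \<and> A (t y) \<and> t y \<preceq> y" using t[OF y] J_iff[of "t y" y] unfolding A_def by auto
    next
      fix y y' assume y: "y \<in> events M" "?Fi y" "y' \<in> events M" "?Fi y'" "snd y < snd y'"
      show "\<not> t y' \<preceq> y" using Fi[OF y(3,4)] y t[OF y(3,4)] J_iff[of "t y'" y] by auto
    qed (use pq in blast)
  qed
  moreover have "link M La ?B"
  proof -
    have B: "\<exists>e\<in>events M. N e \<and> Suc (J e) = pos f" if f: "f \<in> events M" "?B f" for f
    proof -
      consider u where "prevp M W f u" "A u" | "m" "\<not> (\<exists>u. prevp M W f u)" using f by blast
      then show ?thesis
      proof cases
        case 1 then show ?thesis using pos_prev[of f u] f unfolding A_def by auto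
      next
        case 2 then show ?thesis using pos_first[of f] f unfolding m_def by auto
      qed
    qed
    have "\<exists>e. f \<in> events M \<longrightarrow> ?B f \<longrightarrow> e \<in> events M \<and> La e \<and> Suc (J e) = pos f" for f
    proof (cases "f \<in> events M \<and> ?B f")
      case True
      then obtain e where e: "e \<in> events M" "N e \<and> Suc (J e) = pos f"
        "\<And>v. v \<in> events M \<Longrightarrow> N v \<and> Suc (J v) = pos f \<Longrightarrow> snd v \<le> snd e"
        using max_event[of "\<lambda>e. N e \<and> Suc (J e) = pos f"] B by blast
      then have "La e" unfolding La_def by (metis leD)
      then show ?thesis using e by blast
    qed blast
    then obtain t where t: "\<And>f. f \<in> events M \<Longrightarrow> ?B f \<Longrightarrow> t f \<in> events M \<and> La (t f) \<and> Suc (J (t f)) = pos f" by metis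
    show ?thesis
    proof (rule link_complete_proc[of _ t _ q])
      fix y assume y: "y \<in> events M" "?B y"
      have ty: "t y \<in> events M" "La (t y)" "Suc (J (t y)) = pos y" using t[OF y] by auto
      \<comment> \<open>The rank of \<open>y\<close> exceeds \<open>J (t y)\<close>, so
        \<open>y\<close> is not below \<open>t y\<close>; the comparability hypothesis leaves
        \<open>t y \<preceq> y\<close>.\<close>
      have "\<not> y \<preceq> t y" using J_iff[of y "t y"] y ty by simp
      then have "t y \<preceq> y" using cmp[of "t y" y] y ty unfolding La_def by blast
      then show "t y \<in> events M \<and> La (t y) \<and> t y \<preceq> y" using ty by simp
    next
      fix y y' assume y: "y \<in> events M" "?B y" "y' \<in> events M" "?B y'" "snd y < snd y'"
      have ty: "t y' \<in> events M" "La (t y')" "Suc (J (t y')) = pos y'" using t[OF y(3,4)] by auto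
      have "pos y < pos y'" using pos_less[of y y'] y by blast
      then have "y \<preceq> t y'" using J_iff[of y "t y'"] y ty by simp
      then show "\<not> t y' \<preceq> y" using cle_antisym[of y "t y'"] pq ty y unfolding La_def by metis
    qed (use pq in blast)
  qed
  moreover have "La e \<longrightarrow> N e" "A e \<longrightarrow> W e" for e unfolding La_def A_def by auto
  ultimately have "comparable_cert M m N W"
    unfolding comparable_cert_def by (intro exI[of _ "\<lambda>e. (La e, A e)"]) simp
  then show ?thesis ..
qed

end

section \<open>Recognisability of comparability\<close>

context alphabets
begin

lemma cpt_cong:
  fixes t :: "('p, 'a) msc \<Rightarrow> ('p event \<Rightarrow> 'l) \<Rightarrow> 'p event \<Rightarrow> bool"
  assumes "cpt t" "\<And>M l e. is_msc P Sig M \<Longrightarrow> e \<in> events M \<Longrightarrow> t M l e = t' M l e"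
  shows "cpt t'"
proof (rule cpt_boolI, rule recog_cong)
  show "recog (\<lambda>M l. \<forall>e\<in>events M. snd (l e) = t M (\<lambda>e. fst (l e)) e)"
    using assms(1) by (rule cptE)
qed (use assms(2) in auto)

lemma cpt_prevp: "cpt s \<Longrightarrow> cpt t \<Longrightarrow> cpt (\<lambda>M l x. \<exists>u. prevp M (s M l) x u \<and> t M l u)"
proof -
  assume a: "cpt s" "cpt t"
  show ?thesis
    by (rule cpt_cong[OF cpt_onprd[OF cpt_lastp[OF a]]])
      (auto simp: msc_loc.prevp_onprd[OF msc_locI] onprd_def)
qed

lemma cpt_succp: "cpt s \<Longrightarrow> cpt t \<Longrightarrow> cpt (\<lambda>M l x. \<exists>u. succp M (s M l) x u \<and> t M l u)"
proof -
  assume a: "cpt s" "cpt t"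
  show ?thesis
    by (rule cpt_cong[OF cpt_onsuc[OF cpt_nextp[OF a]]])
      (auto simp: msc_loc.succp_onsuc[OF msc_locI] onsuc_def)
qed

lemma recog_comparable_cert: "cpt s \<Longrightarrow> cpt t \<Longrightarrow> recog (\<lambda>M l. comparable_cert M m (s M l) (t M l))"
proof (rule recog_plug2[of "\<lambda>M. comparable_cert M m"])
  show "recog (\<lambda>M (l :: 'p event \<Rightarrow> bool \<times> bool). comparable_cert M m (\<lambda>e. fst (l e)) (\<lambda>e. snd (l e)))"
    unfolding comparable_cert_def
    by (intro recog_ex recog_conj recog_all recog_link cpt_conj cpt_imp cpt_disj cpt_prevp cpt_not cpt_loc) simp_all
qed

lemma recog_comparable:
  assumes "cpt s" "cpt t" "p \<noteq> q"
  shows "recog (\<lambda>M l. \<forall>e\<in>events M. \<forall>f\<in>events M. s M l e \<longrightarrow> fst e = p \<longrightarrow> t M l f \<longrightarrow> fst f = q \<longrightarrow>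
     (e, f) \<in> causal_le M \<or> (f, e) \<in> causal_le M)"
proof -
  let ?N = "\<lambda>M l e. s M l e \<and> fst e = p" and ?W = "\<lambda>M l f. t M l f \<and> fst f = q"
  have "recog (\<lambda>M l. comparable_cert M False (?N M l) (?W M l) \<or> comparable_cert M True (?N M l) (?W M l))"
    by (intro recog_disj recog_comparable_cert cpt_conj assms(1,2) cpt_loc) simp_all
  then show ?thesis
  proof (rule recog_cong)
    fix M l assume "is_msc P Sig M"
    then interpret msc_loc P Sig M by (rule msc_locI)
    show "(comparable_cert M False (?N M l) (?W M l) \<or> comparable_cert M True (?N M l) (?W M l)) =
      (\<forall>e\<in>events M. \<forall>f\<in>events M. s M l e \<longrightarrow> fst e = p \<longrightarrow> t M l f \<longrightarrow> fst f = q \<longrightarrow>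
        (e, f) \<in> causal_le M \<or> (f, e) \<in> causal_le M)" (is "?L = ?R")
    proof
      assume ?L
      then obtain m where m: "comparable_cert M m (?N M l) (?W M l)" by blast
      show ?R using comparable_sound[OF m, of p q] assms(3) by blast
    next
      assume r: ?R
      have "\<exists>m. comparable_cert M m (?N M l) (?W M l)"
        by (rule comparable_complete[of _ p _ q]) (use r assms(3) in auto)
      then show ?L by (metis (full_types))
    qed
  qed
qed

end

section \<open>Parallel events\<close>

text \<open>Runs are maximal blocks of successive \<open>Y\<close>-events of one colour. The
  comparison of two colours is spelled out over \<open>{..D}\<close> because
  \<open>cpt_prevp\<close> tests the earlier event only for a property that does not depend on the
  later one.\<close>

definition run_first :: "('p, 'a) msc \<Rightarrow> nat \<Rightarrow> ('p event \<Rightarrow> bool) \<Rightarrow> ('p event \<Rightarrow> nat) \<Rightarrow> 'p event \<Rightarrow> bool" where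
  "run_first M D Y col e \<longleftrightarrow> Y e \<and> \<not> (\<exists>c\<in>{..D}. col e = c \<and> (\<exists>u. prevp M Y e u \<and> col u = c))"

definition run_last :: "('p, 'a) msc \<Rightarrow> nat \<Rightarrow> ('p event \<Rightarrow> bool) \<Rightarrow> ('p event \<Rightarrow> nat) \<Rightarrow> 'p event \<Rightarrow> bool" where
  "run_last M D Y col e \<longleftrightarrow> Y e \<and> \<not> (\<exists>c\<in>{..D}. col e = c \<and> (\<exists>u. succp M Y e u \<and> col u = c))"

text \<open>
  Certificate that every \<open>Y\<close>-event is parallel to some \<open>W\<close>-event. The \<open>i\<close>-th run of \<open>Y\<close>-events, from
  \<open>e\<^sub>i\<close> to \<open>l\<^sub>i\<close>, has the \<open>i\<close>-th \<open>F\<close>-event \<open>f\<^sub>i\<close> as its common witness. Tokens certify \<open>f\<^sub>i < e\<^sub>i\<^sub>+\<^sub>1\<close> and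
  \<open>e\<^sub>i < f\<^sub>i\<^sub>+\<^sub>1\<close>; the former carry the colours of two consecutive runs, which makes the colours of \<open>e\<^sub>i\<close>
  and \<open>f\<^sub>i\<close> agree. Then \<open>f\<^sub>i < l\<^sub>i\<close> and \<open>e\<^sub>i < f\<^sub>i\<close> are excluded by comparing colours with the latest
  information that reaches \<open>l\<^sub>i\<close> and \<open>f\<^sub>i\<close> along each sequence \<open>w\<close> of processes.
\<close>

definition parallel_cond :: "('p, 'a) msc \<Rightarrow> 'p list set \<Rightarrow> nat \<Rightarrow> ('p event \<Rightarrow> bool) \<Rightarrow> ('p event \<Rightarrow> bool) \<Rightarrow>
    ('p event \<Rightarrow> bool) \<Rightarrow> ('p event \<Rightarrow> nat) \<Rightarrow> bool" where
  "parallel_cond M Ws D Y W F col \<longleftrightarrow>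
     (\<forall>e\<in>events M. F e \<longrightarrow> W e) \<and>
     ((\<exists>e\<in>events M. F e) \<or> (\<forall>e\<in>events M. \<not> Y e)) \<and>
     (\<forall>e\<in>events M. F e \<longrightarrow> \<not> (\<exists>u. prevp M F e u \<and> True) \<longrightarrow> col e = 0) \<and>
     (\<forall>e\<in>events M. Y e \<longrightarrow> \<not> (\<exists>u. prevp M Y e u \<and> True) \<longrightarrow> col e = 0) \<and>
     (\<forall>c\<in>{..D}. \<forall>e\<in>events M. F e \<longrightarrow> col e = c \<longrightarrow> \<not> (\<exists>u. prevp M F e u \<and> col u = c)) \<and>
     (\<forall>c\<in>{..D}. \<forall>d\<in>{..D} - {c}. link M (\<lambda>e. F e \<and> col e = c \<and> (\<exists>u. succp M F e u \<and> col u = d))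
        (\<lambda>e. Y e \<and> col e = d \<and> (\<exists>u. prevp M Y e u \<and> col u = c))) \<and>
     link M (run_first M D Y col) (\<lambda>e. F e \<and> (\<exists>u. prevp M F e u \<and> True)) \<and>
     (\<forall>w\<in>Ws. \<forall>c\<in>{..D}. \<forall>e\<in>events M. run_last M D Y col e \<longrightarrow> col e = c \<longrightarrow>
        \<not> (\<exists>f. lv M F w e f \<and> (col f = c \<or> (\<exists>u. prevp M F f u \<and> col u = c)))) \<and>
     (\<forall>w\<in>Ws. \<forall>c\<in>{..D}. \<forall>e\<in>events M. F e \<longrightarrow> col e = c \<longrightarrow>
        \<not> (\<exists>f. lv M (run_first M D Y col) w e f \<and> col f = c))"

definition parallel_cert :: "('p, 'a) msc \<Rightarrow> 'p list set \<Rightarrow> nat \<Rightarrow> ('p event \<Rightarrow> bool) \<Rightarrow> ('p event \<Rightarrow> bool) \<Rightarrow> bool" where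
  "parallel_cert M Ws D Y W \<longleftrightarrow> (\<exists>b. (\<forall>e\<in>events M. b e \<in> UNIV \<times> {..D}) \<and>
     parallel_cond M Ws D Y W (\<lambda>e. fst (b e)) (\<lambda>e. snd (b e)))"

definition enumerates :: "('p, 'a) msc \<Rightarrow> ('p event \<Rightarrow> bool) \<Rightarrow> 'p \<Rightarrow> nat \<Rightarrow> (nat \<Rightarrow> 'p event) \<Rightarrow> bool" where
  "enumerates M S r K e \<longleftrightarrow>
    (\<forall>i. 1 \<le> i \<longrightarrow> i \<le> K \<longrightarrow> e i \<in> events M \<and> S (e i) \<and> fst (e i) = r) \<and>
    (\<forall>i j. 1 \<le> i \<longrightarrow> i < j \<longrightarrow> j \<le> K \<longrightarrow> snd (e i) < snd (e j)) \<and>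
    (\<forall>x. x \<in> events M \<longrightarrow> S x \<longrightarrow> (\<exists>i. 1 \<le> i \<and> i \<le> K \<and> x = e i))"

lemma enumeratesD:
  assumes "enumerates M S r K e"
  shows "\<And>i. 1 \<le> i \<Longrightarrow> i \<le> K \<Longrightarrow> e i \<in> events M \<and> S (e i) \<and> fst (e i) = r"
    "\<And>i j. 1 \<le> i \<Longrightarrow> i < j \<Longrightarrow> j \<le> K \<Longrightarrow> snd (e i) < snd (e j)"
    "\<And>x. x \<in> events M \<Longrightarrow> S x \<Longrightarrow> \<exists>i. 1 \<le> i \<and> i \<le> K \<and> x = e i"
  using assms unfolding enumerates_def by blast+

text \<open>Pigeonhole: the \<open>j - 1\<close> targets \<open>2..j\<close> cannot have distinct
  origins that are all at most \<open>j - 2\<close>. This is what anonymous tokens give;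
  monotonicity along the two processes turns it into an inequality from index \<open>j - 1\<close>
  to index \<open>j\<close>.\<close>

lemma injective_reaches:
  fixes s :: "nat \<Rightarrow> nat"
  assumes inj: "inj_on s {2..j}" and pos: "\<And>k. 2 \<le> k \<Longrightarrow> k \<le> j \<Longrightarrow> 1 \<le> s k" and j: "2 \<le> j"
  shows "\<exists>k. 2 \<le> k \<and> k \<le> j \<and> j - 1 \<le> s k"
proof (rule ccontr)
  assume neg: "\<not> ?thesis"
  have "s ` {2..j} \<subseteq> {1..j - 2}"
  proof
    fix x assume "x \<in> s ` {2..j}"
    then obtain k where k: "2 \<le> k" "k \<le> j" "x = s k" by auto
    then have "\<not> j - 1 \<le> x" using neg by blast
    then show "x \<in> {1..j - 2}" using k pos[of k] by auto
  qed
  then have "card {2..j} \<le> card {1..j - 2}" by (rule card_inj_on_le[OF inj]) simp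
  then show False using j by simp
qed

context msc_loc
begin

lemma enumerate_proc:
  assumes "\<forall>x\<in>events M. S x \<longrightarrow> fst x = r"
  shows "\<exists>K e. enumerates M S r K e"
proof -
  have r: "\<And>x. x \<in> events M \<Longrightarrow> S x \<Longrightarrow> fst x = r" using assms by blast
  define A where "A = snd ` {x \<in> events M. S x}"
  define xs where "xs = sorted_list_of_set A"
  have A: "finite A" unfolding A_def using finite_events by simp
  have set: "set xs = A" and srt: "sorted_wrt (<) xs" unfolding xs_def using A by simp_all
  have bk: "(r, a) \<in> events M \<and> S (r, a)" if a: "a \<in> A" for a
  proof -
    obtain x where x: "x \<in> events M" "S x" "a = snd x" using a unfolding A_def by blast
    then have "x = (r, a)" using r[OF x(1,2)] by (simp add: prod_eq_iff)
    then show ?thesis using x by simp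
  qed
  show ?thesis
    unfolding enumerates_def
  proof (rule exI[of _ "length xs"], rule exI[of _ "\<lambda>i. (r, xs ! (i - 1))"], rule conjI[OF _ conjI];
      intro allI impI)
    fix i assume "1 \<le> i" "i \<le> length xs"
    then have "xs ! (i - 1) \<in> A" using set by (metis Suc_le_eq diff_Suc_1 less_imp_diff_less nth_mem One_nat_def Suc_pred diff_less le_trans zero_less_one less_le_trans not_less)
    then show "(r, xs ! (i - 1)) \<in> events M \<and> S (r, xs ! (i - 1)) \<and> fst (r, xs ! (i - 1)) = r" using bk by simp
  next
    fix i j :: nat assume "1 \<le> i" "i < j" "j \<le> length xs"
    then show "snd (r, xs ! (i - 1)) < snd (r, xs ! (j - 1))"
      using sorted_wrt_nth_less[OF srt, of "i - 1" "j - 1"] by simp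
  next
    fix x assume x: "x \<in> events M" "S x"
    then have "snd x \<in> set xs" unfolding set A_def by blast
    then obtain i where "i < length xs" "xs ! i = snd x" by (auto simp: in_set_conv_nth)
    then show "\<exists>i. 1 \<le> i \<and> i \<le> length xs \<and> x = (r, xs ! (i - 1))"
      using r[OF x] by (intro exI[of _ "Suc i"]) (simp add: prod_eq_iff)
  qed
qed

lemma prev_in_run:
  assumes "Y y" "\<not> run_first M D Y col y" "col y \<le> D"
  obtains u where "prevp M Y y u" "col u = col y"
  using assms unfolding run_first_def by auto

text \<open>Induction backwards along the \<open>Y\<close>-events: within a run the colour does not
  change.\<close>

lemma run_first_of:
  assumes "y \<in> events M" "Y y" "\<And>e. e \<in> events M \<Longrightarrow> col e \<le> D"
  shows "\<exists>x. lastp M (run_first M D Y col) y x \<and> col x = col y"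
  using assms(1,2)
proof (induction "snd y" arbitrary: y rule: less_induct)
  case less
  show ?case
  proof (cases "run_first M D Y col y")
    case True
    then have "lastp M (run_first M D Y col) y y" using less.prems unfolding lastp_def by simp
    then show ?thesis by blast
  next
    case False
    obtain u where u: "prevp M Y y u" "col u = col y"
      using prev_in_run[OF less.prems(2) False assms(3)[OF less.prems(1)]] by blast
    have ue: "u \<in> events M" "snd u < snd y" "Y u" "fst u = fst y" using u(1) unfolding prevp_def by auto
    obtain x where x: "lastp M (run_first M D Y col) u x" "col x = col u"
      using less.hyps[OF ue(2,1,3)] by blast
    have "lastp M (run_first M D Y col) y x"
      unfolding lastp_def
    proof (intro conjI ballI impI)
      fix v assume v: "v \<in> events M" "fst v = fst y" "snd v \<le> snd y" "run_first M D Y col v"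
      have "snd v \<noteq> snd y" using v False event_eqI[of v y] by metis
      then have "snd v < snd y" using v by simp
      then have "snd v \<le> snd u" using u(1) v unfolding prevp_def run_first_def by simp
      then show "snd v \<le> snd x" using x(1) v ue unfolding lastp_def by simp
    qed (use x(1) ue in \<open>auto simp: lastp_def\<close>)
    then show ?thesis using x u by auto
  qed
qed

text \<open>Leads from \<open>y\<close> to the end of its run, where the certificate performs its
  check; the run is identified by its first event \<open>x\<close>.\<close>

lemma run_last_of:
  assumes "y \<in> events M" "Y y" "\<And>e. e \<in> events M \<Longrightarrow> col e \<le> D" "lastp M (run_first M D Y col) y x"
  shows "\<exists>z\<in>events M. run_last M D Y col z \<and> y \<preceq> z \<and> lastp M (run_first M D Y col) z x"
proof -
  obtain z where z: "z \<in> events M" "Y z \<and> y \<preceq> z \<and> lastp M (run_first M D Y col) z x"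
    "\<And>v. v \<in> events M \<Longrightarrow> Y v \<and> y \<preceq> v \<and> lastp M (run_first M D Y col) v x \<Longrightarrow> snd v \<le> snd z"
    by (rule max_event[of "\<lambda>z. Y z \<and> y \<preceq> z \<and> lastp M (run_first M D Y col) z x"]) (use assms in auto)
  have "run_last M D Y col z"
  proof (rule ccontr)
    assume "\<not> run_last M D Y col z"
    then obtain u where u: "succp M Y z u" "col u = col z" unfolding run_last_def using z(2) by blast
    have ue: "u \<in> events M" "snd z < snd u" "Y u" "fst u = fst z" using u(1) unfolding succp_def by auto
    have p: "prevp M Y u z" using succp_prevp[OF u(1) z(1)] z(2) by blast
    have nf: "\<not> run_first M D Y col u" unfolding run_first_def using p u(2) assms(3)[OF ue(1)] by auto
    have "lastp M (run_first M D Y col) u x"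
      unfolding lastp_def
    proof (intro conjI ballI impI)
      fix v assume v: "v \<in> events M" "fst v = fst u" "snd v \<le> snd u" "run_first M D Y col v"
      have "snd v \<noteq> snd u" using v nf event_eqI[of v u] by metis
      then have "snd v < snd u" using v by simp
      then have "snd v \<le> snd z" using p v unfolding prevp_def run_first_def by simp
      then show "snd v \<le> snd x" using z(2) v ue unfolding lastp_def by simp
    qed (use z(2) ue in \<open>auto simp: lastp_def\<close>)
    moreover have "z \<preceq> u" using same_proc_le[OF z(1) ue(1)] ue by simp
    then have "y \<preceq> u" using z(2) cle_trans by blast
    ultimately have "snd u \<le> snd z" using z(3)[OF ue(1)] ue(3) by blast
    then show False using ue by simp
  qed
  then show ?thesis using z by blast
qed

text \<open>Counting yields the causal inequalities for all indices at once (\<open>tok1\<close>,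
  \<open>tok2\<close>). Agreement of colours needs an induction on the number \<open>i\<close> of
  the run: the token arriving at \<open>e i\<close> is shown to start exactly at
  \<open>f (i - 1)\<close>, and then its second colour is that of \<open>f i\<close>. Once the
  colours agree, a causal path between \<open>f i\<close> and run \<open>i\<close> would be noticed
  along one of the sequences in \<open>Ws\<close>.\<close>

lemma parallel_sound:
  assumes pq: "\<And>e. Y e \<Longrightarrow> fst e = p" "\<And>f. W f \<Longrightarrow> fst f = q" "p \<noteq> q"
    and cols: "\<And>e. e \<in> events M \<Longrightarrow> col e \<le> D"
    and Ws: "\<And>w. distinct w \<Longrightarrow> set w \<subseteq> P \<Longrightarrow> w \<in> Ws"
    and cond: "parallel_cond M Ws D Y W F col"
    and y: "y \<in> events M" "Y y"
  shows "\<exists>f\<in>events M. W f \<and> \<not> y \<preceq> f \<and> \<not> f \<preceq> y"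
proof -
  let ?E = "run_first M D Y col"
  have FW: "\<And>e. e \<in> events M \<Longrightarrow> F e \<Longrightarrow> W e"
    and Fne: "\<exists>e\<in>events M. F e"
    and F0: "\<And>e. e \<in> events M \<Longrightarrow> F e \<Longrightarrow> \<not> (\<exists>u. prevp M F e u) \<Longrightarrow> col e = 0"
    and Y0: "\<And>e. e \<in> events M \<Longrightarrow> Y e \<Longrightarrow> \<not> (\<exists>u. prevp M Y e u) \<Longrightarrow> col e = 0"
    using cond y unfolding parallel_cond_def simp_thms by auto
  have Fdiff: "col e \<noteq> col u" if "e \<in> events M" "F e" "prevp M F e u" for e u
  proof -
    have a: "\<forall>c\<in>{..D}. \<forall>e\<in>events M. F e \<longrightarrow> col e = c \<longrightarrow> \<not> (\<exists>u. prevp M F e u \<and> col u = c)"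
      using cond unfolding parallel_cond_def by (elim conjE)
    have "col e \<in> {..D}" using cols[OF that(1)] by simp
    then have "\<not> (\<exists>u. prevp M F e u \<and> col u = col e)" using a that(1,2) by blast
    then show ?thesis using that(3) by metis
  qed
  have l1: "\<forall>c\<in>{..D}. \<forall>d\<in>{..D} - {c}. link M (\<lambda>e. F e \<and> col e = c \<and> (\<exists>u. succp M F e u \<and> col u = d))
        (\<lambda>e. Y e \<and> col e = d \<and> (\<exists>u. prevp M Y e u \<and> col u = c))"
    and l2: "link M ?E (\<lambda>e. F e \<and> (\<exists>u. prevp M F e u))"
    and c5: "\<forall>w\<in>Ws. \<forall>c\<in>{..D}. \<forall>e\<in>events M. run_last M D Y col e \<longrightarrow> col e = c \<longrightarrow>
        \<not> (\<exists>f. lv M F w e f \<and> (col f = c \<or> (\<exists>u. prevp M F f u \<and> col u = c)))"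
    and c6: "\<forall>w\<in>Ws. \<forall>c\<in>{..D}. \<forall>e\<in>events M. F e \<longrightarrow> col e = c \<longrightarrow>
        \<not> (\<exists>f. lv M ?E w e f \<and> col f = c)"
    using cond unfolding parallel_cond_def simp_thms by - (elim conjE, assumption)+
  have EY: "Y e" if "?E e" for e using that by (simp add: run_first_def)
  have Ep: "\<And>e. e \<in> events M \<Longrightarrow> ?E e \<Longrightarrow> fst e = p" using EY pq(1) by blast
  have Fq: "\<And>e. e \<in> events M \<Longrightarrow> F e \<Longrightarrow> fst e = q" using FW pq(2) by blast
  have Ep': "\<forall>x\<in>events M. ?E x \<longrightarrow> fst x = p" and Fq': "\<forall>x\<in>events M. F x \<longrightarrow> fst x = q"
    using Ep Fq by blast+
  obtain K e where "enumerates M ?E p K e" using enumerate_proc[OF Ep'] by blast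
  note e = enumeratesD(1)[OF this] and e_less = enumeratesD(2)[OF this] and e_sur = enumeratesD(3)[OF this]
  obtain L f where "enumerates M F q L f" using enumerate_proc[OF Fq'] by blast
  note f = enumeratesD(1)[OF this] and f_less = enumeratesD(2)[OF this] and f_sur = enumeratesD(3)[OF this]
  have e_mono: "snd (e i) \<le> snd (e j)" if "1 \<le> i" "i \<le> j" "j \<le> K" for i j
    using e_less[of i j] that by (cases "i = j") auto
  have f_mono: "snd (f i) \<le> snd (f j)" if "1 \<le> i" "i \<le> j" "j \<le> L" for i j
    using f_less[of i j] that by (cases "i = j") auto
  have e_le: "e i \<preceq> e j" if "1 \<le> i" "i \<le> j" "j \<le> K" for i j
  proof (cases "i = j")
    case False
    then show ?thesis using e[of i] e[of j] e_less[of i j] that same_proc_le[of "e i" "e j"] by auto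
  qed simp
  have f_le: "f i \<preceq> f j" if "1 \<le> i" "i \<le> j" "j \<le> L" for i j
  proof (cases "i = j")
    case False
    then show ?thesis using f[of i] f[of j] f_less[of i j] that same_proc_le[of "f i" "f j"] by auto
  qed simp
  have e_idx: "i \<le> j" if "snd (e i) \<le> snd (e j)" "1 \<le> j" "i \<le> K" for i j
    using e_less[of j i] that by (metis leD not_le_imp_less)
  have f_idx: "i \<le> j" if "snd (f i) \<le> snd (f j)" "1 \<le> j" "i \<le> L" for i j
    using f_less[of j i] that by (metis leD not_le_imp_less)
  have e_inj: "i = j" if "e i = e j" "1 \<le> i" "1 \<le> j" "i \<le> K" "j \<le> K" for i j
    using e_idx[of i j] e_idx[of j i] that by simp
  have f_inj: "i = j" if "f i = f j" "1 \<le> i" "1 \<le> j" "i \<le> L" "j \<le> L" for i j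
    using f_idx[of i j] f_idx[of j i] that by simp
  have ef_neq: "e i \<noteq> f j" if "1 \<le> i" "i \<le> K" "1 \<le> j" "j \<le> L" for i j
    using e[of i] f[of j] that pq(3) by metis
  have anti: False if "e i \<preceq> f j" "f j \<preceq> e i" "1 \<le> i" "i \<le> K" "1 \<le> j" "j \<le> L" for i j
    using cle_antisym[OF that(1,2)] ef_neq that by blast
  have f_prev: "prevp M F (f i) (f (i - 1))" if "2 \<le> i" "i \<le> L" for i
    unfolding prevp_def
  proof (intro conjI ballI impI)
    show "f (i - 1) \<in> events M" "fst (f (i - 1)) = fst (f i)" "F (f (i - 1))"
      using f[of i] f[of "i - 1"] that by auto
    show "snd (f (i - 1)) < snd (f i)" using f_less[of "i - 1" i] that by simp
    fix v assume v: "v \<in> events M" "fst v = fst (f i)" "snd v < snd (f i)" "F v"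
    obtain j where j: "1 \<le> j" "j \<le> L" "v = f j" using f_sur[OF v(1,4)] by blast
    have "\<not> i \<le> j"
    proof
      assume "i \<le> j"
      then have "snd (f i) \<le> snd v" using f_mono[of i j] j that by simp
      then show False using v by simp
    qed
    then have "j \<le> i - 1" "i - 1 \<le> L" using that by auto
    then show "snd v \<le> snd (f (i - 1))" using f_mono[of j "i - 1"] j by simp
  qed
  \<comment> \<open>The \<open>Y\<close>-event before \<open>e i\<close> belongs to run
    \<open>i - 1\<close> and has its colour, which differs from that of \<open>e i\<close> because a
    new run starts there.\<close>
  have e_prev: "\<exists>u. prevp M Y (e i) u \<and> col u = col (e (i - 1)) \<and> col u \<noteq> col (e i)" if i: "2 \<le> i" "i \<le> K" for i
  proof -
    have ei: "e i \<in> events M" "?E (e i)" "fst (e i) = p" and ei1: "e (i - 1) \<in> events M" "?E (e (i - 1))" "fst (e (i - 1)) = p"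
      using e[of i] e[of "i - 1"] i by auto
    have lt: "snd (e (i - 1)) < snd (e i)" using e_less[of "i - 1" i] i by simp
    obtain u where u: "prevp M Y (e i) u"
      using prevp_exists[of "e (i - 1)" "e i" Y] ei ei1 lt EY by auto
    have ue: "u \<in> events M" "Y u" "fst u = p" "snd u < snd (e i)" using u ei unfolding prevp_def by auto
    obtain x where x: "lastp M ?E u x" "col x = col u" using run_first_of[of u Y col D, OF ue(1,2) cols] by blast
    have "snd (e (i - 1)) \<le> snd u" using u ei1 ei lt EY[OF ei1(2)] unfolding prevp_def by auto
    then have a: "snd (e (i - 1)) \<le> snd x" using x(1) ei1 ue unfolding lastp_def by auto
    have xe: "x \<in> events M" "?E x" "snd x \<le> snd u" using x(1) unfolding lastp_def by auto
    obtain j where j: "1 \<le> j" "j \<le> K" "x = e j" using e_sur[OF xe(1,2)] by blast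
    have "i - 1 \<le> j" using e_idx[of "i - 1" j] a j i by simp
    moreover have "\<not> i \<le> j"
    proof
      assume "i \<le> j"
      then have "snd (e i) \<le> snd x" using e_mono[of i j] j i by simp
      then show False using xe ue by simp
    qed
    ultimately have "j = i - 1" by simp
    then have "col u = col (e (i - 1))" using x j by simp
    moreover have "col u \<noteq> col (e i)" using ei(2) u cols[OF ei(1)] unfolding run_first_def by auto
    ultimately show ?thesis using u by blast
  qed
  obtain s where s: "inj_on s {y \<in> events M. F y \<and> (\<exists>u. prevp M F y u)}"
    "\<And>y. y \<in> events M \<Longrightarrow> F y \<and> (\<exists>u. prevp M F y u) \<Longrightarrow> s y \<in> events M \<and> ?E (s y) \<and> s y \<preceq> y"
    using link_sound[OF l2] by blast
  \<comment> \<open>The tokens of \<open>f 2\<close> up to \<open>f j\<close> originate in distinct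
    run starts \<open>e (\<sigma> k)\<close>, one of which has index at least
    \<open>j - 1\<close>.\<close>
  have tok2: "j - 1 \<le> K \<and> e (j - 1) \<preceq> f j" if j: "2 \<le> j" "j \<le> L" for j
  proof -
    have dom: "f k \<in> events M" "F (f k) \<and> (\<exists>u. prevp M F (f k) u)" if "2 \<le> k" "k \<le> j" for k
      using f[of k] f_prev[of k] that j by auto
    have "\<exists>i. 2 \<le> k \<longrightarrow> k \<le> j \<longrightarrow> 1 \<le> i \<and> i \<le> K \<and> s (f k) = e i" for k
      using e_sur[of "s (f k)"] s(2)[OF dom] by blast
    then obtain \<sigma> where \<sigma>: "\<And>k. 2 \<le> k \<Longrightarrow> k \<le> j \<Longrightarrow> 1 \<le> \<sigma> k \<and> \<sigma> k \<le> K \<and> s (f k) = e (\<sigma> k)" by metis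
    have "inj_on \<sigma> {2..j}"
    proof (rule inj_onI)
      fix k k' assume k: "k \<in> {2..j}" "k' \<in> {2..j}" "\<sigma> k = \<sigma> k'"
      then have "s (f k) = s (f k')" using \<sigma>[of k] \<sigma>[of k'] by simp
      then have "f k = f k'" using inj_onD[OF s(1), of "f k" "f k'"] dom[of k] dom[of k'] k by simp
      then show "k = k'" using f_inj[of k k'] k j by simp
    qed
    then obtain k where k: "2 \<le> k" "k \<le> j" "j - 1 \<le> \<sigma> k" using injective_reaches[of \<sigma> j] \<sigma> j by blast
    have "e (j - 1) \<preceq> e (\<sigma> k)" using e_le[of "j - 1" "\<sigma> k"] k \<sigma>[of k] j by simp
    moreover have "e (\<sigma> k) \<preceq> f k" using s(2)[OF dom[OF k(1,2)]] \<sigma>[OF k(1,2)] by simp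
    moreover have "f k \<preceq> f j" using f_le[of k j] k j by simp
    ultimately have "e (j - 1) \<preceq> f j" using cle_trans by blast
    then show ?thesis using k \<sigma>[of k] by simp
  qed
  define tgt where "tgt c d y \<longleftrightarrow> Y y \<and> col y = d \<and> (\<exists>u. prevp M Y y u \<and> col u = c)" for c d y
  define src where "src c d y \<longleftrightarrow> F y \<and> col y = c \<and> (\<exists>u. succp M F y u \<and> col u = d)" for c d y
  define lk where "lk c d t \<longleftrightarrow> inj_on t {y \<in> events M. tgt c d y} \<and>
     (\<forall>y\<in>events M. tgt c d y \<longrightarrow> t y \<in> events M \<and> src c d (t y) \<and> t y \<preceq> y)" for c d t
  have "\<exists>t. c \<le> D \<longrightarrow> d \<le> D \<longrightarrow> c \<noteq> d \<longrightarrow> lk c d t" for c d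
  proof (cases "c \<le> D \<and> d \<le> D \<and> c \<noteq> d")
    case True
    then have "c \<in> {..D}" "d \<in> {..D} - {c}" by auto
    then have "link M (\<lambda>e. src c d e) (\<lambda>e. tgt c d e)" using l1 unfolding src_def tgt_def by blast
    from link_sound[OF this] show ?thesis unfolding lk_def by blast
  qed blast
  then obtain t where lk: "\<And>c d. c \<le> D \<Longrightarrow> d \<le> D \<Longrightarrow> c \<noteq> d \<Longrightarrow> lk c d (t c d)" by metis
  have t_inj: "inj_on (t c d) {y \<in> events M. tgt c d y}" if "c \<le> D" "d \<le> D" "c \<noteq> d" for c d
    using lk[OF that] unfolding lk_def by simp
  have t: "t c d y \<in> events M \<and> src c d (t c d y) \<and> t c d y \<preceq> y"
    if "c \<le> D" "d \<le> D" "c \<noteq> d" "y \<in> events M" "tgt c d y" for c d y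
    using lk[OF that(1-3)] that(4,5) unfolding lk_def by simp
  \<comment> \<open>The origin of the token of \<open>e i\<close>, taken from the link for the
    colours of runs \<open>i - 1\<close> and \<open>i\<close>.\<close>
  define tt where "tt i = t (col (e (i - 1))) (col (e i)) (e i)" for i
  have ecol: "col (e i) \<le> D" if "1 \<le> i" "i \<le> K" for i using cols e[of i] that by blast
  have tdom: "tgt (col (e (i - 1))) (col (e i)) (e i)"
    "col (e (i - 1)) \<noteq> col (e i)" if "2 \<le> i" "i \<le> K" for i
    using e_prev[OF that] EY e[of i] that unfolding tgt_def by auto
  have tt: "tt i \<in> events M" "F (tt i)" "col (tt i) = col (e (i - 1))" "\<exists>u. succp M F (tt i) u \<and> col u = col (e i)"
    "tt i \<preceq> e i" if i: "2 \<le> i" "i \<le> K" for i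
  proof -
    have "e i \<in> events M" "col (e (i - 1)) \<le> D" "col (e i) \<le> D" using e[of i] ecol[of i] ecol[of "i - 1"] i by auto
    from t[OF this(2,3) tdom(2)[OF i] this(1) tdom(1)[OF i]]
    show "tt i \<in> events M" "F (tt i)" "col (tt i) = col (e (i - 1))" "\<exists>u. succp M F (tt i) u \<and> col u = col (e i)"
      "tt i \<preceq> e i" unfolding tt_def src_def by blast+
  qed
  \<comment> \<open>Each single link is injective, and an origin determines its link: the two
    colours are its own and that of its \<open>succp\<close>.\<close>
  have tt_inj: "i = j" if ij: "tt i = tt j" "2 \<le> i" "i \<le> K" "2 \<le> j" "j \<le> K" for i j
  proof -
    have c: "col (e (i - 1)) = col (e (j - 1))" using tt(3)[of i] tt(3)[of j] ij by simp
    obtain u u' where u: "succp M F (tt i) u" "col u = col (e i)" "succp M F (tt j) u'" "col u' = col (e j)"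
      using tt(4)[of i] tt(4)[of j] ij by blast
    then have "u = u'" using succp_unique ij(1) by metis
    then have d: "col (e i) = col (e j)" using u by simp
    have ev: "e i \<in> events M" "e j \<in> events M" "col (e (i - 1)) \<le> D" "col (e i) \<le> D"
      using e[of i] e[of j] ecol[of i] ecol[of "i - 1"] ij by auto
    have "e i = e j"
      by (rule inj_onD[OF t_inj[OF ev(3,4) tdom(2)[OF ij(2,3)]]])
        (use ij(1) c d tdom(1)[OF ij(2,3)] tdom(1)[OF ij(4,5)] ev in \<open>auto simp: tt_def\<close>)
    then show ?thesis using e_inj[of i j] ij by simp
  qed
  \<comment> \<open>As for \<open>tok2\<close>; by \<open>tt_inj\<close> the tokens of all colour
    pairs can be counted together.\<close>
  have tok1: "i - 1 \<le> L \<and> f (i - 1) \<preceq> e i" if i: "2 \<le> i" "i \<le> K" for i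
  proof -
    have "\<exists>j. 2 \<le> k \<longrightarrow> k \<le> i \<longrightarrow> 1 \<le> j \<and> j \<le> L \<and> tt k = f j" for k
      using f_sur[of "tt k"] tt(1,2)[of k] i le_trans by blast
    then obtain \<sigma> where \<sigma>: "\<And>k. 2 \<le> k \<Longrightarrow> k \<le> i \<Longrightarrow> 1 \<le> \<sigma> k \<and> \<sigma> k \<le> L \<and> tt k = f (\<sigma> k)" by metis
    have "inj_on \<sigma> {2..i}"
    proof (rule inj_onI)
      fix k k' assume k: "k \<in> {2..i}" "k' \<in> {2..i}" "\<sigma> k = \<sigma> k'"
      then have "tt k = tt k'" using \<sigma>[of k] \<sigma>[of k'] by simp
      then show "k = k'" using tt_inj[of k k'] k i by simp
    qed
    then obtain k where k: "2 \<le> k" "k \<le> i" "i - 1 \<le> \<sigma> k" using injective_reaches[of \<sigma> i] \<sigma> i by blast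
    have "f (i - 1) \<preceq> f (\<sigma> k)" using f_le[of "i - 1" "\<sigma> k"] k \<sigma>[of k] i by simp
    moreover have "f (\<sigma> k) \<preceq> e k" using tt(5)[of k] \<sigma>[OF k(1,2)] k i by simp
    moreover have "e k \<preceq> e i" using e_le[of k i] k i by simp
    ultimately have "f (i - 1) \<preceq> e i" using cle_trans by blast
    then show ?thesis using k \<sigma>[of k] by simp
  qed
  \<comment> \<open>The last conjunct carries the induction: the earlier origins are known exactly,
    so they cannot be used again.\<close>
  define good where "good i \<longleftrightarrow> i \<le> L \<and> col (f i) = col (e i) \<and> \<not> e i \<preceq> f i \<and>
     (\<forall>z\<in>events M. Y z \<longrightarrow> lastp M ?E z (e i) \<longrightarrow> \<not> f i \<preceq> z) \<and> (2 \<le> i \<longrightarrow> tt i = f (i - 1))" for i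
  have main: "1 \<le> i \<longrightarrow> i \<le> K \<longrightarrow> good i" for i
  proof (induction i rule: less_induct)
    case (less i)
    show ?case
    proof (intro impI)
      assume i: "1 \<le> i" "i \<le> K"
      have ei: "e i \<in> events M" "?E (e i)" "fst (e i) = p" using e[OF i] by auto
      have step1: "i \<le> L \<and> col (f i) = col (e i) \<and> (2 \<le> i \<longrightarrow> tt i = f (i - 1))"
      proof (cases "i = 1")
        case True
        have L: "1 \<le> L" using Fne f_sur by fastforce
        have "\<not> (\<exists>u. prevp M F (f 1) u)"
        proof
          assume "\<exists>u. prevp M F (f 1) u"
          then obtain u where u: "prevp M F (f 1) u" ..
          then have "u \<in> events M" "F u" "snd u < snd (f 1)" by (auto simp: prevp_def)
          then obtain j where "1 \<le> j" "j \<le> L" "u = f j" using f_sur by blast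
          then show False using f_mono[of 1 j] \<open>snd u < snd (f 1)\<close> by simp
        qed
        then have c1: "col (f 1) = 0" using F0 f[of 1] L by blast
        have "\<not> (\<exists>u. prevp M Y (e 1) u)"
        proof
          assume "\<exists>u. prevp M Y (e 1) u"
          then obtain u where u: "prevp M Y (e 1) u" ..
          then have ue: "u \<in> events M" "Y u" "snd u < snd (e 1)" by (auto simp: prevp_def)
          obtain x where x: "lastp M ?E u x" using run_first_of[of u Y col D, OF ue(1,2) cols] by blast
          then have "x \<in> events M" "?E x" "snd x \<le> snd u" by (auto simp: lastp_def)
          then obtain j where "1 \<le> j" "j \<le> K" "x = e j" using e_sur by blast
          then show False using e_mono[of 1 j] \<open>snd x \<le> snd u\<close> ue(3) by simp
        qed
        then have "col (e 1) = 0" using Y0 EY ei True by blast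
        then show ?thesis using c1 L True by simp
      next
        case False
        then have i2: "2 \<le> i" using i by simp
        have prev: "good (i - 1)" using less.IH[of "i - 1"] i2 i by simp
        obtain k where k: "1 \<le> k" "k \<le> L" "tt i = f k" using f_sur[OF tt(1,2)[OF i2 i(2)]] by blast
        have fk: "f k \<preceq> e i" using tt(5)[OF i2 i(2)] k by simp
        \<comment> \<open>Otherwise
          \<open>e i \<preceq> e (k - 1) \<preceq> f k \<preceq> e i\<close> would identify events
          of different processes.\<close>
        have "k \<le> i"
        proof (rule ccontr)
          assume "\<not> k \<le> i"
          then have k2: "2 \<le> k" "i \<le> k - 1" using i by auto
          have "k - 1 \<le> K" "e (k - 1) \<preceq> f k" using tok2[OF k2(1) k(2)] by auto
          then have "e i \<preceq> f k" using e_le[of i "k - 1"] k2 i cle_trans by blast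
          then show False using anti[of i k] fk i k by blast
        qed
        \<comment> \<open>Such an \<open>f k\<close> is already the origin of the token of
          \<open>e (k + 1)\<close>.\<close>
        moreover have "\<not> k \<le> i - 2"
        proof
          assume kk: "k \<le> i - 2"
          have a: "2 \<le> k + 1" "k + 1 < i" using k i2 kk by auto
          have "good (k + 1)" using less.IH[of "k + 1"] a i by simp
          then have "tt (k + 1) = f k" using a unfolding good_def by simp
          then have "k + 1 = i" using tt_inj[of "k + 1" i] a i i2 k by simp
          then show False using a by simp
        qed
        \<comment> \<open>The origin has the colour of run \<open>i - 1\<close>, hence that of
          \<open>f (i - 1)\<close>, and successive \<open>F\<close>-events differ in colour.\<close>
        moreover have "k \<noteq> i"
        proof
          assume ki: "k = i"
          have "col (f i) = col (e (i - 1))" using tt(3)[OF i2 i(2)] k ki by simp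
          also have "\<dots> = col (f (i - 1))" using prev unfolding good_def by simp
          finally show False using Fdiff[of "f i" "f (i - 1)"] f[of i] f_prev[of i] i2 k ki by simp
        qed
        ultimately have ki: "k = i - 1" using i2 by simp
        obtain u where u: "succp M F (f (i - 1)) u" "col u = col (e i)"
          using tt(4)[OF i2 i(2)] k ki by auto
        have ue: "u \<in> events M" "F u" "snd (f (i - 1)) < snd u" using u(1) unfolding succp_def by auto
        obtain j where j: "1 \<le> j" "j \<le> L" "u = f j" using f_sur[OF ue(1,2)] by blast
        have "i - 1 < j"
        proof (rule ccontr)
          assume "\<not> i - 1 < j"
          then have "snd (f j) \<le> snd (f (i - 1))" using f_mono[of j "i - 1"] j k ki by simp
          then show False using ue j by simp
        qed
        then have iL: "i \<le> L" using j by simp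
        have "snd (f (i - 1)) < snd (f i)" using f_less[of "i - 1" i] i2 iL by simp
        then have "snd u \<le> snd (f i)" using u(1) f[of i] f[of "i - 1"] i iL i2 unfolding succp_def by auto
        then have "j \<le> i" using f_idx[of j i] j i by simp
        then have "j = i" using \<open>i - 1 < j\<close> by simp
        then show ?thesis using iL u j k ki by simp
      qed
      then have iL: "i \<le> L" and ci: "col (f i) = col (e i)" by auto
      have fi: "f i \<in> events M" "F (f i)" "fst (f i) = q" using f[OF i(1) iL] by auto
      \<comment> \<open>By \<open>tok1\<close> no later run start is below \<open>f i\<close>, so
        \<open>e i\<close> would be the last one below it and some \<open>w\<close> would make it
        visible there, with a forbidden colour.\<close>
      have n1: "\<not> e i \<preceq> f i"
      proof
        assume le: "e i \<preceq> f i"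
        obtain x where x: "x \<in> events M" "?E x \<and> x \<preceq> f i" "\<And>v. v \<in> events M \<Longrightarrow> ?E v \<and> v \<preceq> f i \<Longrightarrow> snd v \<le> snd x"
          by (rule max_event[of "\<lambda>x. ?E x \<and> x \<preceq> f i"]) (use le ei in auto)
        obtain k where k: "1 \<le> k" "k \<le> K" "x = e k" using e_sur x by blast
        have ik: "i \<le> k" using e_idx[of i k] x(3)[OF ei(1)] ei le k i by simp
        have "\<not> i < k"
        proof
          assume lt: "i < k"
          have tk: "k - 1 \<le> L" "f (k - 1) \<preceq> e k" using tok1[of k] k lt i by auto
          then have "f i \<preceq> f (k - 1)" using f_le[of i "k - 1"] lt i by simp
          then have "f i \<preceq> e k" using tk(2) by (rule cle_trans)
          then show False using anti[of k i] x k i iL by simp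
        qed
        then have xk: "x = e i" using k ik by simp
        obtain w where w: "distinct w" "set w \<subseteq> P" "via M w (e i) (f i)" using via_exists[OF le ei(1)] by blast
        have "lv M ?E w (f i) (e i)"
        proof (rule lv_last[OF w(3) fi(1) ei(1)])
          show "?E (e i)" by (rule ei(2))
          show "fst g = fst (e i)" if "g \<in> events M" "?E g" for g using Ep[OF that] ei(3) by simp
          show "snd g \<le> snd (e i)" if "g \<in> events M" "?E g" "g \<preceq> f i" for g
            using x(3)[of g] that xk by simp
        qed
        moreover have "col (e i) \<in> {..D}" using ecol[OF i] by simp
        from c6[THEN bspec, OF Ws[OF w(1,2)], THEN bspec, OF this, THEN bspec, OF fi(1)] fi(2) ci
        have "\<not> (\<exists>g. lv M ?E w (f i) g \<and> col g = col (e i))" by blast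
        ultimately show False by blast
      qed
      \<comment> \<open>At the end \<open>z'\<close> of the run the last \<open>F\<close>-event
        below would be \<open>f k\<close> with \<open>k \<ge> i\<close>, and \<open>tok2\<close>
        allows only \<open>k = i\<close> and \<open>k = i + 1\<close>. This is why the certificate
        looks at the colour of the visible \<open>F\<close>-event and at that of the
        \<open>F\<close>-event before it.\<close>
      have n2: "\<not> f i \<preceq> z" if z: "z \<in> events M" "Y z" "lastp M ?E z (e i)" for z
      proof
        assume fz: "f i \<preceq> z"
        obtain z' where z': "z' \<in> events M" "run_last M D Y col z'" "z \<preceq> z'" "lastp M ?E z' (e i)"
          using run_last_of[of z Y col D "e i", OF z(1,2) cols z(3)] by blast
        have Yz': "Y z'" using z'(2) by (simp add: run_last_def)
        have cz: "col z' = col (e i)"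
          using run_first_of[of z' Y col D, OF z'(1) Yz' cols] lastp_unique[OF z'(4)] by metis
        have le: "f i \<preceq> z'" using fz z'(3) cle_trans by blast
        obtain x where x: "x \<in> events M" "F x \<and> x \<preceq> z'" "\<And>v. v \<in> events M \<Longrightarrow> F v \<and> v \<preceq> z' \<Longrightarrow> snd v \<le> snd x"
          by (rule max_event[of "\<lambda>x. F x \<and> x \<preceq> z'"]) (use le fi in auto)
        obtain k where k: "1 \<le> k" "k \<le> L" "x = f k" using f_sur x by blast
        have ik: "i \<le> k" using f_idx[of i k] x(3)[OF fi(1)] fi le k iL by simp
        have "k \<le> i + 1"
        proof (rule ccontr)
          assume "\<not> k \<le> i + 1"
          then have k2: "2 \<le> k" "i + 1 \<le> k - 1" by auto
          have kk: "k - 1 \<le> K" "e (k - 1) \<preceq> f k" using tok2[OF k2(1) k(2)] by auto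
          then have "e (k - 1) \<preceq> z'" using x k cle_trans by blast
          moreover have ek: "e (k - 1) \<in> events M" "?E (e (k - 1))" "fst (e (k - 1)) = fst z'"
            using e[of "k - 1"] kk k2 pq(1)[OF Yz'] by auto
          ultimately have "snd (e (k - 1)) \<le> snd z'" using cle_same_proc[OF ek(1) z'(1) ek(3)] by blast
          then have "snd (e (k - 1)) \<le> snd (e i)" using z'(4) ek unfolding lastp_def by auto
          then have "k - 1 \<le> i" using e_idx[of "k - 1" i] kk i by simp
          then show False using k2 by simp
        qed
        obtain w where w: "distinct w" "set w \<subseteq> P" "via M w (f k) z'" using via_exists[of "f k" z'] x k by blast
        have lv: "lv M F w z' (f k)"
        proof (rule lv_last[OF w(3) z'(1)])
          show "f k \<in> events M" "F (f k)" using f[OF k(1,2)] by auto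
          show "fst g = fst (f k)" if "g \<in> events M" "F g" for g using Fq[OF that] f[OF k(1,2)] by simp
          show "snd g \<le> snd (f k)" if "g \<in> events M" "F g" "g \<preceq> z'" for g
            using x(3)[of g] that k by simp
        qed
        have "col (e i) \<in> {..D}" using ecol[OF i] by simp
        from c5[THEN bspec, OF Ws[OF w(1,2)], THEN bspec, OF this, THEN bspec, OF z'(1)] z'(2) cz
        have "\<not> (\<exists>g. lv M F w z' g \<and> (col g = col (e i) \<or> (\<exists>u. prevp M F g u \<and> col u = col (e i))))" by blast
        then have nn: "\<not> (col (f k) = col (e i) \<or> (\<exists>u. prevp M F (f k) u \<and> col u = col (e i)))"
          using lv by blast
        consider "k = i" | "k = i + 1" using ik \<open>k \<le> i + 1\<close> by linarith
        then show False
        proof cases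
          case 1 then show ?thesis using nn ci by simp
        next
          case 2
          then have "prevp M F (f k) (f i)" using f_prev[of k] i k by simp
          then show ?thesis using nn ci by blast
        qed
      qed
      show "good i" unfolding good_def using step1 n1 n2 by blast
    qed
  qed
  obtain x where x: "lastp M ?E y x" using run_first_of[of y Y col D, OF y cols] by blast
  then have "x \<in> events M" "?E x" by (auto simp: lastp_def)
  then obtain i where i: "1 \<le> i" "i \<le> K" "x = e i" using e_sur by blast
  have g: "good i" using main i by blast
  then have fi: "f i \<in> events M" "W (f i)" using f[of i] FW i unfolding good_def by blast+
  have "\<not> f i \<preceq> y" using g x y i unfolding good_def by blast
  moreover have "e i \<preceq> y" using lastp_cle[OF x y(1)] i by simp
  then have "\<not> y \<preceq> f i" using g cle_trans unfolding good_def by blast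
  ultimately show ?thesis using fi by blast
qed

end

text \<open>First-fit: at most \<open>D\<close> of the \<open>D + 1\<close> colours are taken by
  smaller indices, and \<open>H i \<subseteq> {..<i}\<close> keeps earlier choices valid. The least
  free colour is \<open>0\<close> for an unconstrained index, as the certificate demands of the
  first one.\<close>

lemma greedy_colouring:
  fixes H :: "nat \<Rightarrow> nat set"
  assumes "\<And>i. finite (H i)" "\<And>i. card (H i) \<le> D" "\<And>i. H i \<subseteq> {..<i}"
  shows "\<exists>\<kappa> :: nat \<Rightarrow> nat. \<forall>i<n. \<kappa> i \<le> D \<and> (\<forall>h\<in>H i. \<kappa> h \<noteq> \<kappa> i) \<and> (H i = {} \<longrightarrow> \<kappa> i = 0)"
proof (induction n)
  case (Suc n)
  then obtain \<kappa> :: "nat \<Rightarrow> nat" where \<kappa>: "\<forall>i<n. \<kappa> i \<le> D \<and> (\<forall>h\<in>H i. \<kappa> h \<noteq> \<kappa> i) \<and> (H i = {} \<longrightarrow> \<kappa> i = 0)"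
    by blast
  define k where "k = (LEAST c. c \<notin> \<kappa> ` H n)"
  have "\<not> {..D} \<subseteq> \<kappa> ` H n"
  proof
    assume "{..D} \<subseteq> \<kappa> ` H n"
    then have "card {..D} \<le> card (\<kappa> ` H n)" using assms(1) by (intro card_mono) simp_all
    also have "\<dots> \<le> card (H n)" using assms(1) by (rule card_image_le)
    finally show False using assms(2)[of n] by simp
  qed
  then obtain c where c: "c \<le> D" "c \<notin> \<kappa> ` H n" by auto
  have k1: "k \<notin> \<kappa> ` H n" unfolding k_def using c(2) by (rule LeastI)
  have "k \<le> c" unfolding k_def using c(2) by (rule Least_le)
  then have k2: "k \<le> D" using c(1) by simp
  have k3: "H n = {} \<longrightarrow> k = 0" unfolding k_def by simp
  let ?\<kappa> = "\<kappa>(n := k)"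
  have upd: "?\<kappa> h = \<kappa> h" if "h \<in> H i" "i \<le> n" for h i using assms(3)[of i] that by auto
  have "?\<kappa> i \<le> D \<and> (\<forall>h\<in>H i. ?\<kappa> h \<noteq> ?\<kappa> i) \<and> (H i = {} \<longrightarrow> ?\<kappa> i = 0)" if i: "i < Suc n" for i
  proof (cases "i = n")
    case True
    have "?\<kappa> h \<noteq> k" if "h \<in> H n" for h using upd[OF that] k1 that by auto
    then show ?thesis using True k2 k3 by simp
  next
    case False
    then have lt: "i < n" using i by simp
    have "?\<kappa> h \<noteq> \<kappa> i" if "h \<in> H i" for h using upd[OF that] \<kappa> lt that by auto
    then show ?thesis using \<kappa> lt False by simp
  qed
  then show ?case by blast
qed simp

section \<open>Completeness of the certificate for parallelism\<close>

context msc_loc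
begin

definition par :: "'p event \<Rightarrow> 'p event \<Rightarrow> bool" where
  "par x y \<longleftrightarrow> \<not> x \<preceq> y \<and> \<not> y \<preceq> x"

text \<open>
  The greedy choice of witnesses: \<open>e\<^sub>i\<^sub>+\<^sub>1\<close> is the first \<open>Y\<close>-event not parallel to \<open>f\<^sub>i\<close>, and \<open>f\<^sub>i\<close> is the
  last \<open>W\<close>-event parallel to \<open>e\<^sub>i\<close>.
\<close>

definition greedy :: "('p event \<Rightarrow> bool) \<Rightarrow> ('p event \<Rightarrow> bool) \<Rightarrow> nat \<Rightarrow> nat \<Rightarrow> (nat \<Rightarrow> 'p event) \<Rightarrow> (nat \<Rightarrow> 'p event) \<Rightarrow> bool" where
  "greedy Y W n K e f \<longleftrightarrow>
     (\<forall>i. 1 \<le> i \<longrightarrow> i \<le> K \<longrightarrow> Y (e i) \<and> snd (e i) \<le> n \<and> W (f i) \<and> par (e i) (f i) \<and>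
        (\<forall>g. W g \<longrightarrow> par (e i) g \<longrightarrow> snd g \<le> snd (f i))) \<and>
     (\<forall>i j. 1 \<le> i \<longrightarrow> i < j \<longrightarrow> j \<le> K \<longrightarrow> snd (e i) < snd (e j)) \<and>
     (\<forall>i. 1 \<le> i \<longrightarrow> i < K \<longrightarrow> f i \<preceq> e (Suc i) \<and> e i \<preceq> f (Suc i)) \<and>
     (\<forall>y. Y y \<longrightarrow> snd y \<le> n \<longrightarrow> (\<exists>i. 1 \<le> i \<and> i \<le> K \<and> snd (e i) \<le> snd y \<and> (i < K \<longrightarrow> snd y < snd (e (Suc i))) \<and> par y (f i)))"

text \<open>Induction over the positions \<open>n\<close> of process \<open>p\<close>. A new pair
  starts at \<open>?y\<close> if \<open>?y\<close> is not parallel to the current witness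
  \<open>f K\<close>; as \<open>e K \<preceq> ?y\<close>, this means
  \<open>f K \<preceq> ?y\<close>. The new witness \<open>w\<close> lies after \<open>f K\<close>,
  so by maximality of \<open>f K\<close> it is not parallel to \<open>e K\<close>, and
  \<open>w \<preceq> e K \<preceq> ?y\<close> is impossible; hence
  \<open>e K \<preceq> w\<close>.\<close>

lemma greedy_exists:
  assumes pq: "\<And>e. Y e \<Longrightarrow> e \<in> events M \<and> fst e = p" "\<And>f. W f \<Longrightarrow> f \<in> events M \<and> fst f = q"
    and wit: "\<And>y. Y y \<Longrightarrow> \<exists>f. W f \<and> par y f"
  shows "\<exists>K e f. greedy Y W n K e f"
proof (induction n)
  case 0
  have "\<not> snd y \<le> 0" if "Y y" for y using pq(1)[OF that] by (simp add: event_iff)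
  then show ?case unfolding greedy_def by (intro exI[of _ 0]) auto
next
  case (Suc n)
  then obtain K e f where g: "greedy Y W n K e f" by blast
  note g1 = g[unfolded greedy_def, THEN conjunct1, rule_format]
    and g2 = g[unfolded greedy_def, THEN conjunct2, THEN conjunct1, rule_format]
    and g3 = g[unfolded greedy_def, THEN conjunct2, THEN conjunct2, THEN conjunct1, rule_format]
    and g4 = g[unfolded greedy_def, THEN conjunct2, THEN conjunct2, THEN conjunct2, rule_format]
  have g1': "snd (e i) \<le> Suc n" if "1 \<le> i" "i \<le> K" for i using g1[OF that] by simp
  let ?y = "(p, Suc n)"
  have new: "y = ?y" if "Y y" "\<not> snd y \<le> n" "snd y \<le> Suc n" for y
    using pq(1)[OF that(1)] that by (auto simp: prod_eq_iff)
  consider "\<not> Y ?y" | "Y ?y" "1 \<le> K" "par ?y (f K)" | "Y ?y" "1 \<le> K \<longrightarrow> \<not> par ?y (f K)" by blast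
  then show ?case
  proof cases
    case 1
    have "greedy Y W (Suc n) K e f"
      unfolding greedy_def
    proof (intro conjI allI impI)
      fix y assume y: "Y y" "snd y \<le> Suc n"
      have "snd y \<le> n" using new[OF y(1) _ y(2)] 1 y(1) by metis
      then show "\<exists>i. 1 \<le> i \<and> i \<le> K \<and> snd (e i) \<le> snd y \<and> (i < K \<longrightarrow> snd y < snd (e (Suc i))) \<and> par y (f i)"
        using g4[OF y(1)] by simp
    qed (use g1 g1' g2 g3 in auto)
    then show ?thesis by blast
  next
    case 2
    have "greedy Y W (Suc n) K e f"
      unfolding greedy_def
    proof (intro conjI allI impI)
      fix y assume y: "Y y" "snd y \<le> Suc n"
      show "\<exists>i. 1 \<le> i \<and> i \<le> K \<and> snd (e i) \<le> snd y \<and> (i < K \<longrightarrow> snd y < snd (e (Suc i))) \<and> par y (f i)"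
      proof (cases "snd y \<le> n")
        case False
        then have "y = ?y" using new y by blast
        then show ?thesis using 2 g1[of K] by (intro exI[of _ K]) auto
      qed (use g4[OF y(1)] in simp)
    qed (use g1 g1' g2 g3 in auto)
    then show ?thesis by blast
  next
    case 3
    have ye: "?y \<in> events M" using pq(1)[OF 3(1)] by simp
    obtain w where w: "w \<in> events M" "W w \<and> par ?y w" "\<And>v. v \<in> events M \<Longrightarrow> W v \<and> par ?y v \<Longrightarrow> snd v \<le> snd w"
      using max_event[of "\<lambda>w. W w \<and> par ?y w"] wit[OF 3(1)] pq(2) by blast
    let ?e = "e(Suc K := ?y)" and ?f = "f(Suc K := w)"
    have link: "f K \<preceq> ?y \<and> e K \<preceq> w" if K: "1 \<le> K"
    proof -
      have eK: "Y (e K)" "snd (e K) \<le> n" "W (f K)" "par (e K) (f K)" "\<And>g. W g \<Longrightarrow> par (e K) g \<Longrightarrow> snd g \<le> snd (f K)"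
        using g1[of K] K by auto
      have ev: "e K \<in> events M" "fst (e K) = p" "f K \<in> events M" "fst (f K) = q" "fst w = q"
        using pq eK w by auto
      have le: "e K \<preceq> ?y" using same_proc_le[OF ev(1) ye] ev eK by simp
      then have "\<not> ?y \<preceq> f K" using eK(4) cle_trans unfolding par_def by blast
      then have fy: "f K \<preceq> ?y" using 3(2) K unfolding par_def by blast
      have nw: "\<not> w \<preceq> ?y" using w(2) unfolding par_def by blast
      then have "\<not> w \<preceq> f K" using fy cle_trans by blast
      then have "\<not> snd w \<le> snd (f K)" using same_proc_le[OF w(1) ev(3)] ev by auto
      then have "\<not> par (e K) w" using eK(5)[of w] w(2) by blast
      moreover have "\<not> w \<preceq> e K" using nw le cle_trans by blast
      ultimately show ?thesis using fy unfolding par_def by blast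
    qed
    have "greedy Y W (Suc n) (Suc K) ?e ?f"
      unfolding greedy_def
    proof (intro conjI allI impI)
      fix i :: nat assume i: "1 \<le> i" "i \<le> Suc K"
      show "Y (?e i)" "snd (?e i) \<le> Suc n" "W (?f i)" "par (?e i) (?f i)"
        using i g1[of i] 3(1) w by (cases "i = Suc K"; simp add: le_SucI)+
      fix g assume "W g" "par (?e i) g"
      then show "snd g \<le> snd (?f i)" using i g1[of i] w(3)[of g] pq(2)[of g] by (cases "i = Suc K") simp_all
    next
      fix i j assume ij: "1 \<le> i" "i < j" "j \<le> Suc K"
      then show "snd (?e i) < snd (?e j)" using g2[of i j] g1[of i] by (cases "j = Suc K") auto
    next
      fix i assume i: "1 \<le> i" "i < Suc K"
      show "?f i \<preceq> ?e (Suc i)" "?e i \<preceq> ?f (Suc i)"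
        using i g3[of i] link by (cases "i = K"; simp)+
    next
      fix y assume y: "Y y" "snd y \<le> Suc n"
      show "\<exists>i. 1 \<le> i \<and> i \<le> Suc K \<and> snd (?e i) \<le> snd y \<and> (i < Suc K \<longrightarrow> snd y < snd (?e (Suc i))) \<and> par y (?f i)"
      proof (cases "snd y \<le> n")
        case True
        obtain i where "1 \<le> i" "i \<le> K" "snd (e i) \<le> snd y" "i < K \<longrightarrow> snd y < snd (e (Suc i))" "par y (f i)"
          using g4[OF y(1) True] by blast
        then show ?thesis using True by (intro exI[of _ i]) auto
      next
        case False
        then have "y = ?y" using new y by blast
        then show ?thesis using w by (intro exI[of _ "Suc K"]) auto
      qed
    qed
    then show ?thesis by blast
  qed
qed

text \<open>Group \<open>i\<close> gets a colour different from that of \<open>i - 1\<close> and,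
  for each \<open>w\<close>, from those of the \<open>F\<close>-event visible at the end of the
  group, of the \<open>F\<close>-event before that one, and of the group start visible at
  \<open>f i\<close>. This accounts for the \<open>1 + 3 * card Ws\<close> constraints.\<close>

lemma parallel_complete:
  assumes pq: "\<And>e. Y e \<Longrightarrow> e \<in> events M \<and> fst e = p" "\<And>f. W f \<Longrightarrow> f \<in> events M \<and> fst f = q" "p \<noteq> q"
    and wit: "\<And>y. Y y \<Longrightarrow> \<exists>f. W f \<and> par y f"
    and Ws: "finite Ws" "1 + 3 * card Ws \<le> D"
  shows "parallel_cert M Ws D Y W"
proof -
  obtain K e f where g: "greedy Y W (length (word M p)) K e f" using greedy_exists[OF pq(1,2) wit] by blast
  have lenp: "snd y \<le> length (word M p)" if "Y y" for y using pq(1)[OF that] by (auto simp: event_iff)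
  note g1 = g[unfolded greedy_def, THEN conjunct1, rule_format]
    and e_less = g[unfolded greedy_def, THEN conjunct2, THEN conjunct1, rule_format]
    and g3 = g[unfolded greedy_def, THEN conjunct2, THEN conjunct2, THEN conjunct1, rule_format]
    and g4 = g[unfolded greedy_def, THEN conjunct2, THEN conjunct2, THEN conjunct2, rule_format]
  have e: "Y (e i)" "e i \<in> events M" "fst (e i) = p" and f: "W (f i)" "f i \<in> events M" "fst (f i) = q"
    and par: "\<not> e i \<preceq> f i" "\<not> f i \<preceq> e i" if "1 \<le> i" "i \<le> K" for i
    using g1[OF that] pq(1)[of "e i"] pq(2)[of "f i"] unfolding par_def by auto
  have e_mono: "snd (e i) \<le> snd (e j)" if "1 \<le> i" "i \<le> j" "j \<le> K" for i j
    using e_less[of i j] that by (cases "i = j") auto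
  have e_le: "e i \<preceq> e j" if "1 \<le> i" "i \<le> j" "j \<le> K" for i j
    using same_proc_le[of "e i" "e j"] e_mono[OF that] e[of i] e[of j] that by simp
  have f_step: "snd (f i) < snd (f (Suc i))" if "1 \<le> i" "i < K" for i
  proof -
    have a: "f i \<preceq> e (Suc i)" "\<not> f (Suc i) \<preceq> e (Suc i)" using g3[of i] par[of "Suc i"] that by auto
    then have "\<not> f (Suc i) \<preceq> f i" using cle_trans by blast
    then have "\<not> snd (f (Suc i)) \<le> snd (f i)"
      using same_proc_le[of "f (Suc i)" "f i"] f[of i] f[of "Suc i"] that by auto
    then show ?thesis by simp
  qed
  have f_less: "snd (f i) < snd (f j)" if "1 \<le> i" "i < j" "j \<le> K" for i j
    using that
  proof (induction j)
    case (Suc j)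
    then show ?case using f_step[of j] by (cases "i = j") auto
  qed simp
  have f_mono: "snd (f i) \<le> snd (f j)" if "1 \<le> i" "i \<le> j" "j \<le> K" for i j
    using f_less[of i j] that by (cases "i = j") auto
  have f_le: "f i \<preceq> f j" if "1 \<le> i" "i \<le> j" "j \<le> K" for i j
    using same_proc_le[of "f i" "f j"] f_mono[OF that] f[of i] f[of j] that by simp
  have f_inj: "i = j" if "f i = f j" "1 \<le> i" "i \<le> K" "1 \<le> j" "j \<le> K" for i j
    using f_less[of i j] f_less[of j i] that by (metis linorder_neqE_nat less_irrefl)
  have e_inj: "i = j" if "e i = e j" "1 \<le> i" "i \<le> K" "1 \<le> j" "j \<le> K" for i j
    using e_less[of i j] e_less[of j i] that by (metis linorder_neqE_nat less_irrefl)
  define F where "F x \<longleftrightarrow> (\<exists>i. 1 \<le> i \<and> i \<le> K \<and> x = f i)" for x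
  define E where "E x \<longleftrightarrow> (\<exists>i. 1 \<le> i \<and> i \<le> K \<and> x = e i)" for x
  \<comment> \<open>\<open>y\<close> lies in group \<open>i\<close>: the \<open>Y\<close>-events
    from \<open>e i\<close> up to, but not including, \<open>e (Suc i)\<close>, with common witness
    \<open>f i\<close>.\<close>
  define isg where "isg y i \<longleftrightarrow> 1 \<le> i \<and> i \<le> K \<and> snd (e i) \<le> snd y \<and> (i < K \<longrightarrow> snd y < snd (e (Suc i))) \<and> par y (f i)" for y i
  have isg_mono: "i \<le> j" if "isg y i" "isg y' j" "snd y \<le> snd y'" for y y' i j
  proof (rule ccontr)
    assume "\<not> i \<le> j"
    then have "snd (e (Suc j)) \<le> snd (e i)" "j < K" using e_mono[of "Suc j" i] that unfolding isg_def by auto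
    then show False using that unfolding isg_def by simp
  qed
  have "\<exists>i. isg y i" if "Y y" for y using g4[OF that lenp[OF that]] unfolding isg_def by blast
  then obtain gi where gi: "\<And>y. Y y \<Longrightarrow> isg y (gi y)" by metis
  have gi_mono: "gi y \<le> gi y'" if "Y y" "Y y'" "snd y \<le> snd y'" for y y'
    using isg_mono[OF gi[OF that(1)] gi[OF that(2)] that(3)] .
  have gi_e: "gi (e i) = i" if i: "1 \<le> i" "i \<le> K" for i
  proof -
    have "isg (e i) i" unfolding isg_def par_def using i e_less[of i "Suc i"] par[OF i] by auto
    then show ?thesis using isg_mono[of "e i" i "e i" "gi (e i)"] isg_mono[of "e i" "gi (e i)" "e i" i] gi e[OF i] by simp
  qed
  have gi_rng: "1 \<le> gi y" "gi y \<le> K" "snd (e (gi y)) \<le> snd y" "\<not> y \<preceq> f (gi y)" "\<not> f (gi y) \<preceq> y" if "Y y" for y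
    using gi[OF that] unfolding isg_def par_def by auto
  have "\<exists>z. 1 \<le> i \<longrightarrow> i \<le> K \<longrightarrow> Y z \<and> gi z = i \<and> (\<forall>v. Y v \<longrightarrow> gi v = i \<longrightarrow> snd v \<le> snd z)" for i
  proof (cases "1 \<le> i \<and> i \<le> K")
    case True
    obtain z where "z \<in> events M" "Y z \<and> gi z = i" "\<And>v. v \<in> events M \<Longrightarrow> Y v \<and> gi v = i \<Longrightarrow> snd v \<le> snd z"
      using max_event[of "\<lambda>z. Y z \<and> gi z = i"] e[of i] gi_e[of i] True by blast
    then show ?thesis using pq(1) by blast
  qed blast
  then obtain l where l: "\<And>i. 1 \<le> i \<Longrightarrow> i \<le> K \<Longrightarrow> Y (l i) \<and> gi (l i) = i \<and> (\<forall>v. Y v \<longrightarrow> gi v = i \<longrightarrow> snd v \<le> snd (l i))"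
    by metis
  define jF where "jF i w = (SOME j. 1 \<le> j \<and> j \<le> K \<and> lv M F w (l i) (f j))" for i w
  define jE where "jE i w = (SOME j. 1 \<le> j \<and> j \<le> K \<and> lv M E w (f i) (e j))" for i w
  have jF: "jF i w = j" if "1 \<le> j" "j \<le> K" "lv M F w (l i) (f j)" for i w j
    unfolding jF_def
  proof (rule some_equality)
    show "j' = j" if "1 \<le> j' \<and> j' \<le> K \<and> lv M F w (l i) (f j')" for j'
      using f_inj[of j' j] lv_unique that \<open>1 \<le> j\<close> \<open>j \<le> K\<close> \<open>lv M F w (l i) (f j)\<close> by blast
  qed (use that in blast)
  have jE: "jE i w = j" if "1 \<le> j" "j \<le> K" "lv M E w (f i) (e j)" for i w j
    unfolding jE_def
  proof (rule some_equality)
    show "j' = j" if "1 \<le> j' \<and> j' \<le> K \<and> lv M E w (f i) (e j')" for j'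
      using e_inj[of j' j] lv_unique that \<open>1 \<le> j\<close> \<open>j \<le> K\<close> \<open>lv M E w (f i) (e j)\<close> by blast
  qed (use that in blast)
  define \<phi> where "\<phi> i wk = (if snd wk = (0 :: nat) then jF i (fst wk) else if snd wk = 1 then jF i (fst wk) - 1 else jE i (fst wk))" for i wk
  \<comment> \<open>Only smaller indices matter: an \<open>F\<close>-event below \<open>l i\<close>,
    or a group start below \<open>f i\<close>, has index less than \<open>i\<close>, since
    \<open>f i\<close> is parallel to \<open>e i\<close> and \<open>l i\<close>. The cut also makes
    \<open>H 1\<close> empty.\<close>
  define H where "H i = insert (i - 1) (\<phi> i ` (Ws \<times> {..<3})) \<inter> {1..<i}" for i
  have fin: "finite (insert (i - 1) (\<phi> i ` (Ws \<times> {..<3})))" for i using Ws(1) by simp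
  have "card (H i) \<le> D" for i
  proof -
    have "card (H i) \<le> card (insert (i - 1) (\<phi> i ` (Ws \<times> {..<3})))"
      unfolding H_def by (rule card_mono[OF fin]) blast
    also have "\<dots> \<le> Suc (card (\<phi> i ` (Ws \<times> {..<3})))" using fin by (simp add: card_insert_if)
    also have "\<dots> \<le> Suc (card (Ws \<times> {..<3::nat}))" using card_image_le[of "Ws \<times> {..<3}" "\<phi> i"] Ws(1) by simp
    also have "\<dots> \<le> D" using Ws(2) by (simp add: card_cartesian_product)
    finally show ?thesis .
  qed
  moreover have "finite (H i)" "H i \<subseteq> {..<i}" for i unfolding H_def by auto
  ultimately obtain \<kappa> :: "nat \<Rightarrow> nat" where
    \<kappa>: "\<forall>i<Suc K. \<kappa> i \<le> D \<and> (\<forall>h\<in>H i. \<kappa> h \<noteq> \<kappa> i) \<and> (H i = {} \<longrightarrow> \<kappa> i = 0)"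
    using greedy_colouring[of H D "Suc K"] by blast
  have kD: "\<kappa> i \<le> D" if "i \<le> K" for i using \<kappa> that by simp
  have kH: "\<kappa> h \<noteq> \<kappa> i" if "h \<in> H i" "i \<le> K" for h i using \<kappa> that by simp
  have k1: "\<kappa> 1 = 0" if "1 \<le> K" using \<kappa> that unfolding H_def by simp
  have k_prev: "\<kappa> (i - 1) \<noteq> \<kappa> i" if "2 \<le> i" "i \<le> K" for i
    by (rule kH) (use that in \<open>auto simp: H_def\<close>)
  have k_lvF: "\<kappa> j \<noteq> \<kappa> i" "2 \<le> j \<Longrightarrow> \<kappa> (j - 1) \<noteq> \<kappa> i"
    if "w \<in> Ws" "lv M F w (l i) (f j)" "1 \<le> j" "j < i" "i \<le> K" for i j w
  proof -
    have "jF i w = j" using jF that by simp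
    then have "\<phi> i (w, 0) = j" "\<phi> i (w, 1) = j - 1" unfolding \<phi>_def by auto
    moreover have "\<phi> i (w, 0) \<in> \<phi> i ` (Ws \<times> {..<3})" "\<phi> i (w, 1) \<in> \<phi> i ` (Ws \<times> {..<3})" using that(1) by auto
    ultimately have m: "j \<in> \<phi> i ` (Ws \<times> {..<3})" "j - 1 \<in> \<phi> i ` (Ws \<times> {..<3})" by metis+
    show "\<kappa> j \<noteq> \<kappa> i" by (rule kH) (use m that in \<open>auto simp: H_def\<close>)
    show "\<kappa> (j - 1) \<noteq> \<kappa> i" if "2 \<le> j"
      by (rule kH) (use m that \<open>j < i\<close> \<open>i \<le> K\<close> in \<open>auto simp: H_def\<close>)
  qed
  have k_lvE: "\<kappa> j \<noteq> \<kappa> i" if "w \<in> Ws" "lv M E w (f i) (e j)" "1 \<le> j" "j < i" "i \<le> K" for i j w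
  proof -
    have "jE i w = j" using jE that by simp
    then have "\<phi> i (w, 2) = j" unfolding \<phi>_def by auto
    moreover have "\<phi> i (w, 2) \<in> \<phi> i ` (Ws \<times> {..<3})" using that(1) by auto
    ultimately have m: "j \<in> \<phi> i ` (Ws \<times> {..<3})" by metis
    show "\<kappa> j \<noteq> \<kappa> i" by (rule kH) (use m that in \<open>auto simp: H_def\<close>)
  qed
  define idx where "idx x = (SOME i. 1 \<le> i \<and> i \<le> K \<and> x = f i)" for x
  have idx: "idx (f i) = i" if "1 \<le> i" "i \<le> K" for i
    unfolding idx_def by (rule some_equality) (use that f_inj[of _ i] in auto)
  define col where "col x = (if Y x then \<kappa> (gi x) else if F x then \<kappa> (idx x) else 0)" for x
  have colY: "col y = \<kappa> (gi y)" if "Y y" for y using that by (simp add: col_def)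
  have colf: "col (f i) = \<kappa> i" if i: "1 \<le> i" "i \<le> K" for i
  proof -
    have "\<not> Y (f i)" using pq(1)[of "f i"] f[OF i] pq(3) by auto
    moreover have "F (f i)" using i unfolding F_def by blast
    ultimately show ?thesis using idx[OF i] by (simp add: col_def)
  qed
  have colD: "col x \<le> D" for x
  proof -
    have "Y x \<Longrightarrow> col x \<le> D" using colY[of x] kD[of "gi x"] gi_rng(2)[of x] by simp
    moreover have "F x \<Longrightarrow> \<not> Y x \<Longrightarrow> col x \<le> D" using colf kD unfolding F_def by auto
    ultimately show ?thesis unfolding col_def by auto
  qed
  have prevF: "2 \<le> i \<and> u = f (i - 1)" if "prevp M F (f i) u" "1 \<le> i" "i \<le> K" for i u
  proof -
    have "F u" "snd u < snd (f i)" using that(1) unfolding prevp_def by auto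
    then obtain j where j: "1 \<le> j" "j \<le> K" "u = f j" unfolding F_def by blast
    have ji: "j < i" using f_mono[of i j] \<open>snd u < snd (f i)\<close> j that by (metis leD not_le_imp_less)
    have "F (f (i - 1))" using that ji j unfolding F_def by (intro exI[of _ "i - 1"]) auto
    moreover have "snd (f (i - 1)) < snd (f i)" using f_less[of "i - 1" i] ji j that by simp
    moreover have "f (i - 1) \<in> events M" "fst (f (i - 1)) = fst (f i)" using f[of "i - 1"] f[of i] ji j that by auto
    ultimately have "snd (f (i - 1)) \<le> snd (f j)" using that(1) j unfolding prevp_def by blast
    then have "i - 1 \<le> j" using f_less[of j "i - 1"] j that by (metis leD not_le_imp_less diff_le_self le_trans)
    then have "j = i - 1" using ji by simp
    then show ?thesis using j ji by simp
  qed
  have succF: "succp M F (f i) (f (Suc i))" if "1 \<le> i" "i < K" for i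
    unfolding succp_def
  proof (intro conjI ballI impI)
    show "f (Suc i) \<in> events M" "fst (f (Suc i)) = fst (f i)" using f[of i] f[of "Suc i"] that by auto
    show "snd (f i) < snd (f (Suc i))" using f_step that by simp
    show "F (f (Suc i))" unfolding F_def using that by (intro exI[of _ "Suc i"]) simp
    fix v assume v: "v \<in> events M" "fst v = fst (f i)" "snd (f i) < snd v" "F v"
    then obtain j where j: "1 \<le> j" "j \<le> K" "v = f j" unfolding F_def by blast
    have "i < j" using f_mono[of j i] v(3) j that by (metis leD not_le_imp_less less_imp_le_nat)
    then show "snd (f (Suc i)) \<le> snd v" using f_mono[of "Suc i" j] j by simp
  qed
  \<comment> \<open>Every group contains its start \<open>e i\<close>, so between successive
    \<open>Y\<close>-events the group number grows by at most one, and only at a group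
    start.\<close>
  have change: "2 \<le> gi x \<and> x = e (gi x) \<and> gi u = gi x - 1" if u: "prevp M Y x u" and x: "Y x" and ne: "gi u \<noteq> gi x" for x u
  proof -
    have ue: "Y u" "snd u < snd x" "fst u = fst x" using u unfolding prevp_def by auto
    have lt: "gi u < gi x" using gi_mono[OF ue(1) x] ue(2) ne by simp
    then have g2: "2 \<le> gi x" using gi_rng(1)[OF ue(1)] by simp
    have eg: "Y (e (gi x))" "e (gi x) \<in> events M" "fst (e (gi x)) = p" using e gi_rng(1,2)[OF x] by auto
    have "snd (e (gi x)) = snd x"
    proof (rule ccontr)
      assume "snd (e (gi x)) \<noteq> snd x"
      then have "snd (e (gi x)) < snd x" using gi_rng(3)[OF x] by simp
      then have "snd (e (gi x)) \<le> snd u" using u eg pq(1)[OF x] unfolding prevp_def by auto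
      then have "gi (e (gi x)) \<le> gi u" using gi_mono eg ue by blast
      then show False using gi_e gi_rng[OF x] lt by simp
    qed
    then have xe: "x = e (gi x)" using eg pq(1)[OF x] by (simp add: prod_eq_iff)
    have e1: "Y (e (gi x - 1))" "e (gi x - 1) \<in> events M" "fst (e (gi x - 1)) = p" using e[of "gi x - 1"] g2 gi_rng(2)[OF x] by auto
    have "snd (e (gi x - 1)) < snd (e (gi x))" using e_less[of "gi x - 1" "gi x"] g2 gi_rng(2)[OF x] by simp
    then have "snd (e (gi x - 1)) < snd x" using xe by simp
    then have "snd (e (gi x - 1)) \<le> snd u" using u e1 pq(1)[OF x] unfolding prevp_def by auto
    then have "gi (e (gi x - 1)) \<le> gi u" using gi_mono e1 ue by blast
    then have "gi x - 1 \<le> gi u" using gi_e[of "gi x - 1"] g2 gi_rng(2)[OF x] by simp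
    then show ?thesis using lt g2 xe by simp
  qed
  have prevE: "gi u < gi x" if Ex: "E x" and u: "prevp M Y x u" for x u
  proof -
    obtain i where i: "1 \<le> i" "i \<le> K" "x = e i" using Ex unfolding E_def by blast
    have ue: "Y u" "snd u < snd x" using u unfolding prevp_def by auto
    have "\<not> i \<le> gi u" using gi_rng(3)[OF ue(1)] gi_rng(2)[OF ue(1)] e_mono[of i "gi u"] i ue by auto
    then show "gi u < gi x" using gi_e i by simp
  qed
  \<comment> \<open>Successive groups have different colours, so the runs of the colouring are
    exactly the groups.\<close>
  have RF: "run_first M D Y col = E"
  proof
    fix x
    show "run_first M D Y col x = E x"
    proof
      assume r: "run_first M D Y col x"
      then have Yx: "Y x" by (simp add: run_first_def)
      have nocol: "col u \<noteq> col x" if "prevp M Y x u" for u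
        using r that colD[of x] unfolding run_first_def by auto
      show "E x"
      proof (cases "x = e (gi x)")
        case True then show ?thesis unfolding E_def using gi_rng[OF Yx] by blast
      next
        case False
        have eg: "Y (e (gi x))" "e (gi x) \<in> events M" "fst (e (gi x)) = p" using e gi_rng(1,2)[OF Yx] by auto
        have "snd (e (gi x)) \<noteq> snd x" using False eg pq(1)[OF Yx] by (auto simp: prod_eq_iff)
        then have "snd (e (gi x)) < snd x" using gi_rng(3)[OF Yx] by simp
        then obtain u where u: "prevp M Y x u" using prevp_exists[of "e (gi x)" x Y] eg pq(1)[OF Yx] by auto
        then have "Y u" unfolding prevp_def by simp
        then have "gi u \<noteq> gi x" using nocol[OF u] colY Yx by auto
        then show ?thesis using change[OF u Yx] False by blast
      qed
    next
      assume Ex: "E x"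
      then obtain i where i: "1 \<le> i" "i \<le> K" "x = e i" unfolding E_def by blast
      have Yx: "Y x" using e i by simp
      have "col u \<noteq> col x" if u: "prevp M Y x u" for u
      proof -
        have Yu: "Y u" using u unfolding prevp_def by simp
        have ch: "2 \<le> gi x" "gi u = gi x - 1" using change[OF u Yx] prevE[OF Ex u] by auto
        then show ?thesis using k_prev[OF ch(1) gi_rng(2)[OF Yx]] colY Yx Yu by simp
      qed
      then show "run_first M D Y col x" unfolding run_first_def using Yx by auto
    qed
  qed
  have c1: "\<forall>x\<in>events M. F x \<longrightarrow> W x" using f unfolding F_def by blast
  have c2: "(\<exists>x\<in>events M. F x) \<or> (\<forall>x\<in>events M. \<not> Y x)"
  proof (cases "\<exists>x\<in>events M. Y x")
    case True
    then obtain x where "Y x" by blast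
    then have "f (gi x) \<in> events M" "F (f (gi x))" using f gi_rng(1,2) unfolding F_def by blast+
    then show ?thesis by blast
  qed blast
  have c3: "col x = 0" if x: "F x" "\<not> (\<exists>u. prevp M F x u)" for x
  proof -
    obtain i where i: "1 \<le> i" "i \<le> K" "x = f i" using x(1) unfolding F_def by blast
    have "i = 1"
    proof (rule ccontr)
      assume "i \<noteq> 1"
      then have "snd (f 1) < snd x" using f_less[of 1 i] i by simp
      moreover have "f 1 \<in> events M" "fst (f 1) = fst x" "F (f 1)" using f[of 1] f[of i] i unfolding F_def by auto
      ultimately have "\<exists>u. prevp M F x u" using prevp_exists[where U = F] by blast
      then show False using x(2) by blast
    qed
    then show ?thesis using colf[of i] i k1 by simp
  qed
  have c4: "col x = 0" if x: "Y x" "\<not> (\<exists>u. prevp M Y x u)" for x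
  proof -
    have e1: "Y (e 1)" "e 1 \<in> events M" "fst (e 1) = p" using e[of 1] gi_rng[OF x(1)] by auto
    have "\<not> snd (e 1) < snd x" using prevp_exists[of "e 1" x Y] x e1 pq(1)[OF x(1)] by auto
    moreover have "snd (e 1) \<le> snd (e (gi x))" using e_mono[of 1 "gi x"] gi_rng[OF x(1)] by simp
    ultimately have "snd x \<le> snd (e 1)" "gi x \<le> gi (e 1)" using gi_mono[OF x(1) e1(1)] by auto
    then have "gi x = 1" using gi_rng[OF x(1)] gi_e[of 1] by simp
    then show ?thesis using colY[OF x(1)] k1 gi_rng[OF x(1)] by simp
  qed
  have c5: "col u \<noteq> col x" if x: "F x" "prevp M F x u" for x u
  proof -
    obtain i where i: "1 \<le> i" "i \<le> K" "x = f i" using x(1) unfolding F_def by blast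
    have "2 \<le> i" "u = f (i - 1)" using prevF[of i u] x i by auto
    then show ?thesis using colf[of i] colf[of "i - 1"] k_prev[of i] i by simp
  qed
  \<comment> \<open>The token of \<open>e i\<close> starts at \<open>f (i - 1)\<close>. Were the
    origin \<open>f (gi y - 1)\<close> of a later target below \<open>x\<close>, then so would be
    \<open>f (gi x)\<close>, which is parallel to \<open>x\<close>.\<close>
  have c6: "link M (\<lambda>x. F x \<and> col x = c \<and> (\<exists>u. succp M F x u \<and> col u = d))
        (\<lambda>x. Y x \<and> col x = d \<and> (\<exists>u. prevp M Y x u \<and> col u = c))" if cd: "c \<noteq> d" for c d
  proof (rule link_complete_proc[of _ "\<lambda>x. f (gi x - 1)" _ p])
    have tgt: "2 \<le> gi x \<and> gi x \<le> K \<and> x = e (gi x) \<and> \<kappa> (gi x) = d \<and> \<kappa> (gi x - 1) = c"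
      if x: "Y x \<and> col x = d \<and> (\<exists>u. prevp M Y x u \<and> col u = c)" for x
    proof -
      obtain u where u: "prevp M Y x u" "col u = c" using x by blast
      have Yu: "Y u" and Yx: "Y x" and cx: "col x = d" using u x unfolding prevp_def by auto
      have "gi u \<noteq> gi x" using colY[OF Yu] colY[OF Yx] u cx cd by auto
      note ch = change[OF u(1) Yx this]
      have "\<kappa> (gi x) = d" using colY[OF Yx] cx by simp
      moreover have "\<kappa> (gi x - 1) = c" using colY[OF Yu] u(2) ch by simp
      ultimately show ?thesis using ch gi_rng(2)[OF Yx] by blast
    qed
    {
      fix x assume "x \<in> events M" and x: "Y x \<and> col x = d \<and> (\<exists>u. prevp M Y x u \<and> col u = c)"
      let ?i = "gi x - 1"
      note g = tgt[OF x]
      have i: "1 \<le> ?i" "?i < K" "Suc ?i = gi x" using g by auto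
      have "succp M F (f ?i) (f (gi x))" using succF[OF i(1,2)] i(3) by simp
      moreover have "col (f (gi x)) = d" "col (f ?i) = c" using colf[of "gi x"] colf[of ?i] g i by auto
      moreover have "F (f ?i)" "f ?i \<in> events M" using i f[of ?i] unfolding F_def by auto
      moreover have "f ?i \<preceq> x" using g3[OF i(1,2)] i(3) g by simp
      ultimately show "f ?i \<in> events M \<and> (F (f ?i) \<and> col (f ?i) = c \<and> (\<exists>u. succp M F (f ?i) u \<and> col u = d)) \<and> f ?i \<preceq> x"
        by blast
    next
      fix x y assume x: "Y x \<and> col x = d \<and> (\<exists>u. prevp M Y x u \<and> col u = c)"
        and y: "Y y \<and> col y = d \<and> (\<exists>u. prevp M Y y u \<and> col u = c)" and lt: "snd x < snd y"
      note gx = tgt[OF x] and gy = tgt[OF y]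
      have "\<not> gi y \<le> gi x" using e_mono[of "gi y" "gi x"] gx gy lt by auto
      then have "1 \<le> gi x" "gi x \<le> gi y - 1" "gi y - 1 \<le> K" using gx gy by linarith+
      then have "f (gi x) \<preceq> f (gi y - 1)" by (rule f_le)
      moreover have "\<not> f (gi x) \<preceq> x" using gi_rng(5) x by blast
      ultimately show "\<not> f (gi y - 1) \<preceq> x" using cle_trans by blast
    }
  qed (use pq(1) in blast)
  have c7: "link M E (\<lambda>x. F x \<and> (\<exists>u. prevp M F x u))"
  proof (rule link_complete_proc[of _ "\<lambda>x. e (idx x - 1)" _ q])
    have tgt: "2 \<le> idx x \<and> idx x \<le> K \<and> x = f (idx x)" if x: "F x \<and> (\<exists>u. prevp M F x u)" for x
    proof -
      obtain u where u: "prevp M F x u" using x by blast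
      obtain i where "1 \<le> i" "i \<le> K" "x = f i" using x unfolding F_def by blast
      with u show ?thesis using prevF[of i u] idx[of i] by auto
    qed
    {
      fix x assume "x \<in> events M" and x: "F x \<and> (\<exists>u. prevp M F x u)"
      let ?i = "idx x - 1"
      note g = tgt[OF x]
      have i: "1 \<le> ?i" "?i < K" "Suc ?i = idx x" using g by auto
      have "e ?i \<preceq> x" using g3[OF i(1,2)] i(3) g by simp
      moreover have "E (e ?i)" "e ?i \<in> events M" using i e[of ?i] unfolding E_def by auto
      ultimately show "e ?i \<in> events M \<and> E (e ?i) \<and> e ?i \<preceq> x" by blast
    next
      fix x y assume x: "F x \<and> (\<exists>u. prevp M F x u)" and y: "F y \<and> (\<exists>u. prevp M F y u)" and lt: "snd x < snd y"
      note gx = tgt[OF x] and gy = tgt[OF y]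
      have "\<not> idx y \<le> idx x" using f_mono[of "idx y" "idx x"] gx gy lt by auto
      then have "1 \<le> idx x" "idx x \<le> idx y - 1" "idx y - 1 \<le> K" using gx gy by linarith+
      then have "e (idx x) \<preceq> e (idx y - 1)" by (rule e_le)
      moreover have "\<not> e (idx x) \<preceq> x" using par(1)[of "idx x"] gx by simp
      ultimately show "\<not> e (idx y - 1) \<preceq> x" using cle_trans by blast
    }
    show "fst x = q" if "F x \<and> (\<exists>u. prevp M F x u)" for x using f that unfolding F_def by auto
  qed
  \<comment> \<open>Whatever is visible at a run end has a smaller index, because
    \<open>f ?i\<close> is parallel to that end; the constraints in \<open>H\<close> then keep the
    colours apart.\<close>
  have c8: "\<not> (col x = c \<or> (\<exists>u. prevp M F x u \<and> col u = c))"
    if w: "w \<in> Ws" and z: "run_last M D Y col z" "col z = c" and lv: "lv M F w z x" for w z c x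
  proof -
    have Yz: "Y z" using z(1) by (simp add: run_last_def)
    let ?i = "gi z"
    note i = gi_rng(1,2)[OF Yz]
    have zl: "z = l ?i"
    proof (rule ccontr)
      assume ne: "z \<noteq> l ?i"
      have li: "Y (l ?i)" "gi (l ?i) = ?i" "snd z \<le> snd (l ?i)" using l[OF i] Yz by auto
      have "snd z \<noteq> snd (l ?i)" using ne pq(1)[OF Yz] pq(1)[OF li(1)] by (auto simp: prod_eq_iff)
      then have lt: "snd z < snd (l ?i)" using li by simp
      then obtain u where u: "succp M Y z u" using succp_exists[of "l ?i" z Y] li pq(1)[OF Yz] pq(1)[OF li(1)] by auto
      have ue: "Y u" "snd z < snd u" "snd u \<le> snd (l ?i)"
        using u lt li pq(1)[OF Yz] pq(1)[OF li(1)] unfolding succp_def by auto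
      have "gi u = ?i" using gi_mono[OF Yz ue(1)] gi_mono[OF ue(1) li(1)] ue li by simp
      then have "col u = col z" using colY Yz ue by simp
      then show False using z(1) u colD[of z] unfolding run_last_def by auto
    qed
    have "F x" "x \<preceq> z" using lv_le[OF lv] pq(1)[OF Yz] by auto
    then obtain j where j: "1 \<le> j" "j \<le> K" "x = f j" unfolding F_def by blast
    have ji: "j < ?i"
    proof (rule ccontr)
      assume "\<not> j < ?i"
      then have "f ?i \<preceq> x" using f_le[of ?i j] j i by simp
      then show False using \<open>x \<preceq> z\<close> gi_rng(5)[OF Yz] cle_trans by blast
    qed
    have lv': "lv M F w (l ?i) (f j)" using lv zl j by simp
    have "col x \<noteq> c" using k_lvF(1)[OF w lv' j(1) ji i(2)] colf[of j] j colY[OF Yz] z by simp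
    moreover have "col u \<noteq> c" if "prevp M F x u" for u
    proof -
      have "2 \<le> j" "u = f (j - 1)" using prevF[of j u] that j by auto
      then show ?thesis using k_lvF(2)[OF w lv' j(1) ji i(2)] colf[of "j - 1"] j colY[OF Yz] z by simp
    qed
    ultimately show ?thesis by blast
  qed
  have c9: "col x \<noteq> c" if w: "w \<in> Ws" and z: "F z" "col z = c" and lv: "lv M E w z x" for w z c x
  proof -
    obtain i where i: "1 \<le> i" "i \<le> K" "z = f i" using z unfolding F_def by blast
    have "E x" "x \<preceq> z" using lv_le[OF lv] f i by auto
    then obtain j where j: "1 \<le> j" "j \<le> K" "x = e j" unfolding E_def by blast
    have ji: "j < i"
    proof (rule ccontr)
      assume "\<not> j < i"
      then have "e i \<preceq> x" using e_le[of i j] j i by simp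
      then show False using \<open>x \<preceq> z\<close> par(1)[of i] i cle_trans by blast
    qed
    have "lv M E w (f i) (e j)" using lv i j by simp
    then have "\<kappa> j \<noteq> \<kappa> i" using k_lvE[OF w _ j(1) ji i(2)] by blast
    then show ?thesis using colf[of i] colY[of x] e[of j] gi_e[of j] i j z by simp
  qed
  have d3: "\<forall>x\<in>events M. F x \<longrightarrow> \<not> (\<exists>u. prevp M F x u) \<longrightarrow> col x = 0" using c3 by blast
  have d4: "\<forall>x\<in>events M. Y x \<longrightarrow> \<not> (\<exists>u. prevp M Y x u) \<longrightarrow> col x = 0" using c4 by blast
  have d5: "\<forall>c\<in>{..D}. \<forall>x\<in>events M. F x \<longrightarrow> col x = c \<longrightarrow> \<not> (\<exists>u. prevp M F x u \<and> col u = c)"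
    using c5 by metis
  have d6: "\<forall>c\<in>{..D}. \<forall>d\<in>{..D} - {c}. link M (\<lambda>x. F x \<and> col x = c \<and> (\<exists>u. succp M F x u \<and> col u = d))
        (\<lambda>x. Y x \<and> col x = d \<and> (\<exists>u. prevp M Y x u \<and> col u = c))"
  proof (intro ballI)
    fix c d assume "d \<in> {..D} - {c}"
    then have "c \<noteq> d" by blast
    then show "link M (\<lambda>x. F x \<and> col x = c \<and> (\<exists>u. succp M F x u \<and> col u = d))
        (\<lambda>x. Y x \<and> col x = d \<and> (\<exists>u. prevp M Y x u \<and> col u = c))" by (rule c6)
  qed
  have d8: "\<forall>w\<in>Ws. \<forall>c\<in>{..D}. \<forall>z\<in>events M. run_last M D Y col z \<longrightarrow> col z = c \<longrightarrow>
        \<not> (\<exists>x. lv M F w z x \<and> (col x = c \<or> (\<exists>u. prevp M F x u \<and> col u = c)))"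
    using c8 by (intro ballI impI notI) (elim exE conjE, metis)
  have d9: "\<forall>w\<in>Ws. \<forall>c\<in>{..D}. \<forall>z\<in>events M. F z \<longrightarrow> col z = c \<longrightarrow> \<not> (\<exists>x. lv M E w z x \<and> col x = c)"
    using c9 by (intro ballI impI notI) (elim exE conjE, metis)
  have "parallel_cond M Ws D Y W F col"
    unfolding parallel_cond_def simp_thms RF
    by (intro conjI c1 c2 d3 d4 d5 d6 c7 d8 d9)
  then show ?thesis
    unfolding parallel_cert_def by (intro exI[of _ "\<lambda>x. (F x, col x)"]) (use colD in auto)
qed

end

section \<open>Relative positions\<close>

text \<open>\<open>Before\<close> and \<open>After\<close> exclude equality and direct edges. So the
  types partition the pairs of events, and every binary atom is a union of types.\<close>

datatype rtype = Same | Next | Prev | Sends | Receives | Before | After | Parallel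

definition rel_type :: "('p, 'a) msc \<Rightarrow> 'p event \<Rightarrow> 'p event \<Rightarrow> rtype" where
  "rel_type M x y =
     (if x = y then Same
      else if (x, y) \<in> proc_rel M then Next
      else if (y, x) \<in> proc_rel M then Prev
      else if (x, y) \<in> msg_rel M then Sends
      else if (y, x) \<in> msg_rel M then Receives
      else if (x, y) \<in> causal_le M then Before
      else if (y, x) \<in> causal_le M then After
      else Parallel)"

fun converse_type :: "rtype \<Rightarrow> rtype" where
  "converse_type Same = Same"
| "converse_type Next = Prev"
| "converse_type Prev = Next"
| "converse_type Sends = Receives"
| "converse_type Receives = Sends"
| "converse_type Before = After"
| "converse_type After = Before"
| "converse_type Parallel = Parallel"

fun holds_in :: "binpred \<Rightarrow> rtype \<Rightarrow> bool" where
  "holds_in Proc_Edge r \<longleftrightarrow> r = Next"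
| "holds_in Msg_Edge r \<longleftrightarrow> r = Sends"
| "holds_in Causal_Le r \<longleftrightarrow> r \<in> {Same, Next, Sends, Before}"

lemma finite_rtype: "finite (UNIV :: rtype set)"
proof (rule finite_subset)
  show "UNIV \<subseteq> {Same, Next, Prev, Sends, Receives, Before, After, Parallel}"
    using rtype.exhaust by blast
qed simp

context msc_loc
begin

lemma step_fst: "(x, y) \<in> step M \<Longrightarrow> (x, y) \<in> proc_rel M \<longleftrightarrow> fst x = fst y"
  using msg_relD(3)[of x y] by (auto simp: step_def proc_rel_iff)

text \<open>An event has at most one process predecessor and at most one sender, and these lie on
  different processes.\<close>

lemma step_source_unique:
  assumes "(d, y) \<in> step M" "(d', y) \<in> step M" "fst d = fst d'"
  shows "d = d'"
proof (cases "fst d = fst y")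
  case True
  then have "(d, y) \<in> proc_rel M" "(d', y) \<in> proc_rel M" using step_fst assms by auto
  then show ?thesis by (simp add: proc_rel_iff prod_eq_iff)
next
  case False
  then have "(d, y) \<in> msg_rel M" "(d', y) \<in> msg_rel M" using assms by (auto simp: step_def proc_rel_iff)
  then show ?thesis by (rule msg_sender_unique)
qed

lemma step_target_unique:
  assumes "(y, d) \<in> step M" "(y, d') \<in> step M" "fst d = fst d'"
  shows "d = d'"
proof (cases "fst y = fst d")
  case True
  then have "(y, d) \<in> proc_rel M" "(y, d') \<in> proc_rel M" using step_fst assms by auto
  then show ?thesis by (rule proc_rel_unique)
next
  case False
  then have "(y, d) \<in> msg_rel M" "(y, d') \<in> msg_rel M" using assms by (auto simp: step_def proc_rel_iff)
  then show ?thesis by (rule msg_receiver_unique)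
qed

text \<open>Acyclicity excludes edges in both directions, and a message edge is never a process
  edge; hence an earlier test of the cascade never hides a later edge relation.\<close>

lemma rel_type_cases:
  "rel_type M x y = Same \<longleftrightarrow> x = y"
  "rel_type M x y = Next \<longleftrightarrow> (x, y) \<in> proc_rel M"
  "rel_type M x y = Prev \<longleftrightarrow> (y, x) \<in> proc_rel M"
  "rel_type M x y = Sends \<longleftrightarrow> (x, y) \<in> msg_rel M"
  "rel_type M x y = Receives \<longleftrightarrow> (y, x) \<in> msg_rel M"
  "rel_type M x y = Before \<longleftrightarrow> x \<preceq> y \<and> x \<noteq> y \<and> (x, y) \<notin> step M"
  "rel_type M x y = After \<longleftrightarrow> y \<preceq> x \<and> x \<noteq> y \<and> (y, x) \<notin> step M"
  "rel_type M x y = Parallel \<longleftrightarrow> \<not> x \<preceq> y \<and> \<not> y \<preceq> x"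
proof -
  have ir: "(x, x) \<notin> step M" for x using step_irrefl[of x x] cle_refl by blast
  have as: "(y, x) \<notin> step M" if "(x, y) \<in> step M" for x y using step_irrefl[OF that] step_cle by blast
  have ex: "(x, y) \<notin> msg_rel M" if "(x, y) \<in> proc_rel M" for x y
    using that msg_relD(3)[of x y] by (auto simp: proc_rel_iff)
  have le: "x \<preceq> y" "\<not> y \<preceq> x" if "(x, y) \<in> step M" for x y using step_irrefl[OF that] step_cle[OF that] by auto
  have cs: "(x, y) \<in> step M \<longleftrightarrow> (x, y) \<in> proc_rel M \<or> (x, y) \<in> msg_rel M" for x y by (simp add: step_def)
  show "rel_type M x y = Same \<longleftrightarrow> x = y" unfolding rel_type_def by simp
  show "rel_type M x y = Next \<longleftrightarrow> (x, y) \<in> proc_rel M"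
    unfolding rel_type_def using ir[of x] cs by auto
  show "rel_type M x y = Prev \<longleftrightarrow> (y, x) \<in> proc_rel M"
    unfolding rel_type_def using ir[of x] as[of x y] cs by auto
  show "rel_type M x y = Sends \<longleftrightarrow> (x, y) \<in> msg_rel M"
    unfolding rel_type_def using ir[of x] as[of x y] cs ex[of x y] by auto
  show "rel_type M x y = Receives \<longleftrightarrow> (y, x) \<in> msg_rel M"
    unfolding rel_type_def using ir[of x] as[of x y] cs ex[of y x] by auto
  show "rel_type M x y = Before \<longleftrightarrow> x \<preceq> y \<and> x \<noteq> y \<and> (x, y) \<notin> step M"
    unfolding rel_type_def using le[of y x] cs[of x y] cs[of y x] by auto
  show "rel_type M x y = After \<longleftrightarrow> y \<preceq> x \<and> x \<noteq> y \<and> (y, x) \<notin> step M"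
    unfolding rel_type_def using le[of x y] cs[of x y] cs[of y x] cle_antisym[of x y] by auto
  show "rel_type M x y = Parallel \<longleftrightarrow> \<not> x \<preceq> y \<and> \<not> y \<preceq> x"
    unfolding rel_type_def using le[of x y] le[of y x] cs[of x y] cs[of y x] by auto
qed

lemma rel_type_converse: "rel_type M y x = converse_type (rel_type M x y)"
proof -
  have "rel_type M x y = r \<Longrightarrow> rel_type M y x = converse_type r" for r
    by (cases r) (auto simp: rel_type_cases)
  then show ?thesis by blast
qed

lemma rel_of_type: "(x, y) \<in> rel_of M r \<longleftrightarrow> holds_in r (rel_type M x y)"
proof (cases r)
  case Causal_Le
  have "x \<preceq> y \<longleftrightarrow> x = y \<or> (x, y) \<in> step M \<or> (x \<preceq> y \<and> x \<noteq> y \<and> (x, y) \<notin> step M)"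
    using step_cle[of x y] by auto
  then show ?thesis using Causal_Le by (auto simp: rel_type_cases step_def)
qed (auto simp: rel_type_cases)

text \<open>
  Among the \<open>W\<close>-events strictly below \<open>y\<close>, all on one process, at most one is a direct predecessor
  of \<open>y\<close>. Hence there is another one iff there are at least two, i.e. one that lies
  strictly above some \<open>W\<close>-event.
\<close>

lemma before_iff:
  assumes W: "\<And>x. W x \<Longrightarrow> fst x = q" and y: "y \<in> events M"
  shows "(\<exists>x\<in>events M. W x \<and> x \<preceq> y \<and> x \<noteq> y \<and> (x, y) \<notin> step M) \<longleftrightarrow>
    (if \<exists>d. (d, y) \<in> step M \<and> W d
     then \<exists>d. (d, y) \<in> step M \<and> up M (\<lambda>e. W e \<and> (\<exists>c. (c, e) \<in> step M \<and> up M W c)) d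
     else \<exists>d. (d, y) \<in> step M \<and> up M W d)"
proof -
  have strict: "(\<exists>c. (c, e) \<in> step M \<and> up M W c) \<longleftrightarrow> (\<exists>x\<in>events M. W x \<and> x \<preceq> e \<and> x \<noteq> e)" for e W
    unfolding up_def using cle_last[of _ e] step_irrefl[of _ e] by blast
  have uniq: "d = d'" if "(d, y) \<in> step M" "W d" "(d', y) \<in> step M" "W d'" for d d'
  proof -
    have "fst d = fst d'" using W that by simp
    then show ?thesis using step_source_unique that by blast
  qed
  have tot: "x \<preceq> x' \<or> x' \<preceq> x" if "x \<in> events M" "W x" "x' \<in> events M" "W x'" for x x'
    using cle_total W that by simp
  show ?thesis
  proof (cases "\<exists>d. (d, y) \<in> step M \<and> W d")
    case True
    then obtain d where d: "(d, y) \<in> step M" "W d" by blast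
    have de: "d \<in> events M" "d \<preceq> y" "d \<noteq> y" using step_events[OF d(1)] step_cle[OF d(1)] step_irrefl[OF d(1)] by auto
    have "(\<exists>x\<in>events M. W x \<and> x \<preceq> y \<and> x \<noteq> y \<and> (x, y) \<notin> step M) \<longleftrightarrow>
       (\<exists>x\<in>events M. (W x \<and> (\<exists>x'\<in>events M. W x' \<and> x' \<preceq> x \<and> x' \<noteq> x)) \<and> x \<preceq> y \<and> x \<noteq> y)" (is "?L = ?R")
    proof
      assume ?L
      then obtain x where x: "x \<in> events M" "W x" "x \<preceq> y" "x \<noteq> y" "(x, y) \<notin> step M" by blast
      have "x \<noteq> d" using x d by blast
      with tot[OF x(1,2) de(1) d(2)] consider "x \<preceq> d" "x \<noteq> d" | "d \<preceq> x" "x \<noteq> d" by blast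
      then show ?R
      proof cases
        case 1 then show ?thesis using x d de by (intro bexI[of _ d]) auto
      next
        case 2 then show ?thesis using x d de by (intro bexI[of _ x]) auto
      qed
    next
      assume ?R
      then obtain x x' where x: "x \<in> events M" "W x" "x \<preceq> y" "x \<noteq> y" "x' \<in> events M" "W x'" "x' \<preceq> x" "x' \<noteq> x" by blast
      have x'y: "x' \<preceq> y" "x' \<noteq> y" using x cle_trans cle_antisym by blast+
      show ?L
      proof (cases "(x, y) \<in> step M")
        case True
        then have "(x', y) \<notin> step M" using uniq x by blast
        then show ?thesis using x x'y by blast
      qed (use x in blast)
    qed
    then show ?thesis using True unfolding strict by simp
  next
    case False
    then show ?thesis unfolding strict by auto
  qed
qed

lemma after_iff:
  assumes W: "\<And>x. W x \<Longrightarrow> fst x = q" and y: "y \<in> events M"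
  shows "(\<exists>x\<in>events M. W x \<and> y \<preceq> x \<and> x \<noteq> y \<and> (y, x) \<notin> step M) \<longleftrightarrow>
    (if \<exists>d. (y, d) \<in> step M \<and> W d
     then \<exists>d. (y, d) \<in> step M \<and> down M (\<lambda>e. W e \<and> (\<exists>c. (e, c) \<in> step M \<and> down M W c)) d
     else \<exists>d. (y, d) \<in> step M \<and> down M W d)"
proof -
  have strict: "(\<exists>c. (e, c) \<in> step M \<and> down M W c) \<longleftrightarrow> (\<exists>x\<in>events M. W x \<and> e \<preceq> x \<and> x \<noteq> e)" for e W
  proof
    assume "\<exists>c. (e, c) \<in> step M \<and> down M W c"
    then obtain c x where x: "(e, c) \<in> step M" "x \<in> events M" "W x" "c \<preceq> x" unfolding down_def by blast
    have "e \<preceq> x" using step_cle[OF x(1)] x(4) by (rule cle_trans)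
    moreover have "x \<noteq> e" using step_irrefl[OF x(1)] x(4) by blast
    ultimately show "\<exists>x\<in>events M. W x \<and> e \<preceq> x \<and> x \<noteq> e" using x by blast
  next
    assume "\<exists>x\<in>events M. W x \<and> e \<preceq> x \<and> x \<noteq> e"
    then obtain x where x: "x \<in> events M" "W x" "e \<preceq> x" "x \<noteq> e" by blast
    then obtain c where "(e, c) \<in> step M" "c \<preceq> x" using cle_first[of e x] by blast
    then show "\<exists>c. (e, c) \<in> step M \<and> down M W c" unfolding down_def using x by blast
  qed
  have uniq: "d = d'" if "(y, d) \<in> step M" "W d" "(y, d') \<in> step M" "W d'" for d d'
  proof -
    have "fst d = fst d'" using W that by simp
    then show ?thesis using step_target_unique that by blast
  qed
  have tot: "x \<preceq> x' \<or> x' \<preceq> x" if "x \<in> events M" "W x" "x' \<in> events M" "W x'" for x x'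
    using cle_total W that by simp
  show ?thesis
  proof (cases "\<exists>d. (y, d) \<in> step M \<and> W d")
    case True
    then obtain d where d: "(y, d) \<in> step M" "W d" by blast
    have de: "d \<in> events M" "y \<preceq> d" "d \<noteq> y" using step_events[OF d(1)] step_cle[OF d(1)] step_irrefl[OF d(1)] by auto
    have "(\<exists>x\<in>events M. W x \<and> y \<preceq> x \<and> x \<noteq> y \<and> (y, x) \<notin> step M) \<longleftrightarrow>
       (\<exists>x\<in>events M. (W x \<and> (\<exists>x'\<in>events M. W x' \<and> x \<preceq> x' \<and> x' \<noteq> x)) \<and> y \<preceq> x \<and> x \<noteq> y)" (is "?L = ?R")
    proof
      assume ?L
      then obtain x where x: "x \<in> events M" "W x" "y \<preceq> x" "x \<noteq> y" "(y, x) \<notin> step M" by blast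
      have "x \<noteq> d" using x d by blast
      with tot[OF x(1,2) de(1) d(2)] consider "x \<preceq> d" "x \<noteq> d" | "d \<preceq> x" "x \<noteq> d" by blast
      then show ?R
      proof cases
        case 1 then show ?thesis using x d de by (intro bexI[of _ x]) auto
      next
        case 2 then show ?thesis using x d de by (intro bexI[of _ d]) auto
      qed
    next
      assume ?R
      then obtain x x' where x: "x \<in> events M" "W x" "y \<preceq> x" "x \<noteq> y" "x' \<in> events M" "W x'" "x \<preceq> x'" "x' \<noteq> x" by blast
      have x'y: "y \<preceq> x'" "x' \<noteq> y" using x cle_trans cle_antisym by blast+
      show ?L
      proof (cases "(y, x) \<in> step M")
        case True
        then have "(y, x') \<notin> step M" using uniq x by blast
        then show ?thesis using x x'y by blast
      qed (use x in blast)
    qed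
    then show ?thesis using True unfolding strict by simp
  next
    case False
    then show ?thesis unfolding strict by auto
  qed
qed

end

section \<open>Recognisability of parallelism and computability of relative positions\<close>

context alphabets
begin

lemma cpt_bex:
  assumes "finite I" "\<And>i. i \<in> I \<Longrightarrow> cpt (t i)"
  shows "cpt (\<lambda>M l e. \<exists>i\<in>I. t i M l e)"
  using assms
proof (induction I rule: finite_induct)
  case empty then show ?case by (simp add: cpt_loc)
next
  case (insert i I)
  then show ?case using cpt_disj[of "t i" "\<lambda>M l e. \<exists>i\<in>I. t i M l e"] by simp
qed

lemma cpt_run_first:
  assumes "cpt Y" "\<And>c. cpt (\<lambda>M l e. col M l e = c)"
  shows "cpt (\<lambda>M l. run_first M D (Y M l) (col M l))"
  unfolding run_first_def by (intro cpt_conj cpt_not cpt_bex cpt_prevp assms finite_atMost)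

lemma cpt_run_last:
  assumes "cpt Y" "\<And>c. cpt (\<lambda>M l e. col M l e = c)"
  shows "cpt (\<lambda>M l. run_last M D (Y M l) (col M l))"
  unfolding run_last_def by (intro cpt_conj cpt_not cpt_bex cpt_succp assms finite_atMost)

text \<open>The quantification over single colours and the conjuncts \<open>True\<close> in
  \<open>parallel_cond\<close> bring every clause into the shape of \<open>cpt_prevp\<close>,
  \<open>cpt_succp\<close> and \<open>cpt_lv\<close>, whose tests are fixed unary
  properties.\<close>

lemma recog_parallel_cert:
  assumes "finite Ws" "cpt s" "cpt t"
  shows "recog (\<lambda>M l. parallel_cert M Ws D (s M l) (t M l))"
proof (rule recog_plug2[OF _ assms(2,3)])
  show "recog (\<lambda>M (l :: 'p event \<Rightarrow> bool \<times> bool). parallel_cert M Ws D (\<lambda>e. fst (l e)) (\<lambda>e. snd (l e)))"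
    unfolding parallel_cert_def
  proof (rule recog_ex)
    have Y: "cpt (\<lambda>M (l :: 'p event \<Rightarrow> (bool \<times> bool) \<times> bool \<times> nat) e. fst (fst (l e)))"
      and W: "cpt (\<lambda>M (l :: 'p event \<Rightarrow> (bool \<times> bool) \<times> bool \<times> nat) e. snd (fst (l e)))"
      and F: "cpt (\<lambda>M (l :: 'p event \<Rightarrow> (bool \<times> bool) \<times> bool \<times> nat) e. fst (snd (l e)))"
      and T: "cpt (\<lambda>M (l :: 'p event \<Rightarrow> (bool \<times> bool) \<times> bool \<times> nat) e. True)"
      and c: "\<And>c. cpt (\<lambda>M (l :: 'p event \<Rightarrow> (bool \<times> bool) \<times> bool \<times> nat) e. snd (snd (l e)) = c)"
      by (rule cpt_loc, simp)+
    show "recog (\<lambda>M (l :: 'p event \<Rightarrow> (bool \<times> bool) \<times> bool \<times> nat). parallel_cond M Ws D (\<lambda>e. fst (fst (l e)))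
        (\<lambda>e. snd (fst (l e))) (\<lambda>e. fst (snd (l e))) (\<lambda>e. snd (snd (l e))))"
      unfolding parallel_cond_def
      by (intro recog_conj recog_disj recog_ball recog_link recog_all recog_exe cpt_imp cpt_conj cpt_disj cpt_not cpt_lv
          cpt_prevp cpt_succp cpt_run_first cpt_run_last Y W F c T finite_atMost finite_Diff assms(1))
  qed simp
qed

lemma cpt_event: "cpt (\<lambda>M l e. e \<in> events M)"
  by (rule cpt_cong[of "\<lambda>M l e. True"]) (simp_all add: cpt_loc)

lemma recog_parallel:
  assumes "cpt s" "cpt t" "p \<noteq> q"
  shows "recog (\<lambda>M l. \<forall>y\<in>events M. s M l y \<longrightarrow> fst y = p \<longrightarrow>
     (\<exists>x\<in>events M. t M l x \<and> fst x = q \<and> (x, y) \<notin> causal_le M \<and> (y, x) \<notin> causal_le M))"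
proof -
  let ?Ws = "{w. set w \<subseteq> P \<and> distinct w}"
  let ?D = "1 + 3 * card ?Ws"
  let ?Y = "\<lambda>M l y. s M l y \<and> fst y = p \<and> y \<in> events M" and ?W = "\<lambda>M l f. t M l f \<and> fst f = q \<and> f \<in> events M"
  have fin: "finite ?Ws" using finite_subset_distinct[OF finite_P] by simp
  have "recog (\<lambda>M l. parallel_cert M ?Ws ?D (?Y M l) (?W M l))"
    by (intro recog_parallel_cert fin cpt_conj assms(1,2) cpt_event cpt_loc) simp_all
  then show ?thesis
  proof (rule recog_cong)
    fix M l assume "is_msc P Sig M"
    then interpret msc_loc P Sig M by (rule msc_locI)
    show "parallel_cert M ?Ws ?D (?Y M l) (?W M l) = (\<forall>y\<in>events M. s M l y \<longrightarrow> fst y = p \<longrightarrow>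
     (\<exists>x\<in>events M. t M l x \<and> fst x = q \<and> (x, y) \<notin> causal_le M \<and> (y, x) \<notin> causal_le M))" (is "?L = ?R")
    proof
      assume ?L
      then obtain b where b: "\<And>e. e \<in> events M \<Longrightarrow> b e \<in> UNIV \<times> {..?D}"
        and c: "parallel_cond M ?Ws ?D (?Y M l) (?W M l) (\<lambda>e. fst (b e)) (\<lambda>e. snd (b e))"
        unfolding parallel_cert_def by blast
      have bb: "snd (b e) \<le> ?D" if "e \<in> events M" for e using b[OF that] by (auto simp: mem_Times_iff)
      show ?R
      proof (intro ballI impI)
        fix y assume y: "y \<in> events M" "s M l y" "fst y = p"
        have "\<exists>f\<in>events M. ?W M l f \<and> (y, f) \<notin> causal_le M \<and> (f, y) \<notin> causal_le M"
          by (rule parallel_sound[OF _ _ assms(3) bb _ c y(1)]) (use y in auto)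
        then show "\<exists>x\<in>events M. t M l x \<and> fst x = q \<and> (x, y) \<notin> causal_le M \<and> (y, x) \<notin> causal_le M" by blast
      qed
    next
      assume r: ?R
      show ?L
      proof (rule parallel_complete[OF _ _ assms(3) _ fin])
        fix y assume y: "?Y M l y"
        then obtain x where "x \<in> events M" "t M l x \<and> fst x = q \<and> (x, y) \<notin> causal_le M \<and> (y, x) \<notin> causal_le M"
          using r by blast
        then show "\<exists>f. ?W M l f \<and> par y f" unfolding par_def by blast
      qed auto
    qed
  qed
qed

lemma cpt_rel_type:
  "cpt (\<lambda>M (l :: 'p event \<Rightarrow> bool) y. \<exists>x\<in>events M. l x \<and> fst x = q \<and> rel_type M x y = r)"
proof -
  let ?W = "\<lambda>M (l :: 'p event \<Rightarrow> bool) x. l x \<and> fst x = q"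
  have W: "cpt ?W" by (rule cpt_loc) simp
  note cong = cpt_cong[where t' = "\<lambda>M l y. \<exists>x\<in>events M. l x \<and> fst x = q \<and> rel_type M x y = r"]
  show ?thesis
  proof (cases r)
    case Same
    show ?thesis
      by (rule cong[OF W]) (auto simp: Same msc_loc.rel_type_cases[OF msc_locI])
  next
    case Next
    show ?thesis
      by (rule cong[OF cpt_onprd[OF W]])
        (auto simp: Next onprd_def msc_loc.rel_type_cases[OF msc_locI] msc_loc.proc_rel_iff[OF msc_locI])
  next
    case Prev
    show ?thesis
      by (rule cong[OF cpt_onsuc[OF W]])
        (auto simp: Prev onsuc_def msc_loc.rel_type_cases[OF msc_locI] msc_loc.proc_rel_iff[OF msc_locI])
  next
    case Sends
    show ?thesis
      by (rule cong[OF cpt_onsnd[OF W]])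
        (auto simp: Sends onsnd_def msc_loc.rel_type_cases[OF msc_locI] dest: msc_loc.msg_relD(1)[OF msc_locI])
  next
    case Receives
    show ?thesis
      by (rule cong[OF cpt_onrcv[OF W]])
        (auto simp: Receives onrcv_def msc_loc.rel_type_cases[OF msc_locI] dest: msc_loc.msg_relD(2)[OF msc_locI])
  next
    case Before
    let ?b = "\<lambda>M U y. onprd M U y \<or> onsnd M U y"
    let ?t = "\<lambda>M l y. if ?b M (?W M l) y
       then ?b M (up M (\<lambda>e. ?W M l e \<and> ?b M (up M (?W M l)) e)) y
       else ?b M (up M (?W M l)) y"
    have "cpt ?t" by (intro cpt_if cpt_disj cpt_onprd cpt_onsnd cpt_up cpt_conj[OF W] W)
    then show ?thesis
    proof (rule cong)
      fix M l and y :: "'p event" assume a: "is_msc P Sig M" "y \<in> events M"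
      interpret msc_loc P Sig M using a(1) by (rule msc_locI)
      show "?t M l y = (\<exists>x\<in>events M. l x \<and> fst x = q \<and> rel_type M x y = r)"
        unfolding Before rel_type_cases using before_iff[of "?W M l" q y] a(2) unfolding onprd_step by auto
    qed
  next
    case After
    let ?b = "\<lambda>M U y. onsuc M U y \<or> onrcv M U y"
    let ?t = "\<lambda>M l y. if ?b M (?W M l) y
       then ?b M (down M (\<lambda>e. ?W M l e \<and> ?b M (down M (?W M l)) e)) y
       else ?b M (down M (?W M l)) y"
    have "cpt ?t" by (intro cpt_if cpt_disj cpt_onsuc cpt_onrcv cpt_down cpt_conj[OF W] W)
    then show ?thesis
    proof (rule cong)
      fix M l and y :: "'p event" assume a: "is_msc P Sig M" "y \<in> events M"
      interpret msc_loc P Sig M using a(1) by (rule msc_locI)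
      show "?t M l y = (\<exists>x\<in>events M. l x \<and> fst x = q \<and> rel_type M x y = r)"
        unfolding After rel_type_cases using after_iff[of "?W M l" q y] a(2) unfolding onsuc_step by auto
    qed
  next
    case Parallel
    have b: "cpt (\<lambda>M (l :: 'p event \<Rightarrow> bool \<times> bool) e. fst (l e))" "cpt (\<lambda>M (l :: 'p event \<Rightarrow> bool \<times> bool) e. snd (l e))"
      by (rule cpt_loc, simp)+
    \<comment> \<open>The value at each event is guessed. On a process other than \<open>q\<close>,
      events guessed \<open>True\<close> are certified by \<open>recog_parallel\<close> and events
      guessed \<open>False\<close> by \<open>recog_comparable\<close>. On \<open>q\<close> itself
      nothing is parallel to an event of \<open>q\<close>, so \<open>True\<close> is
      rejected.\<close>
    let ?A = "\<lambda>p M (l :: 'p event \<Rightarrow> bool \<times> bool). \<forall>y\<in>events M. snd (l y) \<longrightarrow> fst y = p \<longrightarrow>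
     (\<exists>x\<in>events M. fst (l x) \<and> fst x = q \<and> (x, y) \<notin> causal_le M \<and> (y, x) \<notin> causal_le M)"
    let ?B = "\<lambda>p M (l :: 'p event \<Rightarrow> bool \<times> bool). \<forall>e\<in>events M. \<forall>f\<in>events M. \<not> snd (l e) \<longrightarrow> fst e = p \<longrightarrow> fst (l f) \<longrightarrow> fst f = q \<longrightarrow>
     (e, f) \<in> causal_le M \<or> (f, e) \<in> causal_le M"
    have "recog (\<lambda>M l. \<forall>p\<in>P - {q}. ?A p M l \<and> ?B p M l)"
      by (intro recog_ball recog_conj recog_parallel recog_comparable b cpt_not[OF b(2)]) (auto simp: finite_P)
    moreover have "recog (\<lambda>M (l :: 'p event \<Rightarrow> bool \<times> bool). \<forall>y\<in>events M. fst y = q \<longrightarrow> \<not> snd (l y))"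
      by (rule recog_all, rule cpt_loc) simp
    ultimately have r: "recog (\<lambda>M l. (\<forall>p\<in>P - {q}. ?A p M l \<and> ?B p M l) \<and> (\<forall>y\<in>events M. fst y = q \<longrightarrow> \<not> snd (l y)))"
      by (rule recog_conj)
    show ?thesis
    proof (rule cpt_boolI, rule recog_cong[OF r])
      fix M and l :: "'p event \<Rightarrow> bool \<times> bool" assume "is_msc P Sig M"
      then interpret msc_loc P Sig M by (rule msc_locI)
      have same: "\<not> (\<exists>x\<in>events M. fst (l x) \<and> fst x = q \<and> rel_type M x y = Parallel)" if "y \<in> events M" "fst y = q" for y
        using cle_total that unfolding rel_type_cases by metis
      show "((\<forall>p\<in>P - {q}. ?A p M l \<and> ?B p M l) \<and> (\<forall>y\<in>events M. fst y = q \<longrightarrow> \<not> snd (l y))) =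
         (\<forall>y\<in>events M. snd (l y) = (\<exists>x\<in>events M. fst (l x) \<and> fst x = q \<and> rel_type M x y = r))" (is "?L = ?R")
      proof
        assume L: ?L
        show ?R
        proof
          fix y assume y: "y \<in> events M"
          show "snd (l y) = (\<exists>x\<in>events M. fst (l x) \<and> fst x = q \<and> rel_type M x y = r)"
          proof (cases "fst y = q")
            case True
            then show ?thesis using L y same[OF y True] Parallel by blast
          next
            case False
            then have "fst y \<in> P - {q}" using fst_event[OF y] by blast
            then have "?A (fst y) M l" "?B (fst y) M l" using L by blast+
            then show ?thesis using y unfolding Parallel rel_type_cases by blast
          qed
        qed
      next
        assume R: ?R
        have "?A p M l" "?B p M l" for p using R unfolding Parallel rel_type_cases by blast+
        moreover have "\<not> snd (l y)" if "y \<in> events M" "fst y = q" for y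
          using R same[OF that] that Parallel by blast
        ultimately show ?L by blast
      qed
    qed
  qed
qed

lemma cpt_setI:
  assumes "finite U" "\<And>M l e. t M l e \<subseteq> U" "\<And>u. u \<in> U \<Longrightarrow> cpt (\<lambda>M l e. u \<in> t M l e)"
  shows "cpt t"
proof (rule cptI[of "Pow U"])
  have "recog (\<lambda>M l. \<forall>e\<in>events M. (u \<in> snd (l e)) = (u \<in> t M (\<lambda>e. fst (l e)) e))" if "u \<in> U" for u
  proof -
    have "recog (\<lambda>M l. \<forall>e\<in>events M. snd (l e) = (u \<in> t M (\<lambda>e. fst (l e)) e))"
      using assms(3)[OF that] by (rule cptE)
    moreover have "local_term (\<lambda>M l e. (fst (l e), u \<in> snd (l e)))" by (rule local_termI) simp
    ultimately show ?thesis using recog_subst by fastforce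
  qed
  then have "recog (\<lambda>M l. \<forall>u\<in>U. \<forall>e\<in>events M. (u \<in> snd (l e)) = (u \<in> t M (\<lambda>e. fst (l e)) e))"
    by (rule recog_ball[OF assms(1)])
  moreover have "recog (\<lambda>M l. \<forall>e\<in>events M. snd (l e) \<subseteq> U)"
    by (rule recog_all, rule cpt_loc) simp
  ultimately have "recog (\<lambda>M l. (\<forall>u\<in>U. \<forall>e\<in>events M. (u \<in> snd (l e)) = (u \<in> t M (\<lambda>e. fst (l e)) e)) \<and>
      (\<forall>e\<in>events M. snd (l e) \<subseteq> U))"
    by (rule recog_conj)
  then show "recog (\<lambda>M l. \<forall>e\<in>events M. snd (l e) = t M (\<lambda>e. fst (l e)) e)"
    by (rule recog_cong) (use assms(2) in blast)
qed (use assms in auto)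

text \<open>The restrictions to \<open>P\<close> and \<open>K\<close> keep the set inside a fixed
  finite universe for every \<open>M\<close>. On MSCs, with \<open>K\<close> containing all values
  of the term, they hold for every event.\<close>

definition type_set :: "('p, 'a) msc \<Rightarrow> 'k set \<Rightarrow> ('p event \<Rightarrow> 'k) \<Rightarrow> 'p event \<Rightarrow> (rtype \<times> 'p \<times> 'k) set" where
  "type_set M K k y = {(rel_type M x y, fst x, k x) | x. x \<in> events M \<and> fst x \<in> P \<and> k x \<in> K}"

lemma cpt_type_set:
  assumes "finite K" "cpt t"
  shows "cpt (\<lambda>M l. type_set M K (t M l))"
proof (rule cpt_setI[of "UNIV \<times> P \<times> K"])
  show "finite ((UNIV :: rtype set) \<times> P \<times> K)" using finite_rtype finite_P assms(1) by blast
  show "type_set M K (t M l) e \<subseteq> UNIV \<times> P \<times> K" for M :: "('p, 'a) msc" and l e unfolding type_set_def by auto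
  fix u assume "u \<in> (UNIV :: rtype set) \<times> P \<times> K"
  then obtain r q k where u: "u = (r, q, k)" "q \<in> P" "k \<in> K" by auto
  have "cpt (\<lambda>M l y. \<exists>x\<in>events M. (t M l x = k) \<and> fst x = q \<and> rel_type M x y = r)"
    by (rule cpt_comp[OF cpt_rel_type, OF cpt_map[OF assms(2)]])
  moreover have "(\<lambda>M l y. \<exists>x\<in>events M. (t M l x = k) \<and> fst x = q \<and> rel_type M x y = r) =
     (\<lambda>M l e. u \<in> type_set M K (t M l) e)"
    unfolding type_set_def u using u(2,3) by (intro ext) blast
  ultimately show "cpt (\<lambda>M l e. u \<in> type_set M K (t M l) e)" by simp
qed

end

lemma sat_cong:
  "(\<And>x. x \<in> free_fo \<phi> \<Longrightarrow> v x = v' x) \<Longrightarrow> (\<And>X. X \<in> free_so \<phi> \<Longrightarrow> V X = V' X) \<Longrightarrow>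
   sat M v V \<phi> \<longleftrightarrow> sat M v' V' \<phi>"
proof (induction \<phi> arbitrary: v v' V V')
  case (Or \<phi> \<psi>)
  have "sat M v V \<phi> \<longleftrightarrow> sat M v' V' \<phi>" by (rule Or.IH(1)) (use Or.prems in auto)
  moreover have "sat M v V \<psi> \<longleftrightarrow> sat M v' V' \<psi>" by (rule Or.IH(2)) (use Or.prems in auto)
  ultimately show ?case by simp
next
  case (Neg \<phi>)
  have "sat M v V \<phi> \<longleftrightarrow> sat M v' V' \<phi>" by (rule Neg.IH) (use Neg.prems in auto)
  then show ?case by simp
next
  case (ExFO x \<phi>)
  have "sat M (v(x := e)) V \<phi> \<longleftrightarrow> sat M (v'(x := e)) V' \<phi>" for e
    by (rule ExFO.IH) (use ExFO.prems in auto)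
  then show ?case by simp
next
  case (ExSO X \<phi>)
  have "sat M v (V(X := F)) \<phi> \<longleftrightarrow> sat M v' (V'(X := F)) \<phi>" for F
    by (rule ExSO.IH) (use ExSO.prems in auto)
  then show ?case by simp
qed simp_all

section \<open>Two-variable formulas\<close>

text \<open>A label of type \<open>nat \<Rightarrow> bool\<close> lists the set variables that
  contain the event, so a labelling is an assignment.\<close>

definition val_of :: "('p, 'a) msc \<Rightarrow> ('p event \<Rightarrow> nat \<Rightarrow> bool) \<Rightarrow> nat \<Rightarrow> 'p event set" where
  "val_of M l X = {e \<in> events M. l e X}"

context alphabets
begin

text \<open>
  \<open>captures \<psi> t \<beta>\<close>: the truth value of \<open>\<psi>(x, y)\<close> is determined by \<open>\<beta>\<close> from the values of the term
  \<open>t\<close> at \<open>x\<close> and \<open>y\<close> and the relative position of \<open>x\<close> and \<open>y\<close>.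
\<close>

definition captures :: "('p, 'a) mso \<Rightarrow>
    (('p, 'a) msc \<Rightarrow> ('p event \<Rightarrow> nat \<Rightarrow> bool) \<Rightarrow> 'p event \<Rightarrow> 't) \<Rightarrow> ('t \<Rightarrow> 't \<Rightarrow> rtype \<Rightarrow> bool) \<Rightarrow> bool" where
  "captures \<psi> t \<beta> \<longleftrightarrow> (\<forall>M l v. is_msc P Sig M \<longrightarrow> v 0 \<in> events M \<longrightarrow> v 1 \<in> events M \<longrightarrow>
     sat M v (val_of M l) \<psi> = \<beta> (t M l (v 0)) (t M l (v 1)) (rel_type M (v 0) (v 1)))"

definition tame :: "('p, 'a) mso \<Rightarrow> bool" where
  "tame \<psi> \<longleftrightarrow> (\<exists>(t :: ('p, 'a) msc \<Rightarrow> ('p event \<Rightarrow> nat \<Rightarrow> bool) \<Rightarrow> 'p event \<Rightarrow> nat) \<beta>. cpt t \<and> captures \<psi> t \<beta>)"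

lemma tameI:
  fixes t :: "('p, 'a) msc \<Rightarrow> ('p event \<Rightarrow> nat \<Rightarrow> bool) \<Rightarrow> 'p event \<Rightarrow> 't"
  assumes "cpt t" "captures \<psi> t \<beta>"
  shows "tame \<psi>"
proof -
  obtain K where K: "finite K" "\<And>M l e. is_msc P Sig M \<Longrightarrow> e \<in> events M \<Longrightarrow> t M l e \<in> K"
    using assms(1) by (rule cptE) blast
  obtain h :: "'t \<Rightarrow> nat" where h: "inj_on h K" using finite_imp_inj_to_nat_seg[OF K(1)] by blast
  have "captures \<psi> (\<lambda>M l e. h (t M l e)) (\<lambda>a b r. \<beta> (inv_into K h a) (inv_into K h b) r)"
    using assms(2) K(2) h unfolding captures_def by simp
  then show ?thesis unfolding tame_def using cpt_map[OF assms(1)] by blast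
qed

lemma tame_unary:
  assumes "cpt (\<lambda>M l e. u M l e :: bool)" "i \<in> {0, 1}"
    "\<And>M l v. is_msc P Sig M \<Longrightarrow> v i \<in> events M \<Longrightarrow> sat M v (val_of M l) \<psi> = u M l (v i)"
  shows "tame \<psi>"
proof (rule tameI[OF assms(1)])
  show "captures \<psi> u (\<lambda>a b r. if i = 0 then a else b)"
    unfolding captures_def using assms(2,3) by auto
qed

lemma tame_binary:
  assumes "i \<in> {0, 1}" "j \<in> {0, 1}"
    "\<And>M l v. is_msc P Sig M \<Longrightarrow> v i \<in> events M \<Longrightarrow> v j \<in> events M \<Longrightarrow>
       sat M v (val_of M l) \<psi> = h (rel_type M (v i) (v j))"
  shows "tame \<psi>"
proof (rule tameI)
  show "cpt (\<lambda>M l e. True)" by (rule cpt_loc) simp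
  show "captures \<psi> (\<lambda>M l e. True) (\<lambda>a b r. h (if i = j then Same else if i = 0 then r else converse_type r))"
    unfolding captures_def
  proof (intro allI impI)
    fix M :: "('p, 'a) msc" and l and v :: "nat \<Rightarrow> 'p event" assume M: "is_msc P Sig M" and v: "v 0 \<in> events M" "v 1 \<in> events M"
    then interpret msc_loc P Sig M by (intro msc_locI)
    have "rel_type M (v i) (v j) = (if i = j then Same else if i = 0 then rel_type M (v 0) (v 1)
        else converse_type (rel_type M (v 0) (v 1)))"
    proof -
      have same: "rel_type M x x = Same" for x by (simp add: rel_type_def)
      consider "i = j" | "i = 0" "j = 1" | "i = 1" "j = 0" using assms(1,2) by auto
      then show ?thesis
        by cases (simp_all only: same rel_type_converse[of "v 1" "v 0"] if_True if_False refl zero_neq_one one_neq_zero)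
    qed
    moreover have "v i \<in> events M" "v j \<in> events M" using assms(1,2) v by auto
    note assms(3)[OF M this]
    ultimately show "sat M v (val_of M l) \<psi> = h (if i = j then Same else if i = 0 then rel_type M (v 0) (v 1)
        else converse_type (rel_type M (v 0) (v 1)))"
      by (simp only:)
  qed
qed

text \<open>The truth of \<open>\<psi>\<close> depends on a candidate only through its value of
  \<open>t\<close> and its position relative to the other variable. \<open>type_set\<close> at the
  other variable lists the combinations that occur, so pairing it with \<open>t\<close> gives the
  new term.\<close>

lemma tame_ex:
  assumes "tame \<psi>" "i \<in> {0, 1}"
  shows "tame (ExFO i \<psi>)"
proof -
  obtain t :: "('p, 'a) msc \<Rightarrow> ('p event \<Rightarrow> nat \<Rightarrow> bool) \<Rightarrow> 'p event \<Rightarrow> nat" and \<beta> where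
    t: "cpt t" and c: "captures \<psi> t \<beta>" using assms(1) unfolding tame_def by blast
  obtain K where K: "finite K" "\<And>M l e. is_msc P Sig M \<Longrightarrow> e \<in> events M \<Longrightarrow> t M l e \<in> K"
    using t by (rule cptE) blast
  have c': "sat M v (val_of M l) \<psi> = \<beta> (t M l (v 0)) (t M l (v 1)) (rel_type M (v 0) (v 1))"
    if "is_msc P Sig M" "v 0 \<in> events M" "v 1 \<in> events M" for M v l
    using c that unfolding captures_def by blast
  \<comment> \<open>\<open>type_set\<close> records the position of the candidate relative to the
    remaining event. For \<open>i = 0\<close> this is the order of the arguments of
    \<open>\<beta>\<close>; for \<open>i = 1\<close> it has to be reversed.\<close>
  define B where "B a b r = (if i = (0 :: nat) then (\<exists>(r', q, k) \<in> snd b. \<beta> k (fst b) r')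
      else (\<exists>(r', q, k) \<in> snd a. \<beta> (fst a) k (converse_type r')))"
    for a b :: "nat \<times> (rtype \<times> 'p \<times> nat) set" and r :: rtype
  show ?thesis
  proof (rule tameI)
    show "cpt (\<lambda>M l e. (t M l e, type_set M K (t M l) e))"
      by (intro cpt_Pair cpt_type_set t K(1))
    show "captures (ExFO i \<psi>) (\<lambda>M l e. (t M l e, type_set M K (t M l) e)) B"
      unfolding captures_def
    proof (intro allI impI)
      fix M :: "('p, 'a) msc" and l and v :: "nat \<Rightarrow> 'p event" assume M: "is_msc P Sig M" and v: "v 0 \<in> events M" "v 1 \<in> events M"
      then interpret msc_loc P Sig M by (intro msc_locI)
      have ts: "(\<exists>(r', q, k) \<in> type_set M K (t M l) y. Q k r') \<longleftrightarrow> (\<exists>x\<in>events M. Q (t M l x) (rel_type M x y))" for Q y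
        unfolding type_set_def using K(2)[OF M] fst_event by fastforce
      show "sat M v (val_of M l) (ExFO i \<psi>) = B (t M l (v 0), type_set M K (t M l) (v 0))
        (t M l (v 1), type_set M K (t M l) (v 1)) (rel_type M (v 0) (v 1))"
      proof (cases "i = 0")
        case True
        have "sat M (v(0 := x)) (val_of M l) \<psi> = \<beta> (t M l x) (t M l (v 1)) (rel_type M x (v 1))" if "x \<in> events M" for x
          using c'[OF M, of "v(0 := x)" l] v that by simp
        then show ?thesis using True by (simp add: B_def ts[of "v 1" "\<lambda>k. \<beta> k (t M l (v 1))"] del: One_nat_def)
      next
        case False
        then have i: "i = 1" using assms(2) by simp
        have "sat M (v(1 := x)) (val_of M l) \<psi> = \<beta> (t M l (v 0)) (t M l x) (converse_type (rel_type M x (v 0)))" if "x \<in> events M" for x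
          using c'[OF M, of "v(1 := x)" l] v that rel_type_converse[of "v 0" x] by simp
        then show ?thesis using i by (simp add: B_def ts[of "v 0" "\<lambda>k r. \<beta> (t M l (v 0)) k (converse_type r)"] del: One_nat_def)
      qed
    qed
  qed
qed

lemma fo2_tame: "fo2 B \<psi> \<Longrightarrow> tame \<psi>"
proof (induction \<psi>)
  case (OnProc p x)
  show ?case
    by (rule tame_unary[of "\<lambda>M l e. fst e = p" x])
      (use OnProc in \<open>auto simp: msc_loc.events_on_iff[OF msc_locI] intro: cpt_loc\<close>)
next
  case (HasLetter a x)
  show ?case
    by (rule tame_unary[of "\<lambda>M l e. letter M e = a" x]) (use HasLetter in \<open>auto intro: cpt_loc\<close>)
next
  case (InSet x X)
  show ?case
    by (rule tame_unary[of "\<lambda>M l e. l e X" x]) (use InSet in \<open>auto simp: val_of_def intro: cpt_loc\<close>)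
next
  case (Equal x y)
  show ?case
    by (rule tame_binary[of x y _ "\<lambda>r. r = Same"])
      (use Equal in \<open>auto simp: msc_loc.rel_type_cases[OF msc_locI]\<close>)
next
  case (Rel r x y)
  show ?case
    by (rule tame_binary[of x y _ "holds_in r"])
      (use Rel in \<open>auto simp: msc_loc.rel_of_type[OF msc_locI]\<close>)
next
  case (Or \<phi> \<psi>)
  obtain t :: "('p, 'a) msc \<Rightarrow> ('p event \<Rightarrow> nat \<Rightarrow> bool) \<Rightarrow> 'p event \<Rightarrow> nat" and \<beta> where
    1: "cpt t" "captures \<phi> t \<beta>" using Or unfolding tame_def by auto
  obtain t' :: "('p, 'a) msc \<Rightarrow> ('p event \<Rightarrow> nat \<Rightarrow> bool) \<Rightarrow> 'p event \<Rightarrow> nat" and \<beta>' where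
    2: "cpt t'" "captures \<psi> t' \<beta>'" using Or unfolding tame_def by auto
  have "captures (Or \<phi> \<psi>) (\<lambda>M l e. (t M l e, t' M l e)) (\<lambda>a b r. \<beta> (fst a) (fst b) r \<or> \<beta>' (snd a) (snd b) r)"
    using 1(2) 2(2) unfolding captures_def by simp
  then show ?case by (rule tameI[OF cpt_Pair[OF 1(1) 2(1)]])
next
  case (Neg \<phi>)
  obtain t :: "('p, 'a) msc \<Rightarrow> ('p event \<Rightarrow> nat \<Rightarrow> bool) \<Rightarrow> 'p event \<Rightarrow> nat" and \<beta> where
    1: "cpt t" "captures \<phi> t \<beta>" using Neg unfolding tame_def by auto
  have "captures (Neg \<phi>) t (\<lambda>a b r. \<not> \<beta> a b r)"
    using 1(2) unfolding captures_def by simp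
  then show ?case by (rule tameI[OF 1(1)])
next
  case (ExFO x \<psi>)
  then show ?case by (simp add: tame_ex)
qed simp

text \<open>The truth value does not depend on the assignment, so both variables may be placed on
  one event, where the position is \<open>Same\<close>. MSCs have at least one event.\<close>

lemma recog_fo2:
  assumes "fo2 B \<psi>" "free_fo \<psi> = {}"
  shows "recog (\<lambda>M l. \<forall>v. sat M v (val_of M l) \<psi>)"
proof -
  obtain t :: "('p, 'a) msc \<Rightarrow> ('p event \<Rightarrow> nat \<Rightarrow> bool) \<Rightarrow> 'p event \<Rightarrow> nat" and \<beta> where
    t: "cpt t" "captures \<psi> t \<beta>" using fo2_tame[OF assms(1)] unfolding tame_def by blast
  have "recog (\<lambda>M l. \<exists>e\<in>events M. \<beta> (t M l e) (t M l e) Same)"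
    by (rule recog_exe) (rule cpt_map[OF t(1)])
  then show ?thesis
  proof (rule recog_cong)
    fix M l assume M: "is_msc P Sig M"
    then interpret msc_loc P Sig M by (rule msc_locI)
    obtain p where "word M p \<noteq> []" using msc_nonempty by blast
    then obtain x where x: "x \<in> events M" using last_event by blast
    have indep: "sat M v (val_of M l) \<psi> = sat M v' (val_of M l) \<psi>" for v v'
      by (rule sat_cong) (simp_all add: assms(2))
    have at: "sat M (\<lambda>_. e) (val_of M l) \<psi> = \<beta> (t M l e) (t M l e) Same" if "e \<in> events M" for e
      using t(2)[unfolded captures_def, rule_format, OF M, of "\<lambda>_. e" l] that by (simp add: rel_type_def)
    show "(\<exists>e\<in>events M. \<beta> (t M l e) (t M l e) Same) = (\<forall>v. sat M v (val_of M l) \<psi>)"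
      using at indep x by metis
  qed
qed

lemma free_fo_foldr: "free_fo (foldr ExSO Xs \<psi>) = free_fo \<psi>"
  by (induction Xs) simp_all

text \<open>Each set quantifier is a projection. The universal quantifier over \<open>v\<close>
  commutes with it because no first-order variable is free.\<close>

lemma recog_emso2:
  assumes "fo2 B \<psi>" "free_fo \<psi> = {}"
  shows "recog (\<lambda>M l. \<forall>v. sat M v (val_of M l) (foldr ExSO Xs \<psi>))"
proof (induction Xs)
  case Nil
  then show ?case using recog_fo2[OF assms] by simp
next
  case (Cons X Xs)
  let ?\<phi> = "foldr ExSO Xs \<psi>"
  have "local_term (\<lambda>M l e. (fst (l e))(X := snd (l e)))" by (rule local_termI) simp
  from recog_subst[OF Cons.IH this]
  have r: "recog (\<lambda>M l. \<forall>v. sat M v (val_of M (\<lambda>e. (fst (l e))(X := snd (l e)))) ?\<phi>)" .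
  have "recog (\<lambda>M l. \<exists>b. (\<forall>e\<in>events M. b e \<in> (UNIV :: bool set)) \<and> (\<forall>v. sat M v (val_of M (\<lambda>e. (l e)(X := b e))) ?\<phi>))"
    by (rule recog_ex[OF r]) simp
  then show ?case
  proof (rule recog_cong)
    fix M :: "('p, 'a) msc" and l :: "'p event \<Rightarrow> nat \<Rightarrow> bool"
    have upd: "val_of M (\<lambda>e. (l e)(X := b e)) = (val_of M l)(X := {e \<in> events M. b e})" for b
      by (intro ext) (auto simp: val_of_def)
    have indep: "sat M v V ?\<phi> = sat M v' V ?\<phi>" for v v' V
      by (rule sat_cong) (simp_all add: assms(2) free_fo_foldr)
    have set: "(\<exists>b. Q {e \<in> events M. b e}) \<longleftrightarrow> (\<exists>F\<subseteq>events M. Q F)" for Q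
    proof
      assume "\<exists>F\<subseteq>events M. Q F"
      then obtain F where "F \<subseteq> events M" "Q F" by blast
      moreover have "{e \<in> events M. e \<in> F} = F" using \<open>F \<subseteq> events M\<close> by blast
      ultimately show "\<exists>b. Q {e \<in> events M. b e}" by (intro exI[of _ "\<lambda>e. e \<in> F"]) simp
    next
      assume "\<exists>b. Q {e \<in> events M. b e}"
      then obtain b where "Q {e \<in> events M. b e}" ..
      then show "\<exists>F\<subseteq>events M. Q F" by (intro exI[of _ "{e \<in> events M. b e}"]) simp
    qed
    have "(\<exists>b. (\<forall>e\<in>events M. b e \<in> (UNIV :: bool set)) \<and> (\<forall>v. sat M v (val_of M (\<lambda>e. (l e)(X := b e))) ?\<phi>)) \<longleftrightarrow>
      (\<exists>F\<subseteq>events M. \<forall>v. sat M v ((val_of M l)(X := F)) ?\<phi>)"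
      unfolding upd using set[of "\<lambda>F. \<forall>v. sat M v ((val_of M l)(X := F)) ?\<phi>"] by simp
    also have "\<dots> \<longleftrightarrow> (\<forall>v. \<exists>F\<subseteq>events M. sat M v ((val_of M l)(X := F)) ?\<phi>)"
      using indep by metis
    finally show "(\<exists>b. (\<forall>e\<in>events M. b e \<in> (UNIV :: bool set)) \<and> (\<forall>v. sat M v (val_of M (\<lambda>e. (l e)(X := b e))) ?\<phi>)) =
      (\<forall>v. sat M v (val_of M l) (foldr ExSO (X # Xs) \<psi>))" by simp
  qed
qed

lemma recog_sentence:
  assumes "sentence P Sig \<phi>" "emso2 B \<phi>"
  shows "recog (\<lambda>M (l :: 'p event \<Rightarrow> unit). \<forall>v V. sat M v V \<phi>)"
proof -
  obtain Xs \<psi> where \<phi>: "\<phi> = foldr ExSO Xs \<psi>" "fo2 B \<psi>" using assms(2) unfolding emso2_def by blast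
  have free: "free_fo \<phi> = {}" "free_so \<phi> = {}" using assms(1) unfolding sentence_def by auto
  then have "free_fo \<psi> = {}" using \<phi>(1) by (simp add: free_fo_foldr)
  then have r: "recog (\<lambda>M l. \<forall>v. sat M v (val_of M l) \<phi>)" using recog_emso2[OF \<phi>(2)] \<phi>(1) by simp
  have "local_term (\<lambda>(M :: ('p, 'a) msc) (l :: 'p event \<Rightarrow> unit) e (X :: nat). False)" by (rule local_termI) simp
  from recog_subst[OF r this] show ?thesis
  proof (rule recog_cong)
    fix M :: "('p, 'a) msc" and l :: "'p event \<Rightarrow> unit"
    have "sat M v V \<phi> = sat M v (val_of M (\<lambda>e X. False)) \<phi>" for v V
      by (rule sat_cong) (simp_all add: free)
    then show "(\<forall>v. sat M v (val_of M (\<lambda>e X. False)) \<phi>) = (\<forall>v V. sat M v V \<phi>)" by blast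
  qed
qed

section \<open>From tilings to automata\<close>

text \<open>State \<open>0\<close> is initial; state \<open>Suc c\<close> stores the colour \<open>c\<close> of the last event, which is also the
  content of the messages.\<close>

lemma recog_cfm:
  assumes "recog (\<lambda>M (l :: 'p event \<Rightarrow> unit). Q M)"
  shows "\<exists>A :: ('p, 'a, nat, nat) cfm. is_cfm P Sig A \<and> cfm_lang P Sig A = {M. is_msc P Sig M \<and> Q M}"
proof -
  obtain C :: "nat set" and T A where C: "finite C"
    and Q: "\<And>M (l :: 'p event \<Rightarrow> unit). is_msc P Sig M \<Longrightarrow> Q M \<longleftrightarrow> (\<exists>c. tiling T A C M l c)"
    using assms by (rule recogE) blast
  define dec where "dec s = (if s = 0 then None else Some (s - 1))" for s :: nat
  define tr where "tr p = {(s, act, s'). s \<in> insert 0 (Suc ` C) \<and> (\<exists>c\<in>C. s' = Suc c \<and>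
      ((\<exists>a\<in>Sig. act = Internal a \<and> T p a () (dec s) None False c) \<or>
       (\<exists>a\<in>Sig. \<exists>q\<in>P - {p}. act = Send a c q \<and> T p a () (dec s) None True c) \<or>
       (\<exists>a\<in>Sig. \<exists>q\<in>P - {p}. \<exists>m\<in>C. act = Receive a m q \<and> T p a () (dec s) (Some m) False c)))}"
    for p
  \<comment> \<open>Processes outside \<open>P\<close> have no events; the \<open>None\<close>
    supplied for them in \<open>acc\<close> is their value under \<open>last_val\<close>.\<close>
  define B :: "('p, 'a, nat, nat) cfm" where
    "B = \<lparr>msgs = C, states = (\<lambda>_. insert 0 (Suc ` C)), init = (\<lambda>_. 0), trans_on = tr,
      acc = {f \<in> (\<Pi>\<^sub>E p\<in>P. insert 0 (Suc ` C)). A (\<lambda>p. if p \<in> P then dec (f p) else None)}\<rparr>"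
  have cfm: "is_cfm P Sig B"
    unfolding is_cfm_def B_def cfm.simps
  proof (intro conjI ballI)
    fix p assume "p \<in> P"
    show "tr p \<subseteq> insert 0 (Suc ` C) \<times> actions_on P Sig C p \<times> insert 0 (Suc ` C)"
      unfolding tr_def actions_on_def by auto
  qed (use C in auto)
  have "M \<in> cfm_lang P Sig B \<longleftrightarrow> Q M" if M: "is_msc P Sig M" for M
  proof -
    interpret msc_loc P Sig M using M by (rule msc_locI)
    have lets: "letter M e \<in> Sig" if "e \<in> events M" for e
    proof -
      have "\<forall>p\<in>P. word M p \<in> lists Sig" by (rule msc_conds[THEN conjunct1])
      then have "set (word M (fst e)) \<subseteq> Sig" using fst_event[OF that] by auto
      moreover have "letter M e \<in> set (word M (fst e))"
        using that unfolding letter_def event_iff by (intro nth_mem) auto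
      ultimately show ?thesis by blast
    qed
    have oth: "fst e \<in> P - {fst d}" "fst d \<in> P - {fst e}" if "(d, e) \<in> msg_rel M" for d e
      using msg_relD[OF that] fst_event[of e] fst_event[of d] by auto
    have one: "\<not> (e \<in> Domain (msg_rel M) \<and> e \<in> Range (msg_rel M))" for e
    proof
      assume "e \<in> Domain (msg_rel M) \<and> e \<in> Range (msg_rel M)"
      then obtain f d where "(e, f) \<in> msg_rel M" "(d, e) \<in> msg_rel M" by blast
      then have "e = d" using msg_unique[of e f d e] by simp
      then show False using msg_relD(3)[OF \<open>(d, e) \<in> msg_rel M\<close>] by simp
    qed
    show ?thesis
    proof
      assume "M \<in> cfm_lang P Sig B"
      then obtain \<rho> where run: "is_run B M \<rho>" and accg: "accepting P B M \<rho>" unfolding cfm_lang_def by blast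
      have r1: "\<rho> e \<in> tr (fst e)" if "e \<in> events M" for e
        using run that unfolding is_run_def B_def by (auto simp: events_on_iff)
      have r2: "act_label (act (\<rho> e)) = letter M e" if "e \<in> events M" for e
        using run that unfolding is_run_def by blast
      have r3: "source (\<rho> (p, 1)) = 0" if "events_on M p \<noteq> {}" for p
        using run that unfolding is_run_def B_def by simp
      have r4: "target (\<rho> e) = source (\<rho> f)" if "(e, f) \<in> proc_rel M" for e f
        using run that unfolding is_run_def by blast
      have r5: "\<exists>a. act (\<rho> e) = Internal a" if "e \<in> events M" "e \<notin> Field (msg_rel M)" for e
        using run that unfolding is_run_def by blast
      have r6: "\<exists>a b m. act (\<rho> e) = Send a m (fst f) \<and> act (\<rho> f) = Receive b m (fst e)" if "(e, f) \<in> msg_rel M" for e f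
        using run that unfolding is_run_def by blast
      define c where "c e = target (\<rho> e) - 1" for e
      have tc: "target (\<rho> e) = Suc (c e)" "c e \<in> C" if "e \<in> events M" for e
        using r1[OF that] unfolding tr_def c_def target_def by auto
      have prd: "dec (source (\<rho> e)) = prd_val M c e" if e: "e \<in> events M" for e
      proof (cases "snd e \<le> 1")
        case True
        then have "e = (fst e, 1)" using e by (auto simp: event_iff prod_eq_iff)
        moreover have "events_on M (fst e) \<noteq> {}" using e events_on_iff by blast
        ultimately have "source (\<rho> e) = 0" using r3 by metis
        then show ?thesis using True by (simp add: dec_def prd_val_def)
      next
        case False
        then have d: "((fst e, snd e - 1), e) \<in> proc_rel M" using e by (auto simp: proc_rel_iff event_iff)
        then have "source (\<rho> e) = Suc (c (fst e, snd e - 1))" using r4[OF d] tc(1) by (simp add: proc_rel_iff)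
        then show ?thesis using False by (simp add: dec_def prd_val_def)
      qed
      have "T (fst e) (letter M e) () (prd_val M c e) (snd_val M c e) (e \<in> Domain (msg_rel M)) (c e)" if e: "e \<in> events M" for e
      proof -
        obtain s a s' where \<rho>: "\<rho> e = (s, a, s')" by (metis prod_cases3)
        have sa: "source (\<rho> e) = s" "act (\<rho> e) = a" "s' = Suc (c e)" using \<rho> tc(1)[OF e] by (auto simp: source_def act_def target_def)
        have tr: "(s, a, Suc (c e)) \<in> tr (fst e)" using r1[OF e] \<rho> sa by simp
        have s: "dec s = prd_val M c e" using prd[OF e] sa by simp
        consider "e \<notin> Field (msg_rel M)" | f where "(e, f) \<in> msg_rel M" | d where "(d, e) \<in> msg_rel M"
          unfolding Field_def by blast
        then show ?thesis
        proof cases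
          case 1
          then obtain b where b: "a = Internal b" using r5 e sa by blast
          have "T (fst e) b () (dec s) None False (c e)" using tr unfolding tr_def b by auto
          moreover have "b = letter M e" using r2[OF e] sa b by simp
          moreover have "snd_val M c e = None" using 1 by (intro snd_val_None) (auto simp: Field_def)
          moreover have "e \<notin> Domain (msg_rel M)" using 1 by (auto simp: Field_def)
          ultimately show ?thesis using s by simp
        next
          case 2
          then obtain b m where b: "a = Send b m (fst f)" using r6 sa by blast
          have "T (fst e) b () (dec s) None True (c e)" using tr unfolding tr_def b by auto
          moreover have "b = letter M e" using r2[OF e] sa b by simp
          moreover have "snd_val M c e = None" using 2 one by (intro snd_val_None) blast
          moreover have "e \<in> Domain (msg_rel M)" using 2 by blast
          ultimately show ?thesis using s by simp
        next
          case 3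
          then obtain b b' m where b: "a = Receive b m (fst d)" "act (\<rho> d) = Send b' m (fst e)" using r6 sa by blast
          have de: "d \<in> events M" using msg_relD(1)[OF 3] .
          have "m = c d" using r1[OF de] b(2) tc(1)[OF de] unfolding tr_def act_def target_def by auto
          moreover have "T (fst e) b () (dec s) (Some m) False (c e)" using tr unfolding tr_def b(1) by auto
          moreover have "b = letter M e" using r2[OF e] sa b by simp
          moreover have "snd_val M c e = Some (c d)" using 3 by (rule snd_val_eq)
          moreover have "e \<notin> Domain (msg_rel M)" using 3 one by blast
          ultimately show ?thesis using s by simp
        qed
      qed
      moreover have "A (last_val M c)"
      proof -
        have "(\<lambda>p\<in>P. final_state B M \<rho> p) \<in> acc B" using accg unfolding accepting_def .
        then have "A (\<lambda>p. if p \<in> P then dec (final_state B M \<rho> p) else None)"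
          unfolding B_def by (simp add: if_distrib cong: if_cong)
        moreover have "(\<lambda>p. if p \<in> P then dec (final_state B M \<rho> p) else None) = last_val M c"
        proof
          fix p
          have ev: "events_on M p = {} \<longleftrightarrow> word M p = []"
            by (cases "word M p") (auto simp: events_on_def)
          show "(if p \<in> P then dec (final_state B M \<rho> p) else None) = last_val M c p"
            using tc(1)[OF last_event[of p]] msc_outside
            unfolding final_state_def ev last_val_def by (auto simp: dec_def B_def)
        qed
        ultimately show ?thesis by simp
      qed
      ultimately have "tiling T A C M (\<lambda>_. ()) c" unfolding tiling_def using tc(2) by blast
      then show "Q M" using Q[OF M, of "\<lambda>_. ()"] by blast
    next
      assume "Q M"
      then obtain c where c: "tiling T A C M (\<lambda>_. ()) c" using Q[OF M, of "\<lambda>_. ()"] by blast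
      have cC: "c e \<in> C" and cT: "T (fst e) (letter M e) () (prd_val M c e) (snd_val M c e) (e \<in> Domain (msg_rel M)) (c e)"
        if "e \<in> events M" for e using c that unfolding tiling_def by auto
      define enc where "enc x = (case x of None \<Rightarrow> 0 | Some y \<Rightarrow> Suc y)" for x :: "nat option"
      define rcv where "rcv e = (THE f. (e, f) \<in> msg_rel M)" for e
      define sdr where "sdr e = (THE d. (d, e) \<in> msg_rel M)" for e
      have rcv: "rcv e = f" if "(e, f) \<in> msg_rel M" for e f
        unfolding rcv_def using that msg_receiver_unique by blast
      have sdr: "sdr e = d" if "(d, e) \<in> msg_rel M" for e d
        unfolding sdr_def using that msg_sender_unique by blast
      define ac where "ac e = (if e \<in> Domain (msg_rel M) then Send (letter M e) (c e) (fst (rcv e))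
          else if e \<in> Range (msg_rel M) then Receive (letter M e) (c (sdr e)) (fst (sdr e))
          else Internal (letter M e))" for e
      define \<rho> where "\<rho> e = (enc (prd_val M c e), ac e, Suc (c e))" for e
      have dec: "dec (enc x) = x" for x by (cases x) (auto simp: dec_def enc_def)
      have encC: "enc (prd_val M c e) \<in> insert 0 (Suc ` C)" if "e \<in> events M" for e
      proof (cases "snd e \<le> 1")
        case False
        then have "(fst e, snd e - 1) \<in> events M" using that by (auto simp: event_iff)
        then show ?thesis using cC False by (auto simp: prd_val_def enc_def)
      qed (auto simp: prd_val_def enc_def)
      have trans: "\<rho> e \<in> tr (fst e)" if e: "e \<in> events M" for e
      proof -
        consider "e \<notin> Domain (msg_rel M)" "e \<notin> Range (msg_rel M)" | f where "(e, f) \<in> msg_rel M" | d where "(d, e) \<in> msg_rel M"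
          by blast
        then show ?thesis
        proof cases
          case 1
          then have "snd_val M c e = None" by (intro snd_val_None) blast
          then show ?thesis using cT[OF e] cC[OF e] encC[OF e] lets[OF e] 1 unfolding \<rho>_def ac_def tr_def by (auto simp: dec)
        next
          case 2
          have "snd_val M c e = None" using 2 one by (intro snd_val_None) blast
          moreover have "fst f \<in> P - {fst e}" using oth(1)[OF 2] .
          moreover have "ac e = Send (letter M e) (c e) (fst f)" using 2 rcv[OF 2] unfolding ac_def by auto
          moreover have "e \<in> Domain (msg_rel M)" using 2 by blast
          ultimately show ?thesis using cT[OF e] cC[OF e] encC[OF e] lets[OF e] unfolding \<rho>_def tr_def by (auto simp: dec)
        next
          case 3
          have "snd_val M c e = Some (c d)" using 3 by (rule snd_val_eq)
          moreover have "fst d \<in> P - {fst e}" using oth(2)[OF 3] .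
          moreover have nd: "e \<notin> Domain (msg_rel M)" using 3 one by blast
          moreover have "ac e = Receive (letter M e) (c d) (fst d)" using 3 sdr[OF 3] nd unfolding ac_def by auto
          ultimately show ?thesis using cT[OF e] cC[OF e] cC[OF msg_relD(1)[OF 3]] encC[OF e] lets[OF e]
            unfolding \<rho>_def tr_def by (auto simp: dec)
        qed
      qed
      have "is_run B M \<rho>"
        unfolding is_run_def
      proof (intro conjI allI ballI impI)
        show "\<rho> e \<in> trans_on B p" if "e \<in> events_on M p" for p e
          using trans[of e] that unfolding B_def by (auto simp: events_on_iff)
        show "act_label (act (\<rho> e)) = letter M e" for e
          unfolding \<rho>_def act_def ac_def by simp
        show "source (\<rho> (p, 1)) = init B p" for p
          unfolding \<rho>_def source_def B_def by (simp add: prd_val_def enc_def)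
        show "case x of (e, f) \<Rightarrow> target (\<rho> e) = source (\<rho> f)" if "x \<in> proc_rel M" for x
          using that prd_val_eq[of "fst x" "snd x" c] unfolding \<rho>_def target_def source_def
          by (cases x) (simp add: enc_def)
        show "\<exists>a. act (\<rho> e) = Internal a" if "e \<in> events M - Field (msg_rel M)" for e
          using that unfolding \<rho>_def act_def ac_def Field_def by auto
        show "case x of (e, f) \<Rightarrow> \<exists>a b m. act (\<rho> e) = Send a m (fst f) \<and> act (\<rho> f) = Receive b m (fst e)"
          if x: "x \<in> msg_rel M" for x
        proof -
          obtain e f where ef: "x = (e, f)" "(e, f) \<in> msg_rel M" using x by (cases x) auto
          have "f \<notin> Domain (msg_rel M)" using ef(2) one by blast
          then have "act (\<rho> e) = Send (letter M e) (c e) (fst f)" "act (\<rho> f) = Receive (letter M f) (c e) (fst e)"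
            using ef(2) rcv[OF ef(2)] sdr[OF ef(2)] unfolding \<rho>_def act_def ac_def by auto
          then show ?thesis using ef(1) by auto
        qed
      qed
      moreover have "accepting P B M \<rho>"
      proof -
        have ev: "events_on M p = {} \<longleftrightarrow> word M p = []" for p
          by (cases "word M p") (auto simp: events_on_def)
        have fs: "final_state B M \<rho> p = enc (last_val M c p)" for p
          unfolding final_state_def ev last_val_def by (simp add: B_def \<rho>_def target_def enc_def)
        have "enc (last_val M c p) \<in> insert 0 (Suc ` C)" for p
          using cC[OF last_event[of p]] by (auto simp: last_val_def enc_def)
        moreover have "(\<lambda>p. if p \<in> P then last_val M c p else None) = last_val M c"
          using msc_outside by (auto simp: last_val_def)
        moreover have "A (last_val M c)" using c unfolding tiling_def by blast
        ultimately show ?thesis unfolding accepting_def fs unfolding B_def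
          by (simp add: dec cong: if_cong)
      qed
      ultimately show "M \<in> cfm_lang P Sig B" unfolding cfm_lang_def using M by blast
    qed
  qed
  then have "cfm_lang P Sig B = {M. is_msc P Sig M \<and> Q M}" unfolding cfm_lang_def by blast
  then show ?thesis using cfm by blast
qed

lemma emso2_to_cfm:
  assumes "sentence P Sig \<phi>" "emso2 B \<phi>"
  shows "\<exists>A :: ('p, 'a, nat, nat) cfm. is_cfm P Sig A \<and> cfm_lang P Sig A = mso_lang P Sig \<phi>"
  using recog_cfm[OF recog_sentence[OF assms]] unfolding mso_lang_def .

end

section \<open>From automata to formulas\<close>

abbreviation all_rels :: "binpred set" where
  "all_rels \<equiv> {Proc_Edge, Msg_Edge, Causal_Le}"

definition Fls :: "('p, 'a) mso" where
  "Fls = ExFO 0 (Neg (Equal 0 0))"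

definition And :: "('p, 'a) mso \<Rightarrow> ('p, 'a) mso \<Rightarrow> ('p, 'a) mso" where
  "And \<phi> \<psi> = Neg (Or (Neg \<phi>) (Neg \<psi>))"

definition AllFO :: "nat \<Rightarrow> ('p, 'a) mso \<Rightarrow> ('p, 'a) mso" where
  "AllFO x \<phi> = Neg (ExFO x (Neg \<phi>))"

text \<open>The enumeration of \<open>I\<close> is an arbitrary choice; for finite \<open>I\<close>,
  neither the semantics nor the syntactic conditions depend on it.\<close>

definition Disj :: "'i set \<Rightarrow> ('i \<Rightarrow> ('p, 'a) mso) \<Rightarrow> ('p, 'a) mso" where
  "Disj I f = foldr (\<lambda>i. Or (f i)) (SOME xs. set xs = I) Fls"

definition Conj :: "'i set \<Rightarrow> ('i \<Rightarrow> ('p, 'a) mso) \<Rightarrow> ('p, 'a) mso" where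
  "Conj I f = Neg (Disj I (\<lambda>i. Neg (f i)))"

lemma set_some: "finite I \<Longrightarrow> set (SOME xs. set xs = I) = I"
  by (rule someI_ex) (rule finite_list)

lemma sat_Fls [simp]: "\<not> sat M v V Fls"
  by (simp add: Fls_def)

lemma sat_And [simp]: "sat M v V (And \<phi> \<psi>) \<longleftrightarrow> sat M v V \<phi> \<and> sat M v V \<psi>"
  by (simp add: And_def)

lemma sat_AllFO [simp]: "sat M v V (AllFO x \<phi>) \<longleftrightarrow> (\<forall>e\<in>events M. sat M (v(x := e)) V \<phi>)"
  by (simp add: AllFO_def)

lemma sat_Disj:
  assumes "finite I"
  shows "sat M v V (Disj I f) \<longleftrightarrow> (\<exists>i\<in>I. sat M v V (f i))"
proof -
  have "sat M v V (foldr (\<lambda>i. Or (f i)) xs Fls) \<longleftrightarrow> (\<exists>i\<in>set xs. sat M v V (f i))" for xs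
    by (induction xs) auto
  then show ?thesis unfolding Disj_def by (simp add: set_some[OF assms])
qed

lemma sat_Conj: "finite I \<Longrightarrow> sat M v V (Conj I f) \<longleftrightarrow> (\<forall>i\<in>I. sat M v V (f i))"
  by (simp add: Conj_def sat_Disj)

lemma sat_if_Fls: "sat M v V (if b then \<phi> else Fls) \<longleftrightarrow> b \<and> sat M v V \<phi>"
  by simp

lemma sat_foldr_ExSO:
  "sat M v V (foldr ExSO Xs \<psi>) \<longleftrightarrow>
     (\<exists>V'. (\<forall>X\<in>set Xs. V' X \<subseteq> events M) \<and> (\<forall>X. X \<notin> set Xs \<longrightarrow> V' X = V X) \<and> sat M v V' \<psi>)"
proof (induction Xs arbitrary: V)
  case Nil
  have "V' = V" if "\<forall>X. V' X = V X" for V' using that by blast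
  then show ?case by auto
next
  case (Cons Y Xs)
  show ?case
  proof
    assume "sat M v V (foldr ExSO (Y # Xs) \<psi>)"
    then obtain F V' where "F \<subseteq> events M" "\<forall>X\<in>set Xs. V' X \<subseteq> events M"
      "\<forall>X. X \<notin> set Xs \<longrightarrow> V' X = (V(Y := F)) X" "sat M v V' \<psi>" using Cons.IH by auto
    moreover from this have "V' Y \<subseteq> events M" by (cases "Y \<in> set Xs") auto
    ultimately show "\<exists>V'. (\<forall>X\<in>set (Y # Xs). V' X \<subseteq> events M) \<and> (\<forall>X. X \<notin> set (Y # Xs) \<longrightarrow> V' X = V X) \<and> sat M v V' \<psi>"
      by (intro exI[of _ V']) auto
  next
    assume "\<exists>V'. (\<forall>X\<in>set (Y # Xs). V' X \<subseteq> events M) \<and> (\<forall>X. X \<notin> set (Y # Xs) \<longrightarrow> V' X = V X) \<and> sat M v V' \<psi>"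
    then obtain V' where V': "\<forall>X\<in>set (Y # Xs). V' X \<subseteq> events M" "\<forall>X. X \<notin> set (Y # Xs) \<longrightarrow> V' X = V X" "sat M v V' \<psi>"
      by blast
    have "\<exists>V''. (\<forall>X\<in>set Xs. V'' X \<subseteq> events M) \<and> (\<forall>X. X \<notin> set Xs \<longrightarrow> V'' X = (V(Y := V' Y)) X) \<and> sat M v V'' \<psi>"
      using V' by (intro exI[of _ V']) auto
    then have "sat M v (V(Y := V' Y)) (foldr ExSO Xs \<psi>)" using Cons.IH by blast
    then show "sat M v V (foldr ExSO (Y # Xs) \<psi>)" using V'(1) by (auto intro: exI[of _ "V' Y"])
  qed
qed

text \<open>The side conditions behind \<open>sentence\<close> and \<open>emso2\<close> are gathered
  so that one pass of introduction rules proves them together.\<close>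

definition admissible :: "'p set \<Rightarrow> 'a set \<Rightarrow> nat \<Rightarrow> nat set \<Rightarrow> ('p, 'a) mso \<Rightarrow> bool" where
  "admissible P Sig n Z \<phi> \<longleftrightarrow> fo2 all_rels \<phi> \<and> procs \<phi> \<subseteq> P \<and> letters \<phi> \<subseteq> Sig \<and>
     free_so \<phi> \<subseteq> {..<n} \<and> free_fo \<phi> \<subseteq> Z"

lemma admissible_intros:
  "p \<in> P \<Longrightarrow> x \<in> Z \<Longrightarrow> x \<in> {0, 1} \<Longrightarrow> admissible P Sig n Z (OnProc p x)"
  "a \<in> Sig \<Longrightarrow> x \<in> Z \<Longrightarrow> x \<in> {0, 1} \<Longrightarrow> admissible P Sig n Z (HasLetter a x)"
  "X < n \<Longrightarrow> x \<in> Z \<Longrightarrow> x \<in> {0, 1} \<Longrightarrow> admissible P Sig n Z (InSet x X)"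
  "x \<in> Z \<Longrightarrow> y \<in> Z \<Longrightarrow> x \<in> {0, 1} \<Longrightarrow> y \<in> {0, 1} \<Longrightarrow> r \<in> all_rels \<Longrightarrow> admissible P Sig n Z (Rel r x y)"
  "admissible P Sig n Z \<phi> \<Longrightarrow> admissible P Sig n Z \<psi> \<Longrightarrow> admissible P Sig n Z (Or \<phi> \<psi>)"
  "admissible P Sig n Z \<phi> \<Longrightarrow> admissible P Sig n Z \<psi> \<Longrightarrow> admissible P Sig n Z (And \<phi> \<psi>)"
  "admissible P Sig n Z \<phi> \<Longrightarrow> admissible P Sig n Z (Neg \<phi>)"
  "x \<in> {0, 1} \<Longrightarrow> admissible P Sig n (insert x Z) \<phi> \<Longrightarrow> admissible P Sig n Z (ExFO x \<phi>)"
  "x \<in> {0, 1} \<Longrightarrow> admissible P Sig n (insert x Z) \<phi> \<Longrightarrow> admissible P Sig n Z (AllFO x \<phi>)"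
  "admissible P Sig n Z Fls"
  unfolding admissible_def by (auto simp: And_def AllFO_def Fls_def)

lemma admissible_Disj:
  assumes "finite I" "\<And>i. i \<in> I \<Longrightarrow> admissible P Sig n Z (f i)"
  shows "admissible P Sig n Z (Disj I f)"
proof -
  have *: "(\<And>i. i \<in> set xs \<Longrightarrow> admissible P Sig n Z (f i)) \<Longrightarrow> admissible P Sig n Z (foldr (\<lambda>i. Or (f i)) xs Fls)" for xs
    by (induction xs) (auto intro: admissible_intros)
  show ?thesis unfolding Disj_def by (rule *) (simp add: set_some assms)
qed

lemma admissible_Conj:
  "finite I \<Longrightarrow> (\<And>i. i \<in> I \<Longrightarrow> admissible P Sig n Z (f i)) \<Longrightarrow> admissible P Sig n Z (Conj I f)"
  unfolding Conj_def by (intro admissible_intros admissible_Disj)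

lemma ball_pairs:
  assumes "\<And>x y. (x, y) \<in> R \<Longrightarrow> x \<in> E \<and> y \<in> E"
  shows "(\<forall>x\<in>E. \<forall>y\<in>E. (x, y) \<in> R \<longrightarrow> Q x y) \<longleftrightarrow> (\<forall>(x, y)\<in>R. Q x y)"
  using assms by blast

context alphabets
begin

text \<open>Set variables are indexed by pairs of a process and a transition, since processes may
  share transitions. \<open>\<psi>1\<close> and \<open>\<psi>1'\<close> make the sets a partition
  that gives each event a transition of its own process with the right letter, so every model comes
  from a map \<open>\<rho>\<close>. The other conjuncts state the remaining run conditions and
  acceptance.\<close>

lemma cfm_to_emso2:
  assumes A: "is_cfm P Sig (A :: ('p, 'a, 's, 'm) cfm)"
  shows "\<exists>\<phi>. sentence P Sig \<phi> \<and> emso2 all_rels \<phi> \<and> cfm_lang P Sig A = mso_lang P Sig \<phi>"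
proof -
  define TT where "TT = Sigma P (trans_on A)"
  have sub: "trans_on A p \<subseteq> states A p \<times> actions_on P Sig (msgs A) p \<times> states A p" "finite (states A p)" if "p \<in> P" for p
    using A that unfolding is_cfm_def by blast+
  have fin_act: "finite (actions_on P Sig (msgs A) p)" for p
  proof -
    have "actions_on P Sig (msgs A) p \<subseteq> Internal ` Sig \<union> (\<lambda>(a, m, q). Send a m q) ` (Sig \<times> msgs A \<times> P)
        \<union> (\<lambda>(a, m, q). Receive a m q) ` (Sig \<times> msgs A \<times> P)"
      unfolding actions_on_def by (auto simp: image_iff)
    moreover have "finite (msgs A)" using A unfolding is_cfm_def by blast
    ultimately show ?thesis using finite_Sig finite_P by (auto intro: finite_subset)
  qed
  have fin: "finite TT"
    unfolding TT_def
  proof (rule finite_SigmaI[OF finite_P])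
    fix p assume p: "p \<in> P"
    have "finite (states A p \<times> actions_on P Sig (msgs A) p \<times> states A p)" using sub(2)[OF p] fin_act by simp
    then show "finite (trans_on A p)" using sub(1)[OF p] finite_subset by blast
  qed
  have fin_acc: "finite (acc A)"
  proof (rule finite_subset)
    show "acc A \<subseteq> (\<Pi>\<^sub>E p\<in>P. states A p)" using A unfolding is_cfm_def by blast
    show "finite (\<Pi>\<^sub>E p\<in>P. states A p)" by (rule finite_PiE[OF finite_P]) (rule sub(2))
  qed
  obtain n and ix :: "'p \<times> ('p, 'a, 's, 'm) transition \<Rightarrow> nat" where ix: "ix ` TT = {i. i < n}" "inj_on ix TT"
    using finite_imp_inj_to_nat_seg[OF fin] by blast
  have ixn: "ix i < n" if "i \<in> TT" for i using ix(1) that by blast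
  have TTp: "fst i \<in> P" "act_label (act (snd i)) \<in> Sig" if "i \<in> TT" for i
  proof -
    show p: "fst i \<in> P" using that unfolding TT_def by auto
    have "act (snd i) \<in> actions_on P Sig (msgs A) (fst i)" using that sub(1)[OF p] unfolding TT_def act_def by auto
    then show "act_label (act (snd i)) \<in> Sig" unfolding actions_on_def by auto
  qed
  define S2 where "S2 = {i \<in> TT. source (snd i) = init A (fst i)}"
  define S3 where "S3 = {ij \<in> TT \<times> TT. target (snd (fst ij)) = source (snd (snd ij))}"
  define S4 where "S4 = {i \<in> TT. \<exists>a. act (snd i) = Internal a}"
  define S5 where "S5 = {ij \<in> TT \<times> TT. \<exists>a b m. act (snd (fst ij)) = Send a m (fst (snd ij)) \<and>
      act (snd (snd ij)) = Receive b m (fst (fst ij))}"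
  define S6 where "S6 p s = {i \<in> TT. fst i = p \<and> target (snd i) = s}" for p s
  have fins: "finite S2" "finite S3" "finite S4" "finite S5" "finite (S6 p s)" for p s
    unfolding S2_def S3_def S4_def S5_def S6_def using fin by auto
  define \<psi>1 :: "('p, 'a) mso" where "\<psi>1 = AllFO 0 (Disj TT (\<lambda>i. And (OnProc (fst i) 0)
      (And (HasLetter (act_label (act (snd i))) 0) (InSet 0 (ix i)))))"
  define \<psi>1' :: "('p, 'a) mso" where "\<psi>1' = Conj {ij \<in> TT \<times> TT. fst ij \<noteq> snd ij}
      (\<lambda>ij. AllFO 0 (Neg (And (InSet 0 (ix (fst ij))) (InSet 0 (ix (snd ij))))))"
  define \<psi>2 :: "('p, 'a) mso" where "\<psi>2 = AllFO 0 (Or (ExFO 1 (Rel Proc_Edge 1 0)) (Disj S2 (\<lambda>i. InSet 0 (ix i))))"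
  define \<psi>3 :: "('p, 'a) mso" where "\<psi>3 = AllFO 0 (AllFO 1 (Or (Neg (Rel Proc_Edge 0 1))
      (Disj S3 (\<lambda>ij. And (InSet 0 (ix (fst ij))) (InSet 1 (ix (snd ij)))))))"
  define \<psi>4 :: "('p, 'a) mso" where "\<psi>4 = AllFO 0 (Or (ExFO 1 (Or (Rel Msg_Edge 0 1) (Rel Msg_Edge 1 0)))
      (Disj S4 (\<lambda>i. InSet 0 (ix i))))"
  define \<psi>5 :: "('p, 'a) mso" where "\<psi>5 = AllFO 0 (AllFO 1 (Or (Neg (Rel Msg_Edge 0 1))
      (Disj S5 (\<lambda>ij. And (InSet 0 (ix (fst ij))) (InSet 1 (ix (snd ij)))))))"
  \<comment> \<open>The last event of a process is the one without process successor. For a process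
    without events the state is \<open>init A p\<close>, and its comparison with \<open>s p\<close>
    is made while the formula is built.\<close>
  define \<psi>6 :: "('p, 'a) mso" where "\<psi>6 = Disj (acc A) (\<lambda>s. Conj P (\<lambda>p.
      Or (ExFO 0 (And (OnProc p 0) (And (Neg (ExFO 1 (Rel Proc_Edge 0 1))) (Disj (S6 p (s p)) (\<lambda>i. InSet 0 (ix i))))))
         (if init A p = s p then Neg (ExFO 0 (OnProc p 0)) else Fls)))"
  define \<psi> where "\<psi> = And \<psi>1 (And \<psi>1' (And \<psi>2 (And \<psi>3 (And \<psi>4 (And \<psi>5 \<psi>6)))))"
  define \<phi> where "\<phi> = foldr ExSO [0..<n] \<psi>"
  have fin1': "finite {ij \<in> TT \<times> TT. fst ij \<noteq> snd ij}" using fin by simp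
  have S_TT: "i \<in> TT" if "i \<in> S2 \<or> i \<in> S4 \<or> i \<in> S6 p s" for i p s
    using that unfolding S2_def S4_def S6_def by blast
  have S_TT2: "fst ij \<in> TT \<and> snd ij \<in> TT" if "ij \<in> S3 \<or> ij \<in> S5 \<or> ij \<in> {ij \<in> TT \<times> TT. fst ij \<noteq> snd ij}" for ij
    using that unfolding S3_def S5_def by auto
  have adm: "admissible P Sig n {} \<psi>"
  proof -
    have "admissible P Sig n {} \<psi>1" unfolding \<psi>1_def
      by (intro admissible_intros admissible_Disj fin) (auto simp: TTp ixn)
    moreover have "admissible P Sig n {} \<psi>1'" unfolding \<psi>1'_def
      by (intro admissible_intros admissible_Conj fin1') (use S_TT2 ixn in auto)
    moreover have "admissible P Sig n {} \<psi>2" unfolding \<psi>2_def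
      by (intro admissible_intros admissible_Disj fins) (use S_TT ixn in auto)
    moreover have "admissible P Sig n {} \<psi>3" unfolding \<psi>3_def
      by (intro admissible_intros admissible_Disj fins) (use S_TT2 ixn in auto)
    moreover have "admissible P Sig n {} \<psi>4" unfolding \<psi>4_def
      by (intro admissible_intros admissible_Disj fins) (use S_TT ixn in auto)
    moreover have "admissible P Sig n {} \<psi>5" unfolding \<psi>5_def
      by (intro admissible_intros admissible_Disj fins) (use S_TT2 ixn in auto)
    moreover have "admissible P Sig n {} \<psi>6" unfolding \<psi>6_def
    proof (intro admissible_Disj fin_acc admissible_Conj finite_P)
      fix s p assume p: "p \<in> P"
      have n6: "ix i < n" if "i \<in> S6 p (s p)" for i using that ixn unfolding S6_def by blast
      have "admissible P Sig n {} (ExFO 0 (And (OnProc p 0) (And (Neg (ExFO 1 (Rel Proc_Edge 0 1)))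
         (Disj (S6 p (s p)) (\<lambda>i. InSet 0 (ix i))))))"
        by (intro admissible_intros admissible_Disj fins) (simp_all add: n6 p)
      moreover have "admissible P Sig n {} (Neg (ExFO 0 (OnProc p 0)))"
        by (intro admissible_intros) (simp_all add: p)
      ultimately show "admissible P Sig n {} (Or (ExFO 0 (And (OnProc p 0) (And (Neg (ExFO 1 (Rel Proc_Edge 0 1)))
         (Disj (S6 p (s p)) (\<lambda>i. InSet 0 (ix i)))))) (if init A p = s p then Neg (ExFO 0 (OnProc p 0)) else Fls))"
        by (cases "init A p = s p") (simp_all add: admissible_intros)
    qed
    ultimately show ?thesis unfolding \<psi>_def by (intro admissible_intros)
  qed
  have sent: "sentence P Sig \<phi>"
  proof -
    have "procs (foldr ExSO Xs \<psi>) = procs \<psi>" "letters (foldr ExSO Xs \<psi>) = letters \<psi>"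
      "free_so (foldr ExSO Xs \<psi>) = free_so \<psi> - set Xs" for Xs
      by (induction Xs) auto
    then show ?thesis using adm unfolding sentence_def \<phi>_def admissible_def
      by (auto simp: free_fo_foldr)
  qed
  have emso: "emso2 all_rels \<phi>" using adm unfolding emso2_def \<phi>_def admissible_def by blast
  \<comment> \<open>\<open>V\<close> encodes \<open>\<rho>\<close>. For such \<open>V\<close> the
    conjuncts match the run conditions one by one (\<open>sem\<close>), and \<open>rep_ex\<close>
    shows that every model of \<open>\<psi>\<close> is of this kind.\<close>
  define rep where "rep M V \<rho> \<longleftrightarrow> (\<forall>e\<in>events M. (fst e, \<rho> e) \<in> TT \<and> (\<forall>i\<in>TT. e \<in> V (ix i) \<longleftrightarrow> i = (fst e, \<rho> e)))"
    for M :: "('p, 'a) msc" and V \<rho>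
  have sem: "sat M v V \<psi> \<longleftrightarrow> is_run A M \<rho> \<and> accepting P A M \<rho>" if M: "is_msc P Sig M" and rep: "rep M V \<rho>" for M v V \<rho>
  proof -
    interpret msc_loc P Sig M using M by (rule msc_locI)
    have mem: "e \<in> V (ix i) \<longleftrightarrow> i = (fst e, \<rho> e)" if "e \<in> events M" "i \<in> TT" for e i using rep that unfolding rep_def by blast
    have tr: "(fst e, \<rho> e) \<in> TT" "\<rho> e \<in> trans_on A (fst e)" if "e \<in> events M" for e
      using rep that unfolding rep_def TT_def by auto
    have one: "(\<exists>i\<in>S. e \<in> V (ix i)) \<longleftrightarrow> (fst e, \<rho> e) \<in> S" if "e \<in> events M" "S \<subseteq> TT" for e S
      using mem that tr by blast
    have two: "(\<exists>ij\<in>S. e \<in> V (ix (fst ij)) \<and> f \<in> V (ix (snd ij))) \<longleftrightarrow> ((fst e, \<rho> e), (fst f, \<rho> f)) \<in> S"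
      if "e \<in> events M" "f \<in> events M" "S \<subseteq> TT \<times> TT" for e f S
    proof
      assume "\<exists>ij\<in>S. e \<in> V (ix (fst ij)) \<and> f \<in> V (ix (snd ij))"
      then obtain ij where ij: "ij \<in> S" "e \<in> V (ix (fst ij))" "f \<in> V (ix (snd ij))" by blast
      then have "fst ij \<in> TT" "snd ij \<in> TT" using that(3) by auto
      then have "fst ij = (fst e, \<rho> e)" "snd ij = (fst f, \<rho> f)" using mem that ij by auto
      then show "((fst e, \<rho> e), (fst f, \<rho> f)) \<in> S" using ij(1) by (metis prod.collapse)
    next
      assume "((fst e, \<rho> e), (fst f, \<rho> f)) \<in> S"
      then show "\<exists>ij\<in>S. e \<in> V (ix (fst ij)) \<and> f \<in> V (ix (snd ij))"
        using mem tr that by (intro bexI[of _ "((fst e, \<rho> e), (fst f, \<rho> f))"]) auto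
    qed
    have subs: "S2 \<subseteq> TT" "S3 \<subseteq> TT \<times> TT" "S4 \<subseteq> TT" "S5 \<subseteq> TT \<times> TT" "S6 p s \<subseteq> TT" for p s
      unfolding S2_def S3_def S4_def S5_def S6_def by auto
    have s1: "sat M v V \<psi>1 \<longleftrightarrow> (\<forall>e\<in>events M. act_label (act (\<rho> e)) = letter M e)"
    proof -
      have "(\<exists>i\<in>TT. e \<in> events_on M (fst i) \<and> letter M e = act_label (act (snd i)) \<and> e \<in> V (ix i)) \<longleftrightarrow>
         act_label (act (\<rho> e)) = letter M e" if e: "e \<in> events M" for e
      proof
        assume "\<exists>i\<in>TT. e \<in> events_on M (fst i) \<and> letter M e = act_label (act (snd i)) \<and> e \<in> V (ix i)"
        then show "act_label (act (\<rho> e)) = letter M e" using mem[OF e] by auto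
      next
        assume "act_label (act (\<rho> e)) = letter M e"
        then show "\<exists>i\<in>TT. e \<in> events_on M (fst i) \<and> letter M e = act_label (act (snd i)) \<and> e \<in> V (ix i)"
          using mem[OF e tr(1)[OF e]] tr(1)[OF e] e by (intro bexI[of _ "(fst e, \<rho> e)"]) (auto simp: events_on_iff)
      qed
      then show ?thesis unfolding \<psi>1_def by (simp add: sat_Disj[OF fin])
    qed
    have s1': "sat M v V \<psi>1'"
      unfolding \<psi>1'_def sat_Conj[OF fin1']
    proof
      fix ij assume ij: "ij \<in> {ij \<in> TT \<times> TT. fst ij \<noteq> snd ij}"
      then have ne: "fst ij \<in> TT" "snd ij \<in> TT" "fst ij \<noteq> snd ij" by auto
      have "\<not> (e \<in> V (ix (fst ij)) \<and> e \<in> V (ix (snd ij)))" if e: "e \<in> events M" for e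
        using mem[OF e ne(1)] mem[OF e ne(2)] ne(3) by metis
      then show "sat M v V (AllFO 0 (Neg (And (InSet 0 (ix (fst ij))) (InSet 0 (ix (snd ij))))))" by simp
    qed
    have s2: "sat M v V \<psi>2 \<longleftrightarrow> (\<forall>p. events_on M p \<noteq> {} \<longrightarrow> source (\<rho> (p, 1)) = init A p)"
    proof -
      have "sat M v V \<psi>2 \<longleftrightarrow> (\<forall>e\<in>events M. (\<exists>d\<in>events M. (d, e) \<in> proc_rel M) \<or> source (\<rho> e) = init A (fst e))"
        unfolding \<psi>2_def using one[OF _ subs(1)] tr(1) by (simp add: sat_Disj[OF fins(1)]) (simp add: S2_def)
      also have "\<dots> \<longleftrightarrow> (\<forall>p. events_on M p \<noteq> {} \<longrightarrow> source (\<rho> (p, 1)) = init A p)"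
      proof
        assume h: "\<forall>e\<in>events M. (\<exists>d\<in>events M. (d, e) \<in> proc_rel M) \<or> source (\<rho> e) = init A (fst e)"
        show "\<forall>p. events_on M p \<noteq> {} \<longrightarrow> source (\<rho> (p, 1)) = init A p"
        proof (intro allI impI)
          fix p assume "events_on M p \<noteq> {}"
          then have e: "(p, 1) \<in> events M" by (auto simp: events_on_def event_iff)
          have "\<not> (\<exists>d\<in>events M. (d, (p, 1)) \<in> proc_rel M)" by (auto simp: proc_rel_iff event_iff)
          then show "source (\<rho> (p, 1)) = init A p" using h e by force
        qed
      next
        assume h: "\<forall>p. events_on M p \<noteq> {} \<longrightarrow> source (\<rho> (p, 1)) = init A p"
        show "\<forall>e\<in>events M. (\<exists>d\<in>events M. (d, e) \<in> proc_rel M) \<or> source (\<rho> e) = init A (fst e)"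
        proof
          fix e assume e: "e \<in> events M"
          show "(\<exists>d\<in>events M. (d, e) \<in> proc_rel M) \<or> source (\<rho> e) = init A (fst e)"
          proof (cases "snd e \<le> 1")
            case True
            then have "e = (fst e, 1)" using e by (auto simp: event_iff prod_eq_iff)
            moreover have "events_on M (fst e) \<noteq> {}" using e events_on_iff by blast
            ultimately show ?thesis using h by metis
          next
            case False
            then have "((fst e, snd e - 1), e) \<in> proc_rel M" using e by (auto simp: proc_rel_iff event_iff)
            then show ?thesis using proc_rel_iff by blast
          qed
        qed
      qed
      finally show ?thesis .
    qed
    have s3: "sat M v V \<psi>3 \<longleftrightarrow> (\<forall>(e, f)\<in>proc_rel M. target (\<rho> e) = source (\<rho> f))"
    proof -
      have "sat M v V \<psi>3 \<longleftrightarrow> (\<forall>e\<in>events M. \<forall>f\<in>events M. (e, f) \<in> proc_rel M \<longrightarrow> ((fst e, \<rho> e), (fst f, \<rho> f)) \<in> S3)"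
      proof -
        have "sat M v V \<psi>3 \<longleftrightarrow> (\<forall>e\<in>events M. \<forall>f\<in>events M. (e, f) \<notin> proc_rel M \<or>
            (\<exists>ij\<in>S3. e \<in> V (ix (fst ij)) \<and> f \<in> V (ix (snd ij))))"
          unfolding \<psi>3_def by (simp add: sat_Disj[OF fins(2)])
        then show ?thesis using two[OF _ _ subs(2)] by metis
      qed
      also have "\<dots> \<longleftrightarrow> (\<forall>e\<in>events M. \<forall>f\<in>events M. (e, f) \<in> proc_rel M \<longrightarrow> target (\<rho> e) = source (\<rho> f))"
        using tr(1) by (simp add: S3_def)
      also have "\<dots> \<longleftrightarrow> (\<forall>(e, f)\<in>proc_rel M. target (\<rho> e) = source (\<rho> f))"
        by (rule ball_pairs) (simp add: proc_rel_iff)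
      finally show ?thesis .
    qed
    have s4: "sat M v V \<psi>4 \<longleftrightarrow> (\<forall>e\<in>events M - Field (msg_rel M). \<exists>a. act (\<rho> e) = Internal a)"
    proof -
      have "sat M v V \<psi>4 \<longleftrightarrow> (\<forall>e\<in>events M. (\<exists>d\<in>events M. (e, d) \<in> msg_rel M \<or> (d, e) \<in> msg_rel M) \<or> (\<exists>a. act (\<rho> e) = Internal a))"
        unfolding \<psi>4_def using one[OF _ subs(3)] tr(1) by (simp add: sat_Disj[OF fins(3)]) (simp add: S4_def)
      moreover have "(\<exists>d\<in>events M. (e, d) \<in> msg_rel M \<or> (d, e) \<in> msg_rel M) \<longleftrightarrow> e \<in> Field (msg_rel M)" for e
        unfolding Field_def using msg_relD(1,2) by blast
      ultimately show ?thesis by auto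
    qed
    have s5: "sat M v V \<psi>5 \<longleftrightarrow> (\<forall>(e, f)\<in>msg_rel M. \<exists>a b m. act (\<rho> e) = Send a m (fst f) \<and> act (\<rho> f) = Receive b m (fst e))"
    proof -
      have "sat M v V \<psi>5 \<longleftrightarrow> (\<forall>e\<in>events M. \<forall>f\<in>events M. (e, f) \<in> msg_rel M \<longrightarrow> ((fst e, \<rho> e), (fst f, \<rho> f)) \<in> S5)"
      proof -
        have "sat M v V \<psi>5 \<longleftrightarrow> (\<forall>e\<in>events M. \<forall>f\<in>events M. (e, f) \<notin> msg_rel M \<or>
            (\<exists>ij\<in>S5. e \<in> V (ix (fst ij)) \<and> f \<in> V (ix (snd ij))))"
          unfolding \<psi>5_def by (simp add: sat_Disj[OF fins(4)])
        then show ?thesis using two[OF _ _ subs(4)] by metis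
      qed
      also have "\<dots> \<longleftrightarrow> (\<forall>e\<in>events M. \<forall>f\<in>events M. (e, f) \<in> msg_rel M \<longrightarrow>
          (\<exists>a b m. act (\<rho> e) = Send a m (fst f) \<and> act (\<rho> f) = Receive b m (fst e)))"
        using tr(1) by (simp add: S5_def)
      also have "\<dots> \<longleftrightarrow> (\<forall>(e, f)\<in>msg_rel M. \<exists>a b m. act (\<rho> e) = Send a m (fst f) \<and> act (\<rho> f) = Receive b m (fst e))"
        by (rule ball_pairs) (auto dest: msg_relD(1,2))
      finally show ?thesis .
    qed
    have s6: "sat M v V \<psi>6 \<longleftrightarrow> accepting P A M \<rho>"
    proof -
      have fs: "(\<exists>e\<in>events M. e \<in> events_on M p \<and> \<not> (\<exists>f\<in>events M. (e, f) \<in> proc_rel M) \<and> (\<exists>i\<in>S6 p x. e \<in> V (ix i))) \<or>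
          (init A p = x \<and> \<not> (\<exists>e\<in>events M. e \<in> events_on M p)) \<longleftrightarrow> final_state A M \<rho> p = x" for p x
      proof (cases "word M p = []")
        case True
        then have "events_on M p = {}" by (simp add: events_on_def)
        then show ?thesis unfolding final_state_def by simp
      next
        case False
        let ?l = "(p, length (word M p))"
        have l: "?l \<in> events M" "?l \<in> events_on M p" using last_event[OF False] by (auto simp: events_on_iff)
        have "e = ?l" if "e \<in> events_on M p" "\<not> (\<exists>f\<in>events M. (e, f) \<in> proc_rel M)" for e
        proof (rule ccontr)
          assume "e \<noteq> ?l"
          then have "(e, (p, Suc (snd e))) \<in> proc_rel M" using that(1) by (auto simp: proc_rel_iff events_on_def event_iff)
          then show False using that(2) proc_rel_iff by blast
        qed
        moreover have "\<not> (\<exists>f\<in>events M. (?l, f) \<in> proc_rel M)" by (auto simp: proc_rel_iff event_iff)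
        ultimately have "(\<exists>e\<in>events M. e \<in> events_on M p \<and> \<not> (\<exists>f\<in>events M. (e, f) \<in> proc_rel M) \<and> (\<exists>i\<in>S6 p x. e \<in> V (ix i))) \<longleftrightarrow>
           (\<exists>i\<in>S6 p x. ?l \<in> V (ix i))" using l by blast
        also have "\<dots> \<longleftrightarrow> target (\<rho> ?l) = x" using one[OF l(1) subs(5)] tr(1)[OF l(1)] by (simp add: S6_def)
        finally show ?thesis using l unfolding final_state_def by auto
      qed
      have "sat M v V \<psi>6 \<longleftrightarrow> (\<exists>s\<in>acc A. \<forall>p\<in>P. final_state A M \<rho> p = s p)"
        unfolding \<psi>6_def fs[symmetric] by (simp add: sat_Disj fin_acc sat_Conj finite_P fins sat_if_Fls)
      also have "\<dots> \<longleftrightarrow> (\<lambda>p\<in>P. final_state A M \<rho> p) \<in> acc A"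
      proof
        assume "\<exists>s\<in>acc A. \<forall>p\<in>P. final_state A M \<rho> p = s p"
        then obtain s where s: "s \<in> acc A" "\<forall>p\<in>P. final_state A M \<rho> p = s p" by blast
        \<comment> \<open>Members of \<open>acc A\<close> are extensional on \<open>P\<close>, so
          agreement on \<open>P\<close> is equality.\<close>
        have "acc A \<subseteq> (\<Pi>\<^sub>E p\<in>P. states A p)" using A unfolding is_cfm_def by blast
        then have "s \<in> extensional P" using s(1) by (auto simp: PiE_def)
        then have "(\<lambda>p\<in>P. final_state A M \<rho> p) = s" using s(2) by (intro extensionalityI[of _ P]) auto
        then show "(\<lambda>p\<in>P. final_state A M \<rho> p) \<in> acc A" using s(1) by simp
      next
        assume "(\<lambda>p\<in>P. final_state A M \<rho> p) \<in> acc A"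
        then show "\<exists>s\<in>acc A. \<forall>p\<in>P. final_state A M \<rho> p = s p" by (intro bexI) auto
      qed
      finally show ?thesis unfolding accepting_def .
    qed
    have s0: "\<forall>p. \<forall>e\<in>events_on M p. \<rho> e \<in> trans_on A p" using tr(2) by (auto simp: events_on_iff)
    show ?thesis unfolding \<psi>_def sat_And is_run_def using s0 s1 s1' s2 s3 s4 s5 s6 by blast
  qed
  have rep_ex: "\<exists>\<rho>. rep M V \<rho>" if M: "is_msc P Sig M" and s: "sat M v V \<psi>" for M v V
  proof -
    interpret msc_loc P Sig M using M by (rule msc_locI)
    have a: "sat M v V \<psi>1" "sat M v V \<psi>1'" using s unfolding \<psi>_def by auto
    have "\<exists>t. (fst e, t) \<in> TT \<and> e \<in> V (ix (fst e, t))" if e: "e \<in> events M" for e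
    proof -
      obtain i where "i \<in> TT" "e \<in> events_on M (fst i)" "e \<in> V (ix i)"
        using a(1) e unfolding \<psi>1_def by (auto simp: sat_Disj[OF fin])
      moreover from this have "i = (fst e, snd i)" by (auto simp: events_on_iff)
      ultimately show ?thesis by metis
    qed
    then obtain \<rho> where \<rho>: "\<And>e. e \<in> events M \<Longrightarrow> (fst e, \<rho> e) \<in> TT \<and> e \<in> V (ix (fst e, \<rho> e))" by metis
    have "i = j" if "e \<in> events M" "i \<in> TT" "j \<in> TT" "e \<in> V (ix i)" "e \<in> V (ix j)" for e i j
    proof (rule ccontr)
      assume "i \<noteq> j"
      then have "(i, j) \<in> {ij \<in> TT \<times> TT. fst ij \<noteq> snd ij}" using that by simp
      then have "sat M v V (AllFO 0 (Neg (And (InSet 0 (ix i)) (InSet 0 (ix j)))))"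
        using a(2) unfolding \<psi>1'_def sat_Conj[OF fin1'] by fastforce
      then show False using that by auto
    qed
    then have "rep M V \<rho>" unfolding rep_def using \<rho> by blast
    then show ?thesis by blast
  qed
  have "cfm_lang P Sig A = mso_lang P Sig \<phi>"
  proof (intro set_eqI iffI)
    fix M assume "M \<in> cfm_lang P Sig A"
    then obtain \<rho> where M: "is_msc P Sig M" and run: "is_run A M \<rho>" "accepting P A M \<rho>"
      unfolding cfm_lang_def by blast
    interpret msc_loc P Sig M using M by (rule msc_locI)
    have inTT: "(fst e, \<rho> e) \<in> TT" if "e \<in> events M" for e
      using run(1) that fst_event unfolding is_run_def TT_def by (auto simp: events_on_iff)
    have "sat M v V \<phi>" for v V
      unfolding \<phi>_def sat_foldr_ExSO
    proof (intro exI conjI)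
      let ?V = "\<lambda>X. if X < n then {e \<in> events M. X = ix (fst e, \<rho> e)} else V X"
      show "\<forall>X\<in>set [0..<n]. ?V X \<subseteq> events M" by auto
      show "\<forall>X. X \<notin> set [0..<n] \<longrightarrow> ?V X = V X" by auto
      have "rep M ?V \<rho>"
        unfolding rep_def
      proof (intro ballI conjI)
        fix e i assume e: "e \<in> events M" and i: "i \<in> TT"
        show "(e \<in> ?V (ix i)) = (i = (fst e, \<rho> e))"
          using e i ixn[OF i] inTT[OF e] inj_onD[OF ix(2), of i "(fst e, \<rho> e)"] by auto
      qed (rule inTT)
      then show "sat M v ?V \<psi>" using sem[OF M] run by blast
    qed
    then show "M \<in> mso_lang P Sig \<phi>" unfolding mso_lang_def using M by blast
  next
    fix M assume "M \<in> mso_lang P Sig \<phi>"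
    then have M: "is_msc P Sig M" and s: "\<And>v V. sat M v V \<phi>" unfolding mso_lang_def by auto
    obtain V where V: "sat M undefined V \<psi>"
      using s[of undefined "\<lambda>_. {}"] unfolding \<phi>_def sat_foldr_ExSO by blast
    obtain \<rho> where "rep M V \<rho>" using rep_ex[OF M V] by blast
    then show "M \<in> cfm_lang P Sig A" using sem[OF M] V M unfolding cfm_lang_def by blast
  qed
  then show ?thesis using sent emso by blast
qed

end

text \<open>Finite sets of states and messages embed into the numbers, so the type
  \<open>nat\<close> in the second half is no restriction.\<close>

theorem theorem7:
  fixes P :: "'p set" and Sig :: "'a set"
  assumes "finite P" and "finite Sig"
  shows "(\<forall>A :: ('p, 'a, 's, 'm) cfm. is_cfm P Sig A \<longrightarrow>
            (\<exists>\<phi>. sentence P Sig \<phi> \<and> emso2 {Proc_Edge, Msg_Edge, Causal_Le} \<phi> \<and>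
                 cfm_lang P Sig A = mso_lang P Sig \<phi>)) \<and>
         (\<forall>\<phi>. sentence P Sig \<phi> \<and> emso2 {Proc_Edge, Msg_Edge, Causal_Le} \<phi> \<longrightarrow>
            (\<exists>A :: ('p, 'a, nat, nat) cfm. is_cfm P Sig A \<and>
                 cfm_lang P Sig A = mso_lang P Sig \<phi>))"
proof -
  interpret alphabets P Sig by unfold_locales (use assms in auto)
  show ?thesis using cfm_to_emso2 emso2_to_cfm by blast
qed

end
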